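(* Let $(M,J,g,\theta)$ be a Vaisman manifold with transverse Kähler form $\omega_0$, and consider the set $$C(M,J,\omega_0)=\{\zeta\in\mathcal A^1_B(M,\mathbb R) : \omega_0-d\zeta>0 \text{ with respect to } J\}.$$ Then there is a bijection $C(M,J,\omega_0)\to\mathcal V(J,g,\theta)$.
   Context: All manifolds are connected and compact. Vaisman structures. Let $(M,J,g)$ be a Hermitian manifold of complex dimension $\ge 2$ with fundamental form $\omega=g(J\cdot,\cdot)$. If there is a closed $1$-form $\theta$ with $d\omega=\theta\wedge\omega$, then $(J,\omega,\theta)$ (equivalently $(J,g,\theta)$) is a locally conformally Kähler structure; it is Vaisman if $\theta$ is parallel for the Levi-Civita connection of $g$. It is always assumed that $\theta$ is not exact and $|\theta|_g=1$. Put $U=\theta^{\#}$, $V=JU$, $\theta^c=J\theta=-\theta\circ J$ (the $g$-dual of $V$). The fields $U,V$ span the characteristic foliation $\Sigma$, which is transversely Kähler with transverse Kähler form $\omega_0=-d\theta^c$. Let $N=T\Sigma^\perp$, and let $\bar J$ be the complex structure induced by $J$ on $TM/T\Sigma$. The set $\mathcal V(J,g,\theta)$ of Vaisman deformations of $(J,g,\theta)$ is $$\mathcal V(J,g,\theta)=\{\text{Vaisman structures }(J',g',\theta')\text{ on }M : \theta'=\theta,\ U'=U,\ V'=V,\ \bar J'=\bar J\},$$ where $U'=(\theta')^{\#}$ with respect to $g'$, $V'=J'U'$, and $\bar J'$ is induced by $J'$ on $TM/T\Sigma$. Basic forms and positivity. $\mathcal A_B^1(M,\mathbb R)$ is the space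 of real $1$-forms $\zeta$ with $\iota_X\zeta=0$ and $\mathcal L_X\zeta=0$ for all $X$ tangent to $\Sigma$; basic $2$-forms are defined by the same two conditions. A basic $(1,1)$-form $\alpha$ (that is, a basic real $2$-form with $\alpha(JX,JY)=\alpha(X,Y)$) is positive-definite with respect to $J$, written $\alpha>0$ with respect to $J$, if $\alpha(X,JX)>0$ for all nonzero $X\in N$. *)

theory Defs
  imports "HOL-Analysis.Analysis" "HOL-Library.Function_Algebras"
begin

section \<open>Smooth manifolds\<close>

primrec Ck_on :: "nat \<Rightarrow> 'a::euclidean_space set \<Rightarrow> ('a \<Rightarrow> 'b::euclidean_space) \<Rightarrow> bool" where
  "Ck_on 0 S f \<longleftrightarrow> continuous_on S f"
| "Ck_on (Suc k) S f \<longleftrightarrow> (\<forall>x\<in>S. f differentiable (at x)) \<and>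
     (\<forall>v. Ck_on k S (\<lambda>x. frechet_derivative f (at x) v))"

text \<open>Only used for open \<open>S\<close>.\<close>

definition smooth_on :: "'a::euclidean_space set \<Rightarrow> ('a \<Rightarrow> 'b::euclidean_space) \<Rightarrow> bool" where
  "smooth_on S f \<longleftrightarrow> (\<forall>k. Ck_on k S f)"

text \<open>
  The underlying space of the manifold is a whole type \<open>'m\<close> (Hausdorff and second countable), and
  its dimension is \<open>DIM('e)\<close>. A chart is a pair of its domain and its coordinate map; the map is
  irrelevant outside the domain. Atlases are not required to be maximal.
\<close>

type_synonym ('m, 'e) chart = "'m set \<times> ('m \<Rightarrow> 'e)"

definition is_chart :: "('m::topological_space, 'e::euclidean_space) chart \<Rightarrow> bool" where
  "is_chart c \<longleftrightarrow> (case c of (D, \<phi>) \<Rightarrow>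
     open D \<and> open (\<phi> ` D) \<and> homeomorphism D (\<phi> ` D) \<phi> (inv_into D \<phi>))"

definition smooth_atlas ::
  "('m::{t2_space, second_countable_topology}, 'e::euclidean_space) chart set \<Rightarrow> bool" where
  "smooth_atlas A \<longleftrightarrow> (\<forall>c\<in>A. is_chart c) \<and> (\<Union>c\<in>A. fst c) = UNIV \<and>
     (\<forall>(D, \<phi>)\<in>A. \<forall>(E, \<psi>)\<in>A. smooth_on (\<phi> ` (D \<inter> E)) (\<psi> \<circ> inv_into D \<phi>))"

definition smooth_funs ::
  "('m::{t2_space, second_countable_topology}, 'e::euclidean_space) chart set \<Rightarrow> ('m \<Rightarrow> real) set" where
  "smooth_funs A = {f. \<forall>(D, \<phi>)\<in>A. smooth_on (\<phi> ` D) (f \<circ> inv_into D \<phi>)}"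


section \<open>Vector fields and tensor fields\<close>

text \<open>
  Vector fields are the derivations of the algebra of smooth functions, and tensor fields are the
  maps on vector fields that are multilinear over the smooth functions. The tangent vector at \<open>p\<close> of
  a field \<open>X\<close> is the derivation \<open>\<lambda>f. X f p\<close> at \<open>p\<close>; every tangent vector arises in this way from
  some global field, so pointwise conditions on tangent vectors are expressed by quantifying over
  all fields and all points.

  So that equality of these objects is the intended one, all of them take the value 0 outside their
  domain (at non-smooth functions, and at arguments that are not vector fields).
\<close>

type_synonym 'm vf = "('m \<Rightarrow> real) \<Rightarrow> 'm \<Rightarrow> real"
type_synonym 'm form1 = "'m vf \<Rightarrow> 'm \<Rightarrow> real"
type_synonym 'm form2 = "'m vf \<Rightarrow> 'm vf \<Rightarrow> 'm \<Rightarrow> real"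
type_synonym 'm form3 = "'m vf \<Rightarrow> 'm vf \<Rightarrow> 'm vf \<Rightarrow> 'm \<Rightarrow> real"
type_synonym 'm endo = "'m vf \<Rightarrow> 'm vf"

definition vector_fields ::
  "('m::{t2_space, second_countable_topology}, 'e::euclidean_space) chart set \<Rightarrow> 'm vf set" where
  "vector_fields A = {X.
     (\<forall>f\<in>smooth_funs A. X f \<in> smooth_funs A) \<and>
     (\<forall>f\<in>smooth_funs A. \<forall>g\<in>smooth_funs A. X (f + g) = X f + X g) \<and>
     (\<forall>c. \<forall>f\<in>smooth_funs A. X (\<lambda>p. c * f p) = (\<lambda>p. c * X f p)) \<and>
     (\<forall>f\<in>smooth_funs A. \<forall>g\<in>smooth_funs A. X (f * g) = f * X g + X f * g) \<and>
     (\<forall>f. f \<notin> smooth_funs A \<longrightarrow> X f = 0)}"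

definition smul :: "('m \<Rightarrow> real) \<Rightarrow> 'm vf \<Rightarrow> 'm vf"  (infixr \<open>\<cdot>\<^sub>v\<close> 75) where
  "f \<cdot>\<^sub>v X = (\<lambda>h. f * X h)"

definition bracket :: "'m vf \<Rightarrow> 'm vf \<Rightarrow> 'm vf" where
  "bracket X Y = (\<lambda>f. X (Y f) - Y (X f))"

definition one_forms ::
  "('m::{t2_space, second_countable_topology}, 'e::euclidean_space) chart set \<Rightarrow> 'm form1 set" where
  "one_forms A = {\<alpha>.
     (\<forall>X\<in>vector_fields A. \<alpha> X \<in> smooth_funs A) \<and>
     (\<forall>X\<in>vector_fields A. \<forall>Y\<in>vector_fields A. \<alpha> (X + Y) = \<alpha> X + \<alpha> Y) \<and>
     (\<forall>f\<in>smooth_funs A. \<forall>X\<in>vector_fields A. \<alpha> (f \<cdot>\<^sub>v X) = f * \<alpha> X) \<and>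
     (\<forall>X. X \<notin> vector_fields A \<longrightarrow> \<alpha> X = 0)}"

definition bilinear_forms ::
  "('m::{t2_space, second_countable_topology}, 'e::euclidean_space) chart set \<Rightarrow> 'm form2 set" where
  "bilinear_forms A = {\<beta>. (\<forall>X. \<beta> X \<in> one_forms A) \<and> (\<forall>Y. (\<lambda>X. \<beta> X Y) \<in> one_forms A)}"

definition two_forms ::
  "('m::{t2_space, second_countable_topology}, 'e::euclidean_space) chart set \<Rightarrow> 'm form2 set" where
  "two_forms A = {\<beta>\<in>bilinear_forms A. \<forall>X Y. \<beta> Y X = - \<beta> X Y}"

definition endos ::
  "('m::{t2_space, second_countable_topology}, 'e::euclidean_space) chart set \<Rightarrow> 'm endo set" where
  "endos A = {J.
     (\<forall>X\<in>vector_fields A. J X \<in> vector_fields A) \<and>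
     (\<forall>X\<in>vector_fields A. \<forall>Y\<in>vector_fields A. J (X + Y) = J X + J Y) \<and>
     (\<forall>f\<in>smooth_funs A. \<forall>X\<in>vector_fields A. J (f \<cdot>\<^sub>v X) = f \<cdot>\<^sub>v J X) \<and>
     (\<forall>X. X \<notin> vector_fields A \<longrightarrow> J X = 0)}"

text \<open>
  Exterior derivatives and wedge products, without normalising factors. The guards give the value
  0 at arguments that are not vector fields.
\<close>

definition d0 ::
  "('m::{t2_space, second_countable_topology}, 'e::euclidean_space) chart set
     \<Rightarrow> ('m \<Rightarrow> real) \<Rightarrow> 'm form1" where
  "d0 A f = (\<lambda>X. if X \<in> vector_fields A then X f else 0)"

definition d1 ::
  "('m::{t2_space, second_countable_topology}, 'e::euclidean_space) chart set
     \<Rightarrow> 'm form1 \<Rightarrow> 'm form2" where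
  "d1 A \<alpha> = (\<lambda>X Y. if X \<in> vector_fields A \<and> Y \<in> vector_fields A
     then X (\<alpha> Y) - Y (\<alpha> X) - \<alpha> (bracket X Y) else 0)"

definition d2 ::
  "('m::{t2_space, second_countable_topology}, 'e::euclidean_space) chart set
     \<Rightarrow> 'm form2 \<Rightarrow> 'm form3" where
  "d2 A \<beta> = (\<lambda>X Y Z.
     if X \<in> vector_fields A \<and> Y \<in> vector_fields A \<and> Z \<in> vector_fields A
     then X (\<beta> Y Z) - Y (\<beta> X Z) + Z (\<beta> X Y)
        - \<beta> (bracket X Y) Z + \<beta> (bracket X Z) Y - \<beta> (bracket Y Z) X
     else 0)"

definition wedge12 :: "'m form1 \<Rightarrow> 'm form2 \<Rightarrow> 'm form3" where
  "wedge12 \<alpha> \<beta> = (\<lambda>X Y Z. \<alpha> X * \<beta> Y Z - \<alpha> Y * \<beta> X Z + \<alpha> Z * \<beta> X Y)"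

definition lie1 :: "'m vf \<Rightarrow> 'm form1 \<Rightarrow> 'm form1" where
  "lie1 X \<alpha> = (\<lambda>Y. X (\<alpha> Y) - \<alpha> (bracket X Y))"

definition lie2 :: "'m vf \<Rightarrow> 'm form2 \<Rightarrow> 'm form2" where
  "lie2 X \<beta> = (\<lambda>Y Z. X (\<beta> Y Z) - \<beta> (bracket X Y) Z - \<beta> Y (bracket X Z))"


section \<open>Riemannian and Hermitian structures\<close>

definition nonzero_at :: "'m vf \<Rightarrow> 'm \<Rightarrow> bool" where
  "nonzero_at X p \<longleftrightarrow> (\<exists>f. X f p \<noteq> 0)"

definition riemannian_metric ::
  "('m::{t2_space, second_countable_topology}, 'e::euclidean_space) chart set \<Rightarrow> 'm form2 \<Rightarrow> bool" where
  "riemannian_metric A g \<longleftrightarrow> g \<in> bilinear_forms A \<and> (\<forall>X Y. g X Y = g Y X) \<and>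
     (\<forall>X\<in>vector_fields A. \<forall>p. nonzero_at X p \<longrightarrow> g X X p > 0)"

definition sharp ::
  "('m::{t2_space, second_countable_topology}, 'e::euclidean_space) chart set
     \<Rightarrow> 'm form2 \<Rightarrow> 'm form1 \<Rightarrow> 'm vf" where
  "sharp A g \<alpha> = (THE U. U \<in> vector_fields A \<and> (\<forall>X\<in>vector_fields A. g U X = \<alpha> X))"

definition form_norm ::
  "('m::{t2_space, second_countable_topology}, 'e::euclidean_space) chart set
     \<Rightarrow> 'm form2 \<Rightarrow> 'm form1 \<Rightarrow> 'm \<Rightarrow> real" where
  "form_norm A g \<alpha> p = sqrt (g (sharp A g \<alpha>) (sharp A g \<alpha>) p)"

definition affine_connection ::
  "('m::{t2_space, second_countable_topology}, 'e::euclidean_space) chart set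
     \<Rightarrow> ('m vf \<Rightarrow> 'm vf \<Rightarrow> 'm vf) \<Rightarrow> bool" where
  "affine_connection A D \<longleftrightarrow>
     (\<forall>X\<in>vector_fields A. \<forall>Y\<in>vector_fields A. D X Y \<in> vector_fields A) \<and>
     (\<forall>X\<in>vector_fields A. \<forall>Y\<in>vector_fields A. \<forall>Z\<in>vector_fields A.
        D (X + Y) Z = D X Z + D Y Z \<and> D X (Y + Z) = D X Y + D X Z) \<and>
     (\<forall>f\<in>smooth_funs A. \<forall>X\<in>vector_fields A. \<forall>Y\<in>vector_fields A.
        D (f \<cdot>\<^sub>v X) Y = f \<cdot>\<^sub>v D X Y \<and> D X (f \<cdot>\<^sub>v Y) = X f \<cdot>\<^sub>v Y + f \<cdot>\<^sub>v D X Y)"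

definition levi_civita ::
  "('m::{t2_space, second_countable_topology}, 'e::euclidean_space) chart set
     \<Rightarrow> 'm form2 \<Rightarrow> ('m vf \<Rightarrow> 'm vf \<Rightarrow> 'm vf) \<Rightarrow> bool" where
  "levi_civita A g D \<longleftrightarrow> affine_connection A D \<and>
     (\<forall>X\<in>vector_fields A. \<forall>Y\<in>vector_fields A. D X Y - D Y X = bracket X Y) \<and>
     (\<forall>X\<in>vector_fields A. \<forall>Y\<in>vector_fields A. \<forall>Z\<in>vector_fields A.
        X (g Y Z) = g (D X Y) Z + g Y (D X Z))"

definition parallel_form ::
  "('m::{t2_space, second_countable_topology}, 'e::euclidean_space) chart set
     \<Rightarrow> ('m vf \<Rightarrow> 'm vf \<Rightarrow> 'm vf) \<Rightarrow> 'm form1 \<Rightarrow> bool" where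
  "parallel_form A D \<alpha> \<longleftrightarrow>
     (\<forall>X\<in>vector_fields A. \<forall>Y\<in>vector_fields A. X (\<alpha> Y) - \<alpha> (D X Y) = 0)"

text \<open>Integrability of an almost complex structure is the vanishing of its Nijenhuis tensor.\<close>

definition complex_structure ::
  "('m::{t2_space, second_countable_topology}, 'e::euclidean_space) chart set \<Rightarrow> 'm endo \<Rightarrow> bool" where
  "complex_structure A J \<longleftrightarrow> J \<in> endos A \<and>
     (\<forall>X\<in>vector_fields A. J (J X) = - X) \<and>
     (\<forall>X\<in>vector_fields A. \<forall>Y\<in>vector_fields A.
        bracket (J X) (J Y) - J (bracket (J X) Y) - J (bracket X (J Y)) - bracket X Y = 0)"

definition hermitian_structure ::
  "('m::{t2_space, second_countable_topology}, 'e::euclidean_space) chart set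
     \<Rightarrow> 'm endo \<Rightarrow> 'm form2 \<Rightarrow> bool" where
  "hermitian_structure A J g \<longleftrightarrow> complex_structure A J \<and> riemannian_metric A g \<and>
     (\<forall>X\<in>vector_fields A. \<forall>Y\<in>vector_fields A. g (J X) (J Y) = g X Y)"

definition fundamental_form :: "'m endo \<Rightarrow> 'm form2 \<Rightarrow> 'm form2" where
  "fundamental_form J g = (\<lambda>X Y. g (J X) Y)"


section \<open>Vaisman structures\<close>

text \<open>\<open>DIM('e) div 2\<close> is the complex dimension; \<open>DIM('e)\<close> is even as soon as \<open>J\<close> exists.\<close>

definition lck_structure ::
  "('m::{t2_space, second_countable_topology}, 'e::euclidean_space) chart set
     \<Rightarrow> 'm endo \<Rightarrow> 'm form2 \<Rightarrow> 'm form1 \<Rightarrow> bool" where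
  "lck_structure A J g \<theta> \<longleftrightarrow>
     DIM('e) div 2 \<ge> 2 \<and> hermitian_structure A J g \<and>
     \<theta> \<in> one_forms A \<and> d1 A \<theta> = 0 \<and>
     d2 A (fundamental_form J g) = wedge12 \<theta> (fundamental_form J g)"

definition vaisman_structure ::
  "('m::{t2_space, second_countable_topology}, 'e::euclidean_space) chart set
     \<Rightarrow> 'm endo \<Rightarrow> 'm form2 \<Rightarrow> 'm form1 \<Rightarrow> bool" where
  "vaisman_structure A J g \<theta> \<longleftrightarrow>
     lck_structure A J g \<theta> \<and>
     (\<exists>D. levi_civita A g D \<and> parallel_form A D \<theta>) \<and>
     \<not> (\<exists>f\<in>smooth_funs A. \<theta> = d0 A f) \<and>
     (\<forall>p. form_norm A g \<theta> p = 1)"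

definition field_U ::
  "('m::{t2_space, second_countable_topology}, 'e::euclidean_space) chart set
     \<Rightarrow> 'm form2 \<Rightarrow> 'm form1 \<Rightarrow> 'm vf" where
  "field_U A g \<theta> = sharp A g \<theta>"

definition field_V ::
  "('m::{t2_space, second_countable_topology}, 'e::euclidean_space) chart set
     \<Rightarrow> 'm endo \<Rightarrow> 'm form2 \<Rightarrow> 'm form1 \<Rightarrow> 'm vf" where
  "field_V A J g \<theta> = J (field_U A g \<theta>)"

definition theta_c :: "'m endo \<Rightarrow> 'm form1 \<Rightarrow> 'm form1" where
  "theta_c J \<theta> = (\<lambda>X. - \<theta> (J X))"

definition omega0 ::
  "('m::{t2_space, second_countable_topology}, 'e::euclidean_space) chart set
     \<Rightarrow> 'm endo \<Rightarrow> 'm form1 \<Rightarrow> 'm form2" where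
  "omega0 A J \<theta> = - d1 A (theta_c J \<theta>)"

text \<open>The fields tangent to the characteristic foliation \<open>\<Sigma>\<close>.\<close>

definition sigma_fields ::
  "('m::{t2_space, second_countable_topology}, 'e::euclidean_space) chart set
     \<Rightarrow> 'm endo \<Rightarrow> 'm form2 \<Rightarrow> 'm form1 \<Rightarrow> 'm vf set" where
  "sigma_fields A J g \<theta> = {X\<in>vector_fields A.
     \<forall>p. \<exists>a b. \<forall>f. X f p = a * field_U A g \<theta> f p + b * field_V A J g \<theta> f p}"

text \<open>\<open>X\<close> lies at \<open>p\<close> in the fibre of \<open>N = T\<Sigma>\<^sup>\<bottom>\<close>.\<close>

definition normal_at ::
  "('m::{t2_space, second_countable_topology}, 'e::euclidean_space) chart set
     \<Rightarrow> 'm endo \<Rightarrow> 'm form2 \<Rightarrow> 'm form1 \<Rightarrow> 'm vf \<Rightarrow> 'm \<Rightarrow> bool" where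
  "normal_at A J g \<theta> X p \<longleftrightarrow> g X (field_U A g \<theta>) p = 0 \<and> g X (field_V A J g \<theta>) p = 0"

definition basic_one_forms ::
  "('m::{t2_space, second_countable_topology}, 'e::euclidean_space) chart set
     \<Rightarrow> 'm endo \<Rightarrow> 'm form2 \<Rightarrow> 'm form1 \<Rightarrow> 'm form1 set" where
  "basic_one_forms A J g \<theta> = {\<zeta>\<in>one_forms A.
     \<forall>X\<in>sigma_fields A J g \<theta>. \<zeta> X = 0 \<and> (\<forall>Y\<in>vector_fields A. lie1 X \<zeta> Y = 0)}"

definition basic_two_forms ::
  "('m::{t2_space, second_countable_topology}, 'e::euclidean_space) chart set
     \<Rightarrow> 'm endo \<Rightarrow> 'm form2 \<Rightarrow> 'm form1 \<Rightarrow> 'm form2 set" where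
  "basic_two_forms A J g \<theta> = {\<beta>\<in>two_forms A.
     \<forall>X\<in>sigma_fields A J g \<theta>. \<beta> X = 0 \<and>
       (\<forall>Y\<in>vector_fields A. \<forall>Z\<in>vector_fields A. lie2 X \<beta> Y Z = 0)}"

definition basic_11_forms ::
  "('m::{t2_space, second_countable_topology}, 'e::euclidean_space) chart set
     \<Rightarrow> 'm endo \<Rightarrow> 'm form2 \<Rightarrow> 'm form1 \<Rightarrow> 'm form2 set" where
  "basic_11_forms A J g \<theta> = {\<alpha>\<in>basic_two_forms A J g \<theta>.
     \<forall>X\<in>vector_fields A. \<forall>Y\<in>vector_fields A. \<alpha> (J X) (J Y) = \<alpha> X Y}"

text \<open>Positivity is a notion for basic (1,1)-forms, so it includes being of that type.\<close>

definition positive_wrt ::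
  "('m::{t2_space, second_countable_topology}, 'e::euclidean_space) chart set
     \<Rightarrow> 'm endo \<Rightarrow> 'm form2 \<Rightarrow> 'm form1 \<Rightarrow> 'm form2 \<Rightarrow> bool" where
  "positive_wrt A J g \<theta> \<alpha> \<longleftrightarrow> \<alpha> \<in> basic_11_forms A J g \<theta> \<and>
     (\<forall>X\<in>vector_fields A. \<forall>p. normal_at A J g \<theta> X p \<and> nonzero_at X p \<longrightarrow> \<alpha> X (J X) p > 0)"

text \<open>
  \<open>C(M, J, \<omega>\<^sub>0)\<close>; the metric and the Lee form enter through \<open>\<omega>\<^sub>0\<close>, \<open>\<Sigma>\<close> and \<open>N\<close>.
\<close>

definition deformation_forms ::
  "('m::{t2_space, second_countable_topology}, 'e::euclidean_space) chart set
     \<Rightarrow> 'm endo \<Rightarrow> 'm form2 \<Rightarrow> 'm form1 \<Rightarrow> 'm form1 set" where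
  "deformation_forms A J g \<theta> = {\<zeta>\<in>basic_one_forms A J g \<theta>.
     positive_wrt A J g \<theta> (omega0 A J \<theta> - d1 A \<zeta>)}"

text \<open>
  \<open>\<V>(J, g, \<theta>)\<close>. Once \<open>U' = U\<close> and \<open>V' = V\<close>, both structures have the same \<open>\<Sigma>\<close>, and the
  structures induced on \<open>TM / T\<Sigma>\<close> agree iff \<open>J' X - J X\<close> is tangent to \<open>\<Sigma>\<close> for every field \<open>X\<close>.
\<close>

definition vaisman_deformations ::
  "('m::{t2_space, second_countable_topology}, 'e::euclidean_space) chart set
     \<Rightarrow> 'm endo \<Rightarrow> 'm form2 \<Rightarrow> 'm form1 \<Rightarrow> ('m endo \<times> 'm form2 \<times> 'm form1) set" where
  "vaisman_deformations A J g \<theta> = {(J', g', \<theta>'). vaisman_structure A J' g' \<theta>' \<and>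
     \<theta>' = \<theta> \<and> field_U A g' \<theta>' = field_U A g \<theta> \<and> field_V A J' g' \<theta>' = field_V A J g \<theta> \<and>
     (\<forall>X\<in>vector_fields A. J' X - J X \<in> sigma_fields A J g \<theta>)}"

end

theory Submission
  imports Defs
begin

text \<open>
  A basic form \<open>\<zeta>\<close> deforms \<open>\<theta>\<^sup>c\<close> into \<open>\<alpha> = \<theta>\<^sup>c + \<zeta>\<close>. As \<open>J' U = V\<close>, \<open>\<alpha> = - \<theta> \<circ> J'\<close> and the transverse complex
  structure is kept, this forces \<open>J' X = J X - \<zeta>(X) U - \<zeta>(J X) V\<close>; and as the fundamental form of any
  Vaisman structure is \<open>\<theta> \<and> \<theta>\<^sup>c - d\<theta>\<^sup>c\<close>, also \<open>g' = \<theta> \<otimes> \<theta> + \<alpha> \<otimes> \<alpha> - d\<alpha>(\<cdot>, J' \<cdot>)\<close>. Conversely these formulas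
  define a Vaisman structure: \<open>J'\<close> is integrable because \<open>d\<zeta>\<close> is basic of type (1,1), \<open>g'\<close> is positive because
  \<open>\<omega>\<^sub>0 - d\<zeta>\<close> is, and \<open>\<theta>\<close> is parallel because it is closed and \<open>U\<close> is Killing for \<open>g'\<close>.

  The only input from analysis is that the fields form a finitely generated projective module over the
  smooth functions: there are finitely many \<open>E\<^sub>i\<close> and \<open>u\<^sub>i\<close> with \<open>X = \<Sum>\<^sub>i X(u\<^sub>i) E\<^sub>i\<close> for every field \<open>X\<close>. This
  makes one-forms tensorial and yields the musical isomorphism, hence the Levi-Civita connection of \<open>g'\<close>.
\<close>

subsection \<open>Smooth maps between Euclidean spaces\<close>

text \<open>The two coefficients of J' - J come from different sources: the U part is read off by
  applying \<theta> to J'X, the V part by applying \<open>\<theta>c\<close>, once it is known that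
  \<zeta>(J'X) = \<zeta>(JX), which holds because J'X - JX is tangent to the foliation and \<zeta>
  vanishes there. The construction closes up because U and V commute, preserve J and lie in the
  kernel of the derivative of \<open>\<theta>c\<close>; for a given Vaisman structure this has to be
  extracted from the parallel Lee form, the lck equation and the Nijenhuis tensor together. The
  obstacle is that fields are derivations of a function algebra, so there are no tangent spaces in
  which to do linear algebra. Inverting a metric, splitting off the part of a field along U and V,
  or evaluating a form at a point must be done by formulas with smooth coefficients, and the dual
  basis permits this; compactness makes it finite. Near a point it cannot come from coordinates
  alone, as these are not global functions: the cutoff that globalises them gets differentiated as
  well, which explains the additional generator and the third power of the cutoff.\<close>

lemma Ck_on_cong:
  assumes "open S" "\<And>x. x \<in> S \<Longrightarrow> f x = g x" "Ck_on k S f"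
  shows "Ck_on k S g"
  using assms(2,3)
proof (induction k arbitrary: f g)
  case 0
  then show ?case by (auto cong: continuous_on_cong)
next
  case (Suc k)
  have fd: "frechet_derivative f (at x) = frechet_derivative g (at x)" if "x \<in> S" for x
    using Suc.prems that assms(1) by (intro frechet_derivative_transform_within_open[of f x S g]) auto
  have "g differentiable (at x)" if "x \<in> S" for x
  proof -
    have "(f has_derivative frechet_derivative f (at x)) (at x)"
      using Suc.prems that frechet_derivative_works by auto
    then have "(g has_derivative frechet_derivative f (at x)) (at x)"
      using assms(1) that Suc.prems(1) by (rule has_derivative_transform_within_open)
    then show ?thesis by (auto simp: differentiable_def)
  qed
  moreover have "Ck_on k S (\<lambda>x. frechet_derivative g (at x) v)" for v
    by (rule Suc.IH[of "\<lambda>x. frechet_derivative f (at x) v"]) (use Suc.prems in \<open>auto simp: fd\<close>)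
  ultimately show ?case by simp
qed

lemma Ck_on_subset: "Ck_on k T f \<Longrightarrow> S \<subseteq> T \<Longrightarrow> Ck_on k S f"
  by (induction k arbitrary: f) (auto intro: continuous_on_subset)

lemma Ck_on_local:
  assumes "\<And>x. x \<in> S \<Longrightarrow> \<exists>T. open T \<and> x \<in> T \<and> Ck_on k T f"
  shows "Ck_on k S f"
  using assms
proof (induction k arbitrary: f)
  case 0
  have "continuous (at x within S) f" if x: "x \<in> S" for x
  proof -
    obtain T where "open T" "x \<in> T" "continuous_on T f" using 0[OF x] by auto
    then show ?thesis
      by (meson continuous_at_imp_continuous_at_within continuous_on_eq_continuous_at)
  qed
  then show ?case by (simp add: continuous_on_eq_continuous_within)
next
  case (Suc k)
  have "Ck_on k S (\<lambda>x. frechet_derivative f (at x) v)" for v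
  proof (rule Suc.IH)
    fix x assume "x \<in> S"
    then obtain T where "open T" "x \<in> T" "Ck_on (Suc k) T f" using Suc.prems by blast
    then show "\<exists>T. open T \<and> x \<in> T \<and> Ck_on k T (\<lambda>x. frechet_derivative f (at x) v)" by auto
  qed
  moreover have "f differentiable (at x)" if "x \<in> S" for x
    using Suc.prems[OF that] by (metis Ck_on.simps(2))
  ultimately show ?case by simp
qed

text \<open>\<open>Ck_on\<close> is defined through \<open>frechet_derivative\<close>, which is a
  choice term. On an open set any exhibited derivative may take its place, so closure proofs only
  have to supply a formula.\<close>

lemma Ck_on_SucI:
  assumes "open S" "\<And>x. x \<in> S \<Longrightarrow> (f has_derivative f' x) (at x)" "\<And>v. Ck_on k S (\<lambda>x. f' x v)"
  shows "Ck_on (Suc k) S f"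
proof -
  have "frechet_derivative f (at x) = f' x" if "x \<in> S" for x
    using assms(2)[OF that] frechet_derivative_at by fastforce
  then have "Ck_on k S (\<lambda>x. frechet_derivative f (at x) v)" for v
    by (intro Ck_on_cong[OF assms(1) _ assms(3)[of v]]) simp
  then show ?thesis using assms(2) by (auto simp: differentiable_def)
qed

lemma Ck_on_has_derivative:
  assumes "Ck_on (Suc k) S f" "x \<in> S"
  shows "(f has_derivative frechet_derivative f (at x)) (at x)"
  using assms frechet_derivative_works by auto

lemma Ck_on_continuous: "Ck_on k S f \<Longrightarrow> continuous_on S f"
  by (cases k) (auto intro!: continuous_at_imp_continuous_on differentiable_imp_continuous_within)

lemma Ck_on_Suc_imp: "Ck_on (Suc k) S f \<Longrightarrow> Ck_on k S f"
proof (induction k arbitrary: f)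
  case 0
  then show ?case using Ck_on_continuous by (metis Ck_on.simps(1))
qed auto

lemma Ck_on_const: "Ck_on k S (\<lambda>x. c)"
  by (induction k arbitrary: c) auto

lemma Ck_on_add:
  assumes "open S" "Ck_on k S f" "Ck_on k S g"
  shows "Ck_on k S (\<lambda>x. f x + g x)"
  using assms(2,3)
proof (induction k arbitrary: f g)
  case (Suc k)
  show ?case
    by (rule Ck_on_SucI[OF assms(1), where f' = "\<lambda>x v. frechet_derivative f (at x) v + frechet_derivative g (at x) v"])
      (use Suc in \<open>auto intro!: has_derivative_add Ck_on_has_derivative\<close>)
qed (auto intro: continuous_intros)

lemma Ck_on_sum:
  assumes "open S" "\<And>i. i \<in> I \<Longrightarrow> Ck_on k S (f i)"
  shows "Ck_on k S (\<lambda>x. \<Sum>i\<in>I. f i x)"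
proof (cases "finite I")
  case True
  then show ?thesis using assms(2)
    by (induction I) (auto intro!: Ck_on_const Ck_on_add[OF assms(1)])
qed (simp add: Ck_on_const)

lemma Ck_on_linear_comp:
  assumes "open S" "bounded_linear h" "Ck_on k S f"
  shows "Ck_on k S (\<lambda>x. h (f x))"
  using assms(3)
proof (induction k arbitrary: f)
  case 0
  then show ?case using assms(2) linear_continuous_on_compose by (auto intro: bounded_linear.continuous_on)
next
  case (Suc k)
  show ?case
    by (rule Ck_on_SucI[OF assms(1), where f' = "\<lambda>x v. h (frechet_derivative f (at x) v)"])
      (use Suc in \<open>auto intro!: bounded_linear.has_derivative[OF assms(2)] Ck_on_has_derivative\<close>)
qed

lemma Ck_on_id: "Ck_on k S (\<lambda>x. x)"
proof (cases k)
  case (Suc j)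
  have "frechet_derivative (\<lambda>x::'a. x) (at x) = (\<lambda>v. v)" for x
    using frechet_derivative_at[OF has_derivative_ident] by metis
  then show ?thesis using Suc by (simp add: Ck_on_const)
qed (simp add: continuous_on_id)

lemma Ck_on_bilinear:
  assumes "open S" "bounded_bilinear h" "Ck_on k S f" "Ck_on k S g"
  shows "Ck_on k S (\<lambda>x. h (f x) (g x))"
  using assms(3,4)
proof (induction k arbitrary: f g)
  case 0
  then show ?case using assms(2) by (auto intro: bounded_bilinear.continuous_on)
next
  case (Suc k)
  show ?case
  proof (rule Ck_on_SucI[OF assms(1), where f' = "\<lambda>x v. h (f x) (frechet_derivative g (at x) v)
       + h (frechet_derivative f (at x) v) (g x)"])
    show "((\<lambda>x. h (f x) (g x)) has_derivative (\<lambda>v. h (f x) (frechet_derivative g (at x) v)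
       + h (frechet_derivative f (at x) v) (g x))) (at x)" if "x \<in> S" for x
      using Suc.prems that by (intro bounded_bilinear.FDERIV[OF assms(2)]) (auto intro: Ck_on_has_derivative)
    show "Ck_on k S (\<lambda>x. h (f x) (frechet_derivative g (at x) v) + h (frechet_derivative f (at x) v) (g x))" for v
      by (intro Ck_on_add assms(1) Suc.IH) (use Suc.prems Ck_on_Suc_imp in auto)
  qed
qed

lemma Ck_on_compose:
  fixes f :: "'b::euclidean_space \<Rightarrow> 'c::euclidean_space"
  assumes "open S" "Ck_on k T f" "Ck_on k S g" "g ` S \<subseteq> T"
  shows "Ck_on k S (\<lambda>x. f (g x))"
  using assms(2,3)
proof (induction k arbitrary: f)
  case 0
  then show ?case using assms(4) by (auto intro: continuous_on_compose2)
next
  case (Suc k)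
  \<comment> \<open>In the chain rule both the base point and the direction vary with
    \<open>x\<close>, whereas \<open>Ck_on\<close> controls the derivative of \<open>f\<close> in
    fixed directions only. Expanding the direction in the basis separates the two
    dependencies.\<close>
  let ?f' = "\<lambda>x v. \<Sum>b\<in>Basis. (frechet_derivative g (at x) v \<bullet> b) *\<^sub>R frechet_derivative f (at (g x)) b"
  show ?case
  proof (rule Ck_on_SucI[OF assms(1), where f' = ?f'])
    fix x assume x: "x \<in> S"
    have f: "(f has_derivative frechet_derivative f (at (g x))) (at (g x))"
      using Suc.prems(1) x assms(4) by (intro Ck_on_has_derivative) auto
    have chain: "((\<lambda>x. f (g x)) has_derivative (\<lambda>v. frechet_derivative f (at (g x)) (frechet_derivative g (at x) v))) (at x)"
      using has_derivative_compose[OF Ck_on_has_derivative[OF Suc.prems(2) x] f] .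
    have expand: "frechet_derivative f (at (g x)) w = (\<Sum>b\<in>Basis. (w \<bullet> b) *\<^sub>R frechet_derivative f (at (g x)) b)" for w
    proof -
      interpret bounded_linear "frechet_derivative f (at (g x))" using f by (rule has_derivative_bounded_linear)
      have "frechet_derivative f (at (g x)) (\<Sum>b\<in>Basis. (w \<bullet> b) *\<^sub>R b) = (\<Sum>b\<in>Basis. (w \<bullet> b) *\<^sub>R frechet_derivative f (at (g x)) b)"
        by (simp add: sum scaleR)
      then show ?thesis by (simp add: euclidean_representation)
    qed
    show "((\<lambda>x. f (g x)) has_derivative ?f' x) (at x)"
      using chain by (subst expand[symmetric])
  next
    fix v
    show "Ck_on k S (\<lambda>x. ?f' x v)"
      by (intro Ck_on_sum Ck_on_bilinear[OF _ bounded_bilinear_scaleR] Ck_on_linear_comp[OF _ bounded_linear_inner_left]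
          assms(1) Suc.IH) (use Suc.prems Ck_on_Suc_imp in auto)
  qed
qed

lemma Ck_on_inverse:
  fixes f :: "'a::euclidean_space \<Rightarrow> real"
  assumes "open S" "Ck_on k S f" "\<And>x. x \<in> S \<Longrightarrow> f x \<noteq> 0"
  shows "Ck_on k S (\<lambda>x. inverse (f x))"
  using assms(2)
proof (induction k)
  case 0
  then show ?case using assms(3) by (auto intro: continuous_intros)
next
  case (Suc k)
  \<comment> \<open>The derivative of the inverse contains the inverse itself only undifferentiated,
    so its regularity of one order less suffices.\<close>
  have inv: "Ck_on k S (\<lambda>x. inverse (f x))" using Suc Ck_on_Suc_imp by blast
  show ?case
  proof (rule Ck_on_SucI[OF assms(1), where f' = "\<lambda>x v. - (inverse (f x) * frechet_derivative f (at x) v * inverse (f x))"])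
    show "((\<lambda>x. inverse (f x)) has_derivative (\<lambda>v. - (inverse (f x) * frechet_derivative f (at x) v * inverse (f x)))) (at x)"
      if "x \<in> S" for x
      by (rule Deriv.has_derivative_inverse[OF assms(3)[OF that] Ck_on_has_derivative[OF Suc.prems that]])
    show "Ck_on k S (\<lambda>x. - (inverse (f x) * frechet_derivative f (at x) v * inverse (f x)))" for v
      by (intro Ck_on_linear_comp[OF _ bounded_linear_minus[OF bounded_linear_ident]]
          Ck_on_bilinear[OF _ bounded_bilinear_mult] assms(1) inv) (use Suc.prems in auto)
  qed
qed

lemma smooth_on_cong: "open S \<Longrightarrow> (\<And>x. x \<in> S \<Longrightarrow> f x = g x) \<Longrightarrow> smooth_on S f \<Longrightarrow> smooth_on S g"
  using Ck_on_cong unfolding smooth_on_def by metis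

lemma smooth_on_subset: "smooth_on T f \<Longrightarrow> S \<subseteq> T \<Longrightarrow> smooth_on S f"
  using Ck_on_subset unfolding smooth_on_def by metis

lemma smooth_on_local:
  "(\<And>x. x \<in> S \<Longrightarrow> \<exists>T. open T \<and> x \<in> T \<and> smooth_on T f) \<Longrightarrow> smooth_on S f"
  unfolding smooth_on_def by (meson Ck_on_local)

lemma smooth_on_const: "smooth_on S (\<lambda>x. c)"
  by (simp add: smooth_on_def Ck_on_const)

lemma smooth_on_id: "smooth_on S (\<lambda>x. x)"
  by (simp add: smooth_on_def Ck_on_id)

lemma smooth_on_add: "open S \<Longrightarrow> smooth_on S f \<Longrightarrow> smooth_on S g \<Longrightarrow> smooth_on S (\<lambda>x. f x + g x)"
  by (simp add: smooth_on_def Ck_on_add)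

lemma smooth_on_linear_comp: "open S \<Longrightarrow> bounded_linear h \<Longrightarrow> smooth_on S f \<Longrightarrow> smooth_on S (\<lambda>x. h (f x))"
  by (simp add: smooth_on_def Ck_on_linear_comp)

lemma smooth_on_bilinear:
  "open S \<Longrightarrow> bounded_bilinear h \<Longrightarrow> smooth_on S f \<Longrightarrow> smooth_on S g \<Longrightarrow> smooth_on S (\<lambda>x. h (f x) (g x))"
  by (simp add: smooth_on_def Ck_on_bilinear)

lemmas smooth_on_mult = smooth_on_bilinear[OF _ bounded_bilinear_mult]

lemma smooth_on_compose:
  "open S \<Longrightarrow> smooth_on T f \<Longrightarrow> smooth_on S g \<Longrightarrow> g ` S \<subseteq> T \<Longrightarrow> smooth_on S (\<lambda>x. f (g x))"
  unfolding smooth_on_def using Ck_on_compose by blast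

lemma smooth_on_inverse:
  fixes f :: "'a::euclidean_space \<Rightarrow> real"
  shows "open S \<Longrightarrow> smooth_on S f \<Longrightarrow> (\<And>x. x \<in> S \<Longrightarrow> f x \<noteq> 0) \<Longrightarrow> smooth_on S (\<lambda>x. inverse (f x))"
  by (simp add: smooth_on_def Ck_on_inverse)

lemma smooth_on_frechet_derivative:
  "smooth_on S f \<Longrightarrow> smooth_on S (\<lambda>x. frechet_derivative f (at x) v)"
  unfolding smooth_on_def by (metis Ck_on.simps(2))

lemma smooth_on_has_derivative:
  "smooth_on S f \<Longrightarrow> x \<in> S \<Longrightarrow> (f has_derivative frechet_derivative f (at x)) (at x)"
  unfolding smooth_on_def using Ck_on_has_derivative by blast

subsection \<open>Bump functions and the Hadamard lemma\<close>

text \<open>The classical flat function exp(-1/x), extended by 0, with an extra factor 1/x^n: the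
  derivative of a member of this family is a combination of two further members, so smoothness
  follows by one induction for all \<open>n\<close>.\<close>

definition flat_fun :: "nat \<Rightarrow> real \<Rightarrow> real" where
  "flat_fun n x = (if x > 0 then inverse x ^ n / exp (inverse x) else 0)"

lemma flat_fun_tendsto_0: "(flat_fun n \<longlongrightarrow> 0) (at 0)"
proof -
  have "((\<lambda>x. inverse x ^ n / exp (inverse x)) \<longlongrightarrow> (0::real)) (at_right 0)"
    using filterlim_compose[OF tendsto_power_div_exp_0 filterlim_inverse_at_top_right] .
  moreover have "\<forall>\<^sub>F x in at_right 0. inverse x ^ n / exp (inverse x) = flat_fun n x"
    by (simp add: eventually_at_right_less eventually_at_filter flat_fun_def)
  ultimately have "(flat_fun n \<longlongrightarrow> 0) (at_right 0)"
    by (rule Lim_transform_eventually)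
  moreover have "\<forall>\<^sub>F x in at_left 0. 0 = flat_fun n x"
    by (simp add: eventually_at_filter flat_fun_def)
  then have "(flat_fun n \<longlongrightarrow> 0) (at_left 0)"
    by (rule Lim_transform_eventually[OF tendsto_const])
  ultimately show ?thesis by (simp add: filterlim_split_at)
qed

lemma flat_fun_deriv:
  "(flat_fun n has_real_derivative - real n * flat_fun (Suc n) x + flat_fun (Suc (Suc n)) x) (at x)"
proof -
  consider "x > 0" | "x < 0" | "x = 0" by linarith
  then show ?thesis
  proof cases
    case 1
    have "((\<lambda>x. inverse x ^ n * exp (- inverse x)) has_real_derivative
        real n * inverse x ^ (n - Suc 0) * - (inverse x * inverse x) * exp (- inverse x)
        + inverse x ^ n * (exp (- inverse x) * (inverse x * inverse x))) (at x)"
      using 1 by (auto intro!: derivative_eq_intros)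
    also have "real n * inverse x ^ (n - Suc 0) * - (inverse x * inverse x) * exp (- inverse x)
        + inverse x ^ n * (exp (- inverse x) * (inverse x * inverse x))
        = - real n * flat_fun (Suc n) x + flat_fun (Suc (Suc n)) x"
      using 1 by (cases n) (auto simp: flat_fun_def exp_minus divide_inverse algebra_simps)
    finally have "((\<lambda>x. inverse x ^ n * exp (- inverse x)) has_real_derivative
        - real n * flat_fun (Suc n) x + flat_fun (Suc (Suc n)) x) (at x)" .
    then show ?thesis
      by (rule has_field_derivative_transform_within_open[of _ _ _ "{0<..}"])
        (use 1 in \<open>auto simp: flat_fun_def exp_minus divide_inverse\<close>)
  next
    case 2
    have "((\<lambda>x. 0) has_real_derivative 0) (at x)" by simp
    then have "(flat_fun n has_real_derivative 0) (at x)"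
      by (rule has_field_derivative_transform_within_open[of _ _ _ "{..<0}"])
        (use 2 in \<open>auto simp: flat_fun_def\<close>)
    then show ?thesis using 2 by (simp add: flat_fun_def)
  next
    case 3
    \<comment> \<open>The difference quotient at 0 is the next member of the family, which is
      already known to tend to 0.\<close>
    have "(flat_fun n y - flat_fun n 0) / (y - 0) = flat_fun (Suc n) y" for y
      by (auto simp: flat_fun_def field_simps)
    then have "(flat_fun n has_real_derivative 0) (at 0)"
      unfolding has_field_derivative_iff using flat_fun_tendsto_0 by simp
    then show ?thesis using 3 by (simp add: flat_fun_def)
  qed
qed

lemma smooth_on_flat_fun: "smooth_on UNIV (flat_fun n)"
proof -
  have "Ck_on k UNIV (flat_fun n)" for k
  proof (induction k arbitrary: n)
    case 0
    then show ?case
      using flat_fun_deriv by (auto intro!: continuous_at_imp_continuous_on DERIV_isCont)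
  next
    case (Suc k)
    show ?case
    proof (rule Ck_on_SucI)
      show "(flat_fun n has_derivative (\<lambda>v. (- real n * flat_fun (Suc n) x + flat_fun (Suc (Suc n)) x) * v)) (at x)"
        for x using flat_fun_deriv by (simp add: has_field_derivative_def)
      show "Ck_on k UNIV (\<lambda>x. (- real n * flat_fun (Suc n) x + flat_fun (Suc (Suc n)) x) * v)" for v
        by (intro Ck_on_bilinear[OF _ bounded_bilinear_mult] Ck_on_add Ck_on_const Suc.IH open_UNIV)
    qed simp
  qed
  then show ?thesis by (simp add: smooth_on_def)
qed

text \<open>The squared distance, unlike the distance, is smooth at the centre as well.\<close>

definition bump :: "'a::euclidean_space \<Rightarrow> real \<Rightarrow> 'a \<Rightarrow> real" where
  "bump y r x = flat_fun 0 (r\<^sup>2 - (x - y) \<bullet> (x - y))"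

lemma bump_pos_iff: "r > 0 \<Longrightarrow> bump y r x > 0 \<longleftrightarrow> x \<in> ball y r"
proof -
  assume r: "r > 0"
  have "dist y x < r \<longleftrightarrow> (x - y) \<bullet> (x - y) < r\<^sup>2"
    using r by (metis abs_of_pos dist_commute dist_norm norm_lt_square)
  then show ?thesis by (auto simp: bump_def flat_fun_def)
qed

lemma bump_nonneg: "bump y r x \<ge> 0"
  by (simp add: bump_def flat_fun_def)

lemma bump_eq_0: "r > 0 \<Longrightarrow> x \<notin> ball y r \<Longrightarrow> bump y r x = 0"
  using bump_pos_iff[of r y x] bump_nonneg[of y r x] by linarith

lemma smooth_on_bump: "open S \<Longrightarrow> smooth_on S (bump y r)"
proof -
  assume S: "open S"
  have "smooth_on S (\<lambda>x. x + (- y))"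
    by (intro smooth_on_add S smooth_on_id smooth_on_const)
  then have "smooth_on S (\<lambda>x. r\<^sup>2 + - ((x - y) \<bullet> (x - y)))"
    by (intro smooth_on_add smooth_on_const smooth_on_linear_comp[OF _ bounded_linear_minus[OF bounded_linear_ident]]
        smooth_on_bilinear[OF _ bounded_bilinear_inner] S) auto
  then have "smooth_on S (\<lambda>x. flat_fun 0 (r\<^sup>2 + - ((x - y) \<bullet> (x - y))))"
    by (rule smooth_on_compose[OF S smooth_on_flat_fun]) auto
  then show ?thesis by (simp add: bump_def[abs_def])
qed

lemma convex_segment_mem:
  assumes "convex U" "y \<in> U" "x \<in> U" "t \<in> cbox 0 (1::real)"
  shows "y + t *\<^sub>R (x - y) \<in> U"
proof -
  have "(1 - t) *\<^sub>R y + t *\<^sub>R x \<in> U" using assms by (intro convexD_alt) auto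
  then show ?thesis by (simp add: algebra_simps)
qed

text \<open>The power of \<open>t\<close> makes the statement stable under differentiation in \<open>x\<close>.\<close>

lemma Ck_on_segment_integral:
  fixes \<phi> :: "'a::euclidean_space \<Rightarrow> real"
  assumes U: "open U" "convex U" "y \<in> U" and "Ck_on k U \<phi>"
  shows "Ck_on k U (\<lambda>x. integral (cbox 0 1) (\<lambda>t. t ^ m * \<phi> (y + t *\<^sub>R (x - y))))"
  using assms(4)
proof (induction k arbitrary: m \<phi>)
  case 0
  note seg = convex_segment_mem[OF U(2,3)]
  have "continuous_on (U \<times> cbox 0 1) (\<lambda>z. \<phi> (y + snd z *\<^sub>R (fst z - y)))"
    by (rule continuous_on_compose2[of U \<phi>]) (use 0 seg in \<open>auto intro!: continuous_intros\<close>)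
  then have "continuous_on (U \<times> cbox 0 1) (\<lambda>(x, t). t ^ m * \<phi> (y + t *\<^sub>R (x - y)))"
    by (auto simp: case_prod_beta intro!: continuous_intros)
  from integral_continuous_on_param[OF this] show ?case by simp
next
  case (Suc k)
  note seg = convex_segment_mem[OF U(2,3)]
  have seg_cont: "continuous_on (U \<times> cbox 0 1) (\<lambda>z. \<psi> (y + snd z *\<^sub>R (fst z - y)))"
    if "continuous_on U \<psi>" for \<psi> :: "'a \<Rightarrow> real"
    by (rule continuous_on_compose2[of U \<psi>]) (use that seg in \<open>auto intro!: continuous_intros\<close>)
  define d where "d x v = frechet_derivative \<phi> (at x) v" for x v
  have d: "(\<phi> has_derivative d x) (at x)" if "x \<in> U" for x
    using Ck_on_has_derivative[OF Suc.prems that] by (simp add: d_def[abs_def])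
  have d_Ck: "Ck_on k U (\<lambda>x. d x v)" for v using Suc.prems by (simp add: d_def)
  \<comment> \<open>The Leibniz rule wants the derivative as a bounded linear map depending
    continuously on both \<open>x\<close> and \<open>t\<close>; in finite dimension this continuity
    can be checked on basis vectors.\<close>
  define F where "F x t = Blinfun (\<lambda>v. t ^ Suc m * d (y + t *\<^sub>R (x - y)) v)" for x t
  have F: "blinfun_apply (F x t) = (\<lambda>v. t ^ Suc m * d (y + t *\<^sub>R (x - y)) v)"
    if "x \<in> U" "t \<in> cbox 0 1" for x t
    unfolding F_def
    by (intro bounded_linear_Blinfun_apply bounded_linear_const_mult
        has_derivative_bounded_linear[OF d] seg that)
  have F_cont: "continuous_on (U \<times> cbox 0 1) (\<lambda>(x, t). F x t)"
  proof (rule continuous_on_blinfun_componentwise)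
    fix i :: 'a
    have "continuous_on (U \<times> cbox 0 1) (\<lambda>z. snd z ^ Suc m * d (y + snd z *\<^sub>R (fst z - y)) i)"
      by (intro continuous_intros seg_cont Ck_on_continuous[OF d_Ck])
    then show "continuous_on (U \<times> cbox 0 1) (\<lambda>z. blinfun_apply (case z of (x, t) \<Rightarrow> F x t) i)"
      by (rule continuous_on_eq) (auto simp: F)
  qed
  have F_int: "integral (cbox 0 1) (F x) v = integral (cbox 0 1) (\<lambda>t. t ^ Suc m * d (y + t *\<^sub>R (x - y)) v)"
    if "x \<in> U" for x v
  proof -
    have "continuous_on (cbox 0 1) (F x)"
      using continuous_on_compose2[OF F_cont continuous_on_Pair[OF continuous_on_const continuous_on_id], of x "cbox 0 1"] that
      by auto
    then have "integral (cbox 0 1) (F x) v = integral (cbox 0 1) (\<lambda>t. F x t v)"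
      by (intro blinfun_apply_integral integrable_continuous)
    also have "\<dots> = integral (cbox 0 1) (\<lambda>t. t ^ Suc m * d (y + t *\<^sub>R (x - y)) v)"
      by (rule integral_cong) (simp add: F that)
    finally show ?thesis .
  qed
  show ?case
  proof (rule Ck_on_SucI[OF U(1), where f' = "\<lambda>x v. integral (cbox 0 1) (\<lambda>t. t ^ Suc m * d (y + t *\<^sub>R (x - y)) v)"])
    fix x assume x: "x \<in> U"
    have "((\<lambda>x. integral (cbox 0 1) (\<lambda>t. t ^ m * \<phi> (y + t *\<^sub>R (x - y)))) has_derivative
        integral (cbox 0 1) (F x)) (at x within U)"
    proof (rule leibniz_rule[OF _ _ F_cont x U(2)])
      fix x t assume xt: "x \<in> U" "t \<in> cbox 0 (1::real)"
      have "((\<lambda>x. \<phi> (y + t *\<^sub>R (x - y))) has_derivative (\<lambda>v. d (y + t *\<^sub>R (x - y)) (t *\<^sub>R v))) (at x)"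
        using xt by (intro has_derivative_compose[where g = \<phi>, OF _ d] seg) (auto intro!: derivative_eq_intros)
      moreover have "d (y + t *\<^sub>R (x - y)) (t *\<^sub>R v) = t * d (y + t *\<^sub>R (x - y)) v" for v
        using linear_simps(5)[OF has_derivative_bounded_linear[OF d[OF seg[OF xt]]], of t v] by simp
      ultimately have "((\<lambda>x. t ^ m * \<phi> (y + t *\<^sub>R (x - y))) has_derivative
          (\<lambda>v. t ^ m * (t * d (y + t *\<^sub>R (x - y)) v))) (at x)"
        by (auto intro!: has_derivative_mult_right)
      then show "((\<lambda>x. t ^ m * \<phi> (y + t *\<^sub>R (x - y))) has_derivative blinfun_apply (F x t)) (at x within U)"
        unfolding F[OF xt] by (simp add: mult_ac has_derivative_at_withinI)
    next
      fix x assume "x \<in> U"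
      then have "continuous_on (cbox 0 1) (\<lambda>t. \<phi> (y + t *\<^sub>R (x - y)))"
        by (intro continuous_on_compose2[OF Ck_on_continuous[OF Suc.prems], of "cbox 0 1"])
          (use seg in \<open>auto intro!: continuous_intros\<close>)
      then show "(\<lambda>t. t ^ m * \<phi> (y + t *\<^sub>R (x - y))) integrable_on cbox 0 1"
        by (intro integrable_continuous continuous_intros)
    qed
    then show "((\<lambda>x. integral (cbox 0 1) (\<lambda>t. t ^ m * \<phi> (y + t *\<^sub>R (x - y)))) has_derivative
        (\<lambda>v. integral (cbox 0 1) (\<lambda>t. t ^ Suc m * d (y + t *\<^sub>R (x - y)) v))) (at x)"
      unfolding at_within_open[OF x U(1)] by (rule has_derivative_eq_rhs) (use F_int[OF x] in auto)
  next
    fix v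
    show "Ck_on k U (\<lambda>x. integral (cbox 0 1) (\<lambda>t. t ^ Suc m * d (y + t *\<^sub>R (x - y)) v))"
      by (rule Suc.IH[OF d_Ck])
  qed
qed

text \<open>The coefficients are the means of the partial derivatives over the segment from
  \<open>y\<close> to \<open>x\<close>, by the fundamental theorem of calculus along it. The
  expansion makes a derivation computable at \<open>y\<close> by the product rule alone, since the
  coordinate differences vanish there.\<close>

lemma hadamard:
  fixes f :: "'a::euclidean_space \<Rightarrow> real"
  assumes U: "open U" "convex U" "y \<in> U" and f: "smooth_on U f"
  obtains h where "\<And>i. smooth_on U (h i)"
    "\<And>x. x \<in> U \<Longrightarrow> f x = f y + (\<Sum>i\<in>Basis. ((x - y) \<bullet> i) * h i x)"
    "\<And>i. h i y = frechet_derivative f (at y) i"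
proof
  define d where "d x v = frechet_derivative f (at x) v" for x v
  define h where "h i x = integral (cbox 0 1) (\<lambda>t. d (y + t *\<^sub>R (x - y)) i)" for i x
  have d: "(f has_derivative d x) (at x)" if "x \<in> U" for x
    using smooth_on_has_derivative[OF f that] by (simp add: d_def[abs_def])
  have d_smooth: "smooth_on U (\<lambda>x. d x v)" for v
    unfolding d_def by (rule smooth_on_frechet_derivative[OF f])
  show "smooth_on U (h i)" for i
    using Ck_on_segment_integral[OF U, of _ "\<lambda>x. d x i" 0] d_smooth[of i]
    by (simp add: smooth_on_def h_def[abs_def])
  show "h i y = frechet_derivative f (at y) i" for i by (simp add: h_def d_def)
  fix x assume x: "x \<in> U"
  note seg = convex_segment_mem[OF U(2,3) x]
  have "((\<lambda>t. \<Sum>i\<in>Basis. ((x - y) \<bullet> i) * d (y + t *\<^sub>R (x - y)) i) has_integral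
      (f (y + 1 *\<^sub>R (x - y)) - f (y + 0 *\<^sub>R (x - y)))) {0..1}"
  proof (rule fundamental_theorem_of_calculus)
    fix t :: real assume t: "t \<in> {0..1}"
    interpret bounded_linear "d (y + t *\<^sub>R (x - y))"
      by (rule has_derivative_bounded_linear[OF d[OF seg]]) (use t in simp)
    have "((\<lambda>t. f (y + t *\<^sub>R (x - y))) has_derivative (\<lambda>s. d (y + t *\<^sub>R (x - y)) (s *\<^sub>R (x - y)))) (at t)"
      using t by (intro has_derivative_compose[where g = f, OF _ d] seg) (auto intro!: derivative_eq_intros)
    moreover have "d (y + t *\<^sub>R (x - y)) (x - y) = (\<Sum>i\<in>Basis. ((x - y) \<bullet> i) * d (y + t *\<^sub>R (x - y)) i)"
      using arg_cong[OF euclidean_representation[of "x - y"], of "d (y + t *\<^sub>R (x - y))"]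
      by (simp only: sum scaleR real_scaleR_def)
    ultimately show "((\<lambda>t. f (y + t *\<^sub>R (x - y))) has_vector_derivative
        (\<Sum>i\<in>Basis. ((x - y) \<bullet> i) * d (y + t *\<^sub>R (x - y)) i)) (at t within {0..1})"
      by (simp add: has_vector_derivative_def scaleR has_derivative_at_withinI)
  qed simp
  then have "((\<lambda>t. \<Sum>i\<in>Basis. ((x - y) \<bullet> i) * d (y + t *\<^sub>R (x - y)) i) has_integral (f x - f y)) {0..1}"
    by simp
  moreover have "((\<lambda>t. \<Sum>i\<in>Basis. ((x - y) \<bullet> i) * d (y + t *\<^sub>R (x - y)) i) has_integral
      (\<Sum>i\<in>Basis. ((x - y) \<bullet> i) * h i x)) {0..1}"
  proof (intro has_integral_sum has_integral_mult_right finite_Basis)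
    fix i :: 'a
    have "continuous_on U (\<lambda>x. d x i)"
      using d_smooth[of i] by (auto simp: smooth_on_def intro: Ck_on_continuous[of 0])
    then have "continuous_on (cbox 0 1) (\<lambda>t. d (y + t *\<^sub>R (x - y)) i)"
      by (rule continuous_on_compose2[of U]) (use seg in \<open>auto intro!: continuous_intros\<close>)
    then show "((\<lambda>t. d (y + t *\<^sub>R (x - y)) i) has_integral h i x) {0..1}"
      unfolding h_def using integrable_continuous integrable_integral
      by (metis box_real(2))
  qed
  ultimately have "f x - f y = (\<Sum>i\<in>Basis. ((x - y) \<bullet> i) * h i x)"
    by (rule has_integral_unique)
  then show "f x = f y + (\<Sum>i\<in>Basis. ((x - y) \<bullet> i) * h i x)" by simp
qed

subsection \<open>Vector fields on a closed manifold\<close>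

locale closed_manifold =
  fixes A :: "('m::{t2_space, second_countable_topology}, 'e::euclidean_space) chart set"
  assumes atlas: "smooth_atlas A" and compact: "compact (UNIV :: 'm set)"
begin

abbreviation "funs \<equiv> smooth_funs A"
abbreviation "fields \<equiv> vector_fields A"

section \<open>Charts\<close>

lemma chart:
  assumes "(D, \<phi>) \<in> A"
  shows chart_open_dom: "open D" and chart_open_ran: "open (\<phi> ` D)"
    and chart_homeomorphism: "homeomorphism D (\<phi> ` D) \<phi> (inv_into D \<phi>)"
  using atlas assms by (force simp: smooth_atlas_def is_chart_def)+

lemma chart_inv: "(D, \<phi>) \<in> A \<Longrightarrow> q \<in> D \<Longrightarrow> inv_into D \<phi> (\<phi> q) = q"
  using chart_homeomorphism by (auto simp: homeomorphism_def)

lemma chart_transition: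
  "(D, \<phi>) \<in> A \<Longrightarrow> (E, \<psi>) \<in> A \<Longrightarrow> smooth_on (\<phi> ` (D \<inter> E)) (\<lambda>x. \<psi> (inv_into D \<phi> x))"
  using atlas by (fastforce simp: smooth_atlas_def o_def)

lemma chart_exists: obtains D \<phi> where "(D, \<phi>) \<in> A" "p \<in> D"
proof -
  have "p \<in> (\<Union>c\<in>A. fst c)" using atlas by (simp add: smooth_atlas_def)
  then show thesis using that by auto
qed

lemma chart_open_image:
  assumes c: "(D, \<phi>) \<in> A" and "open S" "S \<subseteq> D"
  shows "open (\<phi> ` S)"
proof -
  have "openin (top_of_set D) S" using assms by (simp add: openin_open_eq chart_open_dom)
  then have "openin (top_of_set (\<phi> ` D)) (\<phi> ` S)"
    by (rule homeomorphism_imp_open_map[OF chart_homeomorphism[OF c]])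
  then show ?thesis using chart_open_ran[OF c] by (simp add: openin_open_eq)
qed

section \<open>The algebra of smooth functions\<close>

lemma smooth_funsI:
  "(\<And>D \<phi>. (D, \<phi>) \<in> A \<Longrightarrow> smooth_on (\<phi> ` D) (\<lambda>x. f (inv_into D \<phi> x))) \<Longrightarrow> f \<in> funs"
  by (auto simp: smooth_funs_def o_def)

lemma smooth_funsD:
  "f \<in> funs \<Longrightarrow> (D, \<phi>) \<in> A \<Longrightarrow> smooth_on (\<phi> ` D) (\<lambda>x. f (inv_into D \<phi> x))"
  by (auto simp: smooth_funs_def o_def)

lemma funs_const: "(\<lambda>_. c) \<in> funs"
  by (intro smooth_funsI smooth_on_const)

lemma funs_0: "0 \<in> funs"
  using funs_const[of 0] by (simp add: zero_fun_def)

lemma funs_1: "1 \<in> funs"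
  using funs_const[of 1] by (simp add: one_fun_def)

lemma funs_add: "f \<in> funs \<Longrightarrow> g \<in> funs \<Longrightarrow> f + g \<in> funs"
  by (rule smooth_funsI) (simp add: smooth_on_add[OF chart_open_ran smooth_funsD smooth_funsD])

lemma funs_mult: "f \<in> funs \<Longrightarrow> g \<in> funs \<Longrightarrow> f * g \<in> funs"
  by (rule smooth_funsI) (simp add: smooth_on_mult[OF chart_open_ran smooth_funsD smooth_funsD])

lemma funs_scale: "f \<in> funs \<Longrightarrow> (\<lambda>p. c * f p) \<in> funs"
  using funs_mult[OF funs_const] by (simp add: times_fun_def)

lemma funs_uminus: "f \<in> funs \<Longrightarrow> - f \<in> funs"
  using funs_scale[of f "-1"] by (simp add: fun_Compl_def)

lemma funs_diff: "f \<in> funs \<Longrightarrow> g \<in> funs \<Longrightarrow> f - g \<in> funs"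
  using funs_add[of f "- g"] funs_uminus by simp

lemma funs_sum: "(\<And>i. i \<in> I \<Longrightarrow> f i \<in> funs) \<Longrightarrow> sum f I \<in> funs"
  by (induction I rule: infinite_finite_induct) (auto intro: funs_add funs_0)

lemma funs_inverse: "f \<in> funs \<Longrightarrow> (\<And>p. f p \<noteq> 0) \<Longrightarrow> (\<lambda>p. inverse (f p)) \<in> funs"
  by (rule smooth_funsI) (simp add: smooth_on_inverse[OF chart_open_ran smooth_funsD])

lemmas funs_intros = funs_const funs_0 funs_1 funs_add funs_mult funs_scale funs_uminus
  funs_diff funs_sum

lemma sum_fun_apply [simp]: "sum f I p = (\<Sum>i\<in>I. f i p)"
  for f :: "'i \<Rightarrow> 'x \<Rightarrow> 'b::comm_monoid_add"
  by (induction I rule: infinite_finite_induct) auto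

section \<open>Derivations and their Lie bracket\<close>

lemma fieldsI:
  assumes "\<And>f. f \<in> funs \<Longrightarrow> X f \<in> funs" "\<And>f g. f \<in> funs \<Longrightarrow> g \<in> funs \<Longrightarrow> X (f + g) = X f + X g"
    "\<And>c f. f \<in> funs \<Longrightarrow> X (\<lambda>p. c * f p) = (\<lambda>p. c * X f p)"
    "\<And>f g. f \<in> funs \<Longrightarrow> g \<in> funs \<Longrightarrow> X (f * g) = f * X g + X f * g"
    "\<And>f. f \<notin> funs \<Longrightarrow> X f = 0"
  shows "X \<in> fields"
  using assms by (simp add: vector_fields_def)

lemma fields_funs: "X \<in> fields \<Longrightarrow> X f \<in> funs"
  by (cases "f \<in> funs") (auto simp: vector_fields_def funs_0)

lemma fields_outside: "X \<in> fields \<Longrightarrow> f \<notin> funs \<Longrightarrow> X f = 0"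
  by (auto simp: vector_fields_def)

lemma fields_add: "X \<in> fields \<Longrightarrow> f \<in> funs \<Longrightarrow> g \<in> funs \<Longrightarrow> X (f + g) = X f + X g"
  by (auto simp: vector_fields_def)

lemma fields_mult: "X \<in> fields \<Longrightarrow> f \<in> funs \<Longrightarrow> g \<in> funs \<Longrightarrow> X (f * g) = f * X g + X f * g"
  by (auto simp: vector_fields_def)

lemma fields_scale: "X \<in> fields \<Longrightarrow> f \<in> funs \<Longrightarrow> X (\<lambda>p. c * f p) = (\<lambda>p. c * X f p)"
  by (auto simp: vector_fields_def)

lemma fields_uminus: "X \<in> fields \<Longrightarrow> f \<in> funs \<Longrightarrow> X (- f) = - X f"
  using fields_scale[of X f "-1"] by (simp add: fun_Compl_def)

lemma fields_diff: "X \<in> fields \<Longrightarrow> f \<in> funs \<Longrightarrow> g \<in> funs \<Longrightarrow> X (f - g) = X f - X g"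
  using fields_add[of X f "- g"] by (simp add: fields_uminus funs_uminus fun_eq_iff)

lemma fields_0: "X \<in> fields \<Longrightarrow> X 0 = 0"
  using fields_add[of X 0 0] funs_0 by simp

lemma fields_1: "X \<in> fields \<Longrightarrow> X 1 = 0"
  using fields_mult[of X 1 1] funs_1 by simp

lemma fields_const: "X \<in> fields \<Longrightarrow> X (\<lambda>_. c) = 0"
  using fields_scale[of X 1 c] funs_1 fields_1[of X] by (simp add: zero_fun_def)

lemma fields_sum:
  "X \<in> fields \<Longrightarrow> (\<And>i. i \<in> I \<Longrightarrow> f i \<in> funs) \<Longrightarrow> X (sum f I) = (\<Sum>i\<in>I. X (f i))"
  by (induction I rule: infinite_finite_induct) (auto simp: fields_0 fields_add funs_sum)

lemmas field_rules = fields_funs fields_add fields_mult fields_diff fields_uminus fields_0 fields_1 fields_const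

lemma vf_zero: "0 \<in> fields"
  by (auto simp: vector_fields_def funs_0 fun_eq_iff)

lemma vf_add: "X \<in> fields \<Longrightarrow> Y \<in> fields \<Longrightarrow> X + Y \<in> fields"
  unfolding vector_fields_def by (auto simp: funs_add algebra_simps fun_eq_iff)

lemma vf_smul: "f \<in> funs \<Longrightarrow> X \<in> fields \<Longrightarrow> f \<cdot>\<^sub>v X \<in> fields"
  unfolding vector_fields_def by (auto simp: funs_mult smul_def algebra_simps fun_eq_iff)

lemma vf_uminus: "X \<in> fields \<Longrightarrow> - X \<in> fields"
proof -
  have "- X = (\<lambda>_. -1) \<cdot>\<^sub>v X" by (auto simp: smul_def fun_eq_iff)
  then show "X \<in> fields \<Longrightarrow> - X \<in> fields" using vf_smul[OF funs_const] by metis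
qed

lemma vf_diff: "X \<in> fields \<Longrightarrow> Y \<in> fields \<Longrightarrow> X - Y \<in> fields"
  using vf_add[of X "- Y"] vf_uminus by simp

lemma vf_sum: "(\<And>i. i \<in> I \<Longrightarrow> X i \<in> fields) \<Longrightarrow> sum X I \<in> fields"
  by (induction I rule: infinite_finite_induct) (auto intro: vf_add vf_zero)

lemma vf_bracket:
  assumes X: "X \<in> fields" and Y: "Y \<in> fields"
  shows "bracket X Y \<in> fields"
proof (rule fieldsI)
  note simps = fields_funs[OF X] fields_funs[OF Y] fields_add[OF X] fields_add[OF Y] fields_mult[OF X]
    fields_mult[OF Y] fields_scale[OF X] fields_scale[OF Y] funs_mult
  fix f g c assume f: "f \<in> funs"
  show "bracket X Y f \<in> funs" by (simp add: bracket_def simps funs_diff)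
  show "bracket X Y (\<lambda>p. c * f p) = (\<lambda>p. c * bracket X Y f p)"
    using f by (simp add: bracket_def simps fun_eq_iff algebra_simps)
  assume g: "g \<in> funs"
  show "bracket X Y (f + g) = bracket X Y f + bracket X Y g"
    using f g by (simp add: bracket_def simps)
  show "bracket X Y (f * g) = f * bracket X Y g + bracket X Y f * g"
    using f g by (simp add: bracket_def simps algebra_simps)
next
  fix f assume "f \<notin> funs"
  then show "bracket X Y f = 0"
    by (simp add: bracket_def fields_outside[OF X] fields_outside[OF Y] fields_0[OF X] fields_0[OF Y])
qed

lemmas vf_intros = vf_zero vf_add vf_smul vf_uminus vf_diff vf_sum vf_bracket

section \<open>A finite dual basis of the module of fields\<close>

text \<open>The cutoff vanishes off the compact set \<open>K\<close>, which is closed since the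
  manifold is Hausdorff. So the manifold is covered by the open set \<open>W\<close>, where the
  function is a composition of smooth maps, and by the complement of \<open>K\<close>, where it is
  0.\<close>

lemma chart_cutoff_smooth:
  assumes c: "(D, \<phi>) \<in> A" and U: "open U" "U \<subseteq> \<phi> ` D" and r: "r > 0" "cball y r \<subseteq> U"
    and h: "smooth_on U h"
  shows "(\<lambda>q. if q \<in> D then bump y r (\<phi> q) * h (\<phi> q) else 0) \<in> funs" (is "?F \<in> _")
proof (rule smooth_funsI, rule smooth_on_local)
  fix E \<psi> x assume e: "(E, \<psi>) \<in> A" and "x \<in> \<psi> ` E"
  then obtain q where q: "q \<in> E" "x = \<psi> q" by auto
  define W where "W = {q\<in>D. \<phi> q \<in> U}"
  define K where "K = inv_into D \<phi> ` cball y r"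
  have "open W"
  proof -
    have "continuous_on D \<phi>" using chart_homeomorphism[OF c] by (simp add: homeomorphism_def)
    then have "open (D \<inter> \<phi> -` U)" by (rule continuous_open_preimage[OF _ chart_open_dom[OF c] U(1)])
    moreover have "D \<inter> \<phi> -` U = W" by (auto simp: W_def)
    ultimately show ?thesis by simp
  qed
  have "closed K"
  proof -
    have "continuous_on (cball y r) (inv_into D \<phi>)"
      using chart_homeomorphism[OF c] U(2) r(2) by (auto simp: homeomorphism_def intro: continuous_on_subset)
    then show ?thesis unfolding K_def by (intro compact_imp_closed compact_continuous_image) auto
  qed
  have K: "\<phi> q \<notin> cball y r" if "q \<in> D" "q \<notin> K" for q
    using that chart_inv[OF c \<open>q \<in> D\<close>] unfolding K_def by (metis image_eqI)
  show "\<exists>T. open T \<and> x \<in> T \<and> smooth_on T (\<lambda>x. ?F (inv_into E \<psi> x))"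
  proof (cases "q \<in> W")
    case True
    let ?T = "\<psi> ` (E \<inter> W)"
    have T: "open ?T"
      using e \<open>open W\<close> chart_open_dom[OF e] by (intro chart_open_image[OF e] open_Int) auto
    have tr: "smooth_on ?T (\<lambda>x. \<phi> (inv_into E \<psi> x))"
      by (rule smooth_on_subset[OF chart_transition[OF e c]]) (auto simp: W_def)
    have inU: "(\<lambda>x. \<phi> (inv_into E \<psi> x)) ` ?T \<subseteq> U"
      using chart_inv[OF e] by (auto simp: W_def)
    have "smooth_on ?T (\<lambda>x. bump y r (\<phi> (inv_into E \<psi> x)) * h (\<phi> (inv_into E \<psi> x)))"
      by (intro smooth_on_mult T smooth_on_compose[OF T h tr inU]
          smooth_on_compose[OF T smooth_on_bump[OF U(1)] tr inU])
    then have "smooth_on ?T (\<lambda>x. ?F (inv_into E \<psi> x))"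
      by (rule smooth_on_cong[OF T, rotated]) (auto simp: W_def chart_inv[OF e])
    then show ?thesis using T q True by blast
  next
    case False
    have "K \<subseteq> W"
    proof
      fix q assume "q \<in> K"
      then obtain z where z: "z \<in> cball y r" "q = inv_into D \<phi> z" by (auto simp: K_def)
      then have "z \<in> U" "z \<in> \<phi> ` D" using r(2) U(2) by blast+
      then show "q \<in> W" unfolding W_def z(2) by (simp add: f_inv_into_f inv_into_into)
    qed
    then have "q \<notin> K" using False by blast
    let ?T = "\<psi> ` (E - K)"
    have T: "open ?T"
      using e \<open>closed K\<close> chart_open_dom[OF e] by (intro chart_open_image[OF e] open_Diff) auto
    have "smooth_on ?T (\<lambda>x. ?F (inv_into E \<psi> x))"
    proof (rule smooth_on_cong[OF T _ smooth_on_const])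
      fix x assume "x \<in> ?T"
      then obtain q where "q \<in> E" "q \<notin> K" "x = \<psi> q" by auto
      then show "0 = ?F (inv_into E \<psi> x)"
        using K[of q] r(1) bump_eq_0[of r "\<phi> q" y] by (auto simp: chart_inv[OF e] less_imp_le)
    qed
    then show ?thesis using T q \<open>q \<notin> K\<close> by blast
  qed
qed

text \<open>
  Multiplying Hadamard's expansion of \<open>f\<close> at \<open>q\<close> by the square of a cutoff function \<open>\<beta>\<close> makes
  it a global identity, to which a derivation can be applied; one more factor \<open>\<beta>\<close> absorbs the
  points where the cutoff vanishes.
\<close>

lemma local_dual_basis:
  obtains \<beta> E u where "\<beta> \<in> funs" "\<And>q. \<beta> q \<ge> 0" "\<beta> p > 0" "\<And>i. E i \<in> fields" "\<And>i. u i \<in> funs"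
    "\<And>X f. X \<in> fields \<Longrightarrow> f \<in> funs \<Longrightarrow> \<beta> * \<beta> * \<beta> * X f = (\<Sum>i\<in>insert (0::'e) Basis. X (u i) * E i f)"
proof -
  obtain D \<phi> where c: "(D, \<phi>) \<in> A" and p: "p \<in> D" using chart_exists .
  define y where "y = \<phi> p"
  obtain r' where r': "r' > 0" "ball y r' \<subseteq> \<phi> ` D"
    using chart_open_ran[OF c] p unfolding y_def by (meson image_eqI open_contains_ball)
  define r where "r = r' / 2"
  define U where "U = ball y r'"
  have r: "r > 0" "cball y r \<subseteq> U" and U: "open U" "convex U" "U \<subseteq> \<phi> ` D"
    using r' by (auto simp: r_def U_def)
  define ext where "ext h q = (if q \<in> D then bump y r (\<phi> q) * h (\<phi> q) else 0)" for h q
  have ext: "ext h \<in> funs" if "smooth_on U h" for h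
    unfolding ext_def[abs_def] by (rule chart_cutoff_smooth[OF c U(1,3) r that])
  define \<beta> where "\<beta> = ext (\<lambda>_. 1)"
  define x where "x i = ext (\<lambda>z. z \<bullet> i)" for i
  have \<beta>: "\<beta> \<in> funs" unfolding \<beta>_def by (intro ext smooth_on_const)
  have x: "x i \<in> funs" for i
    unfolding x_def by (intro ext smooth_on_linear_comp[OF U(1) bounded_linear_inner_left] smooth_on_id)
  have \<beta>_eq: "\<beta> q = (if q \<in> D then bump y r (\<phi> q) else 0)" for q by (simp add: \<beta>_def ext_def)
  have ext_eq: "ext h q = (if q \<in> D then \<beta> q * h (\<phi> q) else 0)" for h q
    by (simp add: \<beta>_eq ext_def)
  define rep where "rep f z = f (inv_into D \<phi> z)" for f :: "'m \<Rightarrow> real" and z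
  have rep: "smooth_on (\<phi> ` D) (rep f)" if "f \<in> funs" for f
    unfolding rep_def[abs_def] by (rule smooth_funsD[OF that c])
  define d where "d v f z = frechet_derivative (rep f) (at z) v" for v f z
  have rep_deriv: "(rep f has_derivative (\<lambda>v. d v f (\<phi> q))) (at (\<phi> q))" if "f \<in> funs" "q \<in> D" for f q
    using smooth_on_has_derivative[OF rep[OF that(1)]] that(2) by (simp add: d_def)
  have d_eq: "d v f (\<phi> q) = f' v" if "(rep f has_derivative f') (at (\<phi> q))" for f f' v q
    unfolding d_def using frechet_derivative_at[OF that] by simp
  have rep_\<phi>: "rep f (\<phi> q) = f q" if "q \<in> D" for f q
    by (simp add: rep_def chart_inv[OF c that])
  \<comment> \<open>The coordinate derivative in direction \<open>v\<close>, cut off to a global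
    field.\<close>
  define G where "G v f = (if f \<in> funs then ext (d v f) else 0)" for v f
  have G: "G v \<in> fields" for v
  proof -
    have "G v f \<in> funs" if "f \<in> funs" for f
      using that smooth_on_subset[OF smooth_on_frechet_derivative[OF rep[OF that]] U(3)]
      by (auto simp: G_def d_def[abs_def] intro!: ext)
    moreover have "G v (f + g) = G v f + G v g" if fg: "f \<in> funs" "g \<in> funs" for f g
    proof -
      have "d v (f + g) (\<phi> q) = d v f (\<phi> q) + d v g (\<phi> q)" if q: "q \<in> D" for q
        by (rule d_eq) (use has_derivative_add[OF rep_deriv[OF fg(1) q] rep_deriv[OF fg(2) q]]
            in \<open>simp add: rep_def[abs_def]\<close>)
      then show ?thesis using fg by (auto simp: G_def funs_add ext_eq fun_eq_iff algebra_simps)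
    qed
    moreover have "G v (\<lambda>p. k * f p) = (\<lambda>p. k * G v f p)" if f: "f \<in> funs" for k f
    proof -
      have "d v (\<lambda>p. k * f p) (\<phi> q) = k * d v f (\<phi> q)" if q: "q \<in> D" for q
        by (rule d_eq) (use has_derivative_mult_right[OF rep_deriv[OF f q], of k]
            in \<open>simp add: rep_def[abs_def]\<close>)
      then show ?thesis using f by (auto simp: G_def funs_scale ext_eq fun_eq_iff)
    qed
    moreover have "G v (f * g) = f * G v g + G v f * g" if fg: "f \<in> funs" "g \<in> funs" for f g
    proof -
      have "d v (f * g) (\<phi> q) = f q * d v g (\<phi> q) + d v f (\<phi> q) * g q" if q: "q \<in> D" for q
        by (rule d_eq) (use has_derivative_mult[OF rep_deriv[OF fg(1) q] rep_deriv[OF fg(2) q]]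
            in \<open>simp add: rep_def[abs_def] chart_inv[OF c q]\<close>)
      then show ?thesis using fg by (auto simp: G_def funs_mult ext_eq fun_eq_iff algebra_simps)
    qed
    ultimately show ?thesis by (rule fieldsI) (simp_all add: G_def fun_eq_iff)
  qed
  have local: "\<beta> q * \<beta> q * \<beta> q * X f q = (\<Sum>i\<in>Basis. (\<beta> q * X (x i) q - x i q * X \<beta> q) * G i f q)"
    if X: "X \<in> fields" and f: "f \<in> funs" for X f q
  proof (cases "\<beta> q = 0")
    case True
    then have "G i f q = 0" for i using f by (simp add: G_def ext_eq cong: if_cong)
    then show ?thesis using True by simp
  next
    case False
    then have q: "q \<in> D" by (auto simp: \<beta>_eq split: if_splits)
    have inU: "\<phi> s \<in> U" if "s \<in> D" "\<beta> s \<noteq> 0" for s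
    proof -
      have "\<phi> s \<in> ball y r" using that bump_eq_0[OF r(1)] by (auto simp: \<beta>_eq)
      then show ?thesis using r(2) by auto
    qed
    have "\<phi> q \<in> U" using inU[OF q False] .
    then obtain h where h: "\<And>i. smooth_on U (h i)"
      "\<And>z. z \<in> U \<Longrightarrow> rep f z = rep f (\<phi> q) + (\<Sum>i\<in>Basis. ((z - \<phi> q) \<bullet> i) * h i z)"
      "\<And>i. h i (\<phi> q) = d i f (\<phi> q)"
      unfolding d_def using hadamard[OF U(1,2) _ smooth_on_subset[OF rep[OF f] U(3)]] by blast
    \<comment> \<open>The coordinate difference from \<open>q\<close>, times \<beta>. It vanishes at
      \<open>q\<close>, so after applying \<open>X\<close> there the coefficient
      \<open>ext (h i)\<close> survives only undifferentiated.\<close>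
    define w where "w i = x i - (\<lambda>_. \<phi> q \<bullet> i) * \<beta>" for i
    have w: "w i \<in> funs" for i unfolding w_def by (intro funs_intros x \<beta>)
    have \<eta>: "ext (h i) \<in> funs" for i by (rule ext[OF h(1)])
    have expansion: "\<beta> * \<beta> * f = (\<lambda>_. f q) * (\<beta> * \<beta>) + (\<Sum>i\<in>Basis. w i * ext (h i))"
    proof
      fix s
      consider "s \<in> D" "\<phi> s \<in> U" | "s \<in> D" "\<phi> s \<notin> U" | "s \<notin> D" by blast
      then show "(\<beta> * \<beta> * f) s = ((\<lambda>_. f q) * (\<beta> * \<beta>) + (\<Sum>i\<in>Basis. w i * ext (h i))) s"
      proof cases
        case 1
        have "f s = f q + (\<Sum>i\<in>Basis. ((\<phi> s - \<phi> q) \<bullet> i) * h i (\<phi> s))"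
          using h(2)[OF 1(2)] by (simp add: rep_\<phi> 1 q)
        then have "\<beta> s * \<beta> s * f s = f q * (\<beta> s * \<beta> s)
            + (\<Sum>i\<in>Basis. \<beta> s * \<beta> s * (((\<phi> s - \<phi> q) \<bullet> i) * h i (\<phi> s)))"
          by (simp add: distrib_left sum_distrib_left)
        then show ?thesis
          using 1 by (simp add: w_def x_def ext_eq inner_diff_left algebra_simps)
      next
        case 2
        then have "\<beta> s = 0" using inU by blast
        then show ?thesis by (simp add: w_def x_def ext_eq cong: if_cong)
      next
        case 3
        then show ?thesis by (simp add: \<beta>_eq w_def x_def ext_eq cong: if_cong)
      qed
    qed
    have "X (\<beta> * \<beta> * f) q = \<beta> q * \<beta> q * X f q + 2 * \<beta> q * X \<beta> q * f q"
      by (simp add: fields_mult X \<beta> f funs_mult algebra_simps)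
    moreover have "X ((\<lambda>_. f q) * (\<beta> * \<beta>) + (\<Sum>i\<in>Basis. w i * ext (h i))) q
        = 2 * f q * \<beta> q * X \<beta> q + (\<Sum>i\<in>Basis. X (w i) q * ext (h i) q + w i q * X (ext (h i)) q)"
      by (simp add: fields_add fields_mult fields_sum fields_const X \<beta> w \<eta> funs_intros algebra_simps)
    moreover have "w i q = 0" for i using q by (simp add: w_def x_def ext_eq)
    moreover have "X (w i) q = X (x i) q - (\<phi> q \<bullet> i) * X \<beta> q" for i
      unfolding w_def by (simp add: fields_diff fields_mult fields_const X x \<beta> funs_intros)
    moreover have "ext (h i) q = G i f q" for i
      using q f by (simp add: ext_eq h(3) G_def)
    ultimately have "\<beta> q * \<beta> q * X f q = (\<Sum>i\<in>Basis. (X (x i) q - (\<phi> q \<bullet> i) * X \<beta> q) * G i f q)"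
      using arg_cong[OF expansion, of "\<lambda>F. X F q"] by (simp add: algebra_simps)
    \<comment> \<open>The third factor \<beta> turns the constant \<phi> q \<bullet> i into
      \<open>x i q\<close>, the value of a globally smooth function.\<close>
    then have "\<beta> q * \<beta> q * \<beta> q * X f q = (\<Sum>i\<in>Basis. \<beta> q * ((X (x i) q - (\<phi> q \<bullet> i) * X \<beta> q) * G i f q))"
      by (simp add: sum_distrib_left mult.assoc)
    also have "\<dots> = (\<Sum>i\<in>Basis. (\<beta> q * X (x i) q - x i q * X \<beta> q) * G i f q)"
      using q by (intro sum.cong) (simp_all add: x_def ext_eq algebra_simps)
    finally show ?thesis .
  qed
  \<comment> \<open>Since 0 is not a basis vector, it is free to index one more generator, paired
    with \<open>u 0 = \<beta>\<close>; it collects all terms in which \<open>X\<close>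
    differentiates the cutoff.\<close>
  define E where "E i = (if i = 0 then - (\<Sum>j\<in>Basis. x j \<cdot>\<^sub>v G j) else \<beta> \<cdot>\<^sub>v G i)" for i
  define u where "u i = (if i = 0 then \<beta> else x i)" for i
  show thesis
  proof
    show "\<beta> q \<ge> 0" for q by (simp add: \<beta>_eq bump_nonneg)
    show "\<beta> p > 0" using p r(1) bump_pos_iff[OF r(1), of y y] by (simp add: \<beta>_eq y_def)
    show "E i \<in> fields" for i by (auto simp: E_def intro!: vf_intros G x \<beta>)
    show "u i \<in> funs" for i by (simp add: u_def x \<beta>)
    fix X f assume X: "X \<in> fields" and f: "f \<in> funs"
    show "\<beta> * \<beta> * \<beta> * X f = (\<Sum>i\<in>insert 0 Basis. X (u i) * E i f)"
    proof
      fix q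
      have "(\<Sum>i\<in>Basis. X (u i) q * E i f q) = (\<Sum>i\<in>Basis. \<beta> q * X (x i) q * G i f q)"
        by (intro sum.cong) (auto simp: u_def E_def smul_def)
      moreover have "E 0 f q = - (\<Sum>j\<in>Basis. x j q * G j f q)"
        by (simp add: E_def smul_def)
      ultimately show "(\<beta> * \<beta> * \<beta> * X f) q = (\<Sum>i\<in>insert 0 Basis. X (u i) * E i f) q"
        using local[OF X f, of q]
        by (simp add: u_def sum_distrib_left sum_subtractf algebra_simps)
    qed
  qed (rule \<beta>)
qed

text \<open>By compactness finitely many of the sets where a cutoff is positive cover the manifold,
  so the sum \<open>S\<close> of the cubed cutoffs has a smooth inverse. Adding the local identities
  and dividing by \<open>S\<close> gives the global one.\<close>

lemma dual_basis:
  obtains I :: "('m \<times> 'e) set" and E u where "finite I" "\<And>i. i \<in> I \<Longrightarrow> E i \<in> fields"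
    "\<And>i. i \<in> I \<Longrightarrow> u i \<in> funs"
    "\<And>X. X \<in> fields \<Longrightarrow> X = (\<Sum>i\<in>I. X (u i) \<cdot>\<^sub>v E i)"
proof -
  define P where "P p \<beta> E u \<longleftrightarrow> \<beta> \<in> funs \<and> (\<forall>q. \<beta> q \<ge> 0) \<and> \<beta> p > 0 \<and> (\<forall>i. E i \<in> fields) \<and> (\<forall>i. u i \<in> funs) \<and>
      (\<forall>X\<in>fields. \<forall>f\<in>funs. \<beta> * \<beta> * \<beta> * X f = (\<Sum>i\<in>insert (0::'e) Basis. X (u i) * E i f))" for p \<beta> E u
  have "\<forall>p. \<exists>\<beta> E u. P p \<beta> E u"
    unfolding P_def by (rule allI, rule local_dual_basis) blast
  from choice[OF this] obtain \<beta> where "\<forall>p. \<exists>E u. P p (\<beta> p) E u" by blast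
  from choice[OF this] obtain E where "\<forall>p. \<exists>u. P p (\<beta> p) (E p) u" by blast
  from choice[OF this] obtain u where P: "\<And>p. P p (\<beta> p) (E p) (u p)" by blast
  have \<beta>: "\<And>p. \<beta> p \<in> funs" "\<And>p q. \<beta> p q \<ge> 0" "\<And>p. \<beta> p p > 0"
    and Eu: "\<And>p i. E p i \<in> fields" "\<And>p i. u p i \<in> funs"
    and cube: "\<And>p X f. X \<in> fields \<Longrightarrow> f \<in> funs \<Longrightarrow>
      \<beta> p * \<beta> p * \<beta> p * X f = (\<Sum>i\<in>insert (0::'e) Basis. X (u p i) * E p i f)"
    using P unfolding P_def by blast+
  have "open {q. \<beta> p q > 0}" for p
  proof (rule Topological_Spaces.openI)
    fix q assume q: "q \<in> {q. \<beta> p q > 0}"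
    obtain D \<phi> where c: "(D, \<phi>) \<in> A" and qD: "q \<in> D" using chart_exists .
    have "continuous_on (\<phi> ` D) (\<lambda>x. \<beta> p (inv_into D \<phi> x))"
      using smooth_funsD[OF \<beta>(1) c] by (auto simp: smooth_on_def intro: Ck_on_continuous[of 0])
    moreover have "continuous_on D \<phi>" using chart_homeomorphism[OF c] by (simp add: homeomorphism_def)
    ultimately have "continuous_on D (\<lambda>q. \<beta> p (inv_into D \<phi> (\<phi> q)))"
      by (rule continuous_on_compose2) auto
    then have "continuous_on D (\<beta> p)"
      by (rule continuous_on_eq) (simp add: chart_inv[OF c])
    then have "open (D \<inter> \<beta> p -` {0<..})"
      by (rule continuous_open_preimage[OF _ chart_open_dom[OF c]]) simp
    then show "\<exists>T. open T \<and> q \<in> T \<and> T \<subseteq> {q. \<beta> p q > 0}"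
      using q qD by (intro exI[of _ "D \<inter> \<beta> p -` {0<..}"]) auto
  qed
  then obtain P where P: "finite P" "UNIV \<subseteq> (\<Union>p\<in>P. {q. \<beta> p q > 0})"
  proof (rule compactE_image[OF compact, of UNIV "\<lambda>p. {q. \<beta> p q > 0}"])
    show "(UNIV :: 'm set) \<subseteq> (\<Union>p\<in>UNIV. {q. \<beta> p q > 0})" using \<beta>(3) by auto
  qed
  define S where "S = (\<Sum>p\<in>P. \<beta> p * \<beta> p * \<beta> p)"
  have S: "S \<in> funs" unfolding S_def by (intro funs_intros \<beta>)
  have S_pos: "S q > 0" for q
  proof -
    obtain p where p: "p \<in> P" "\<beta> p q > 0" using P(2) by blast
    then show ?thesis
      unfolding S_def using P(1) \<beta>(2) by (auto intro!: sum_pos2[of P p])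
  qed
  define s where "s q = inverse (S q)" for q
  have s: "s \<in> funs" unfolding s_def[abs_def] by (rule funs_inverse[OF S]) (use S_pos in \<open>metis less_irrefl\<close>)
  have sS: "s * S = 1" using S_pos by (auto simp: s_def fun_eq_iff less_imp_neq[THEN not_sym])
  define I where "I = P \<times> insert (0::'e) Basis"
  show thesis
  proof
    show "finite I" unfolding I_def using P(1) by auto
    show "(case i of (p, j) \<Rightarrow> s \<cdot>\<^sub>v E p j) \<in> fields" for i using Eu s by (auto intro: vf_smul split: prod.split)
    show "(case i of (p, j) \<Rightarrow> u p j) \<in> funs" for i using Eu by (auto split: prod.split)
    fix X assume X: "X \<in> fields"
    show "X = (\<Sum>i\<in>I. X (case i of (p, j) \<Rightarrow> u p j) \<cdot>\<^sub>v (case i of (p, j) \<Rightarrow> s \<cdot>\<^sub>v E p j))" (is "_ = ?Y")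
    proof
      fix f
      have "X f = s * S * X f" by (simp add: sS)
      also have "\<dots> = s * (\<Sum>p\<in>P. \<beta> p * \<beta> p * \<beta> p * X f)" by (simp add: S_def sum_distrib_right mult.assoc)
      also have "\<dots> = ?Y f" if f: "f \<in> funs"
        unfolding cube[OF X f] I_def
        by (simp add: sum.cartesian_product' sum_distrib_left smul_def distrib_left mult_ac)
      finally have "f \<in> funs \<Longrightarrow> X f = ?Y f" .
      moreover have "?Y f = 0" if "f \<notin> funs"
        using that Eu fields_outside by (auto simp: smul_def fun_eq_iff intro!: sum.neutral split: prod.split)
      ultimately show "X f = ?Y f" using fields_outside[OF X] by (cases "f \<in> funs") auto
    qed
  qed
qed

end

subsection \<open>Tensor fields and the Levi-Civita connection\<close>

text \<open>The scalars are all real functions, not just the smooth ones, so the module laws rewrite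
  without smoothness conditions.\<close>

global_interpretation smul: module "smul :: ('m \<Rightarrow> real) \<Rightarrow> 'm vf \<Rightarrow> 'm vf"
  by standard (simp_all add: smul_def fun_eq_iff algebra_simps)

lemma smul_apply: "(f \<cdot>\<^sub>v X) h = f * X h"
  by (simp add: smul_def)

context closed_manifold
begin

section \<open>Calculus of the Lie bracket\<close>

lemma bracket_anticomm: "bracket Y X = - bracket X Y"
  by (simp add: bracket_def fun_eq_iff)

lemma bracket_self [simp]: "bracket X X = 0"
  by (simp add: bracket_def fun_eq_iff)

lemma bracket_left_linear:
  assumes X: "X \<in> fields" and Y: "Y \<in> fields" and Z: "Z \<in> fields"
  shows bracket_add_left: "bracket (X + Y) Z = bracket X Z + bracket Y Z"
    and bracket_uminus_left: "bracket (- X) Z = - bracket X Z"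
    and bracket_smul_left: "f \<in> funs \<Longrightarrow> bracket (f \<cdot>\<^sub>v X) Z = f \<cdot>\<^sub>v bracket X Z - Z f \<cdot>\<^sub>v X"
proof -
  note rules = field_rules[OF X] field_rules[OF Y] field_rules[OF Z]
  show "bracket (X + Y) Z = bracket X Z + bracket Y Z" "bracket (- X) Z = - bracket X Z"
    by (rule ext, simp add: bracket_def rules)+
  show "bracket (f \<cdot>\<^sub>v X) Z = f \<cdot>\<^sub>v bracket X Z - Z f \<cdot>\<^sub>v X" if "f \<in> funs"
    using that by (intro ext) (simp add: bracket_def smul_def rules algebra_simps)
qed

lemma bracket_add_right: "X \<in> fields \<Longrightarrow> Y \<in> fields \<Longrightarrow> Z \<in> fields \<Longrightarrow>
    bracket X (Y + Z) = bracket X Y + bracket X Z"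
  using bracket_add_left[of Y Z X] bracket_anticomm[of X] by simp

lemma bracket_uminus_right: "X \<in> fields \<Longrightarrow> Y \<in> fields \<Longrightarrow> bracket X (- Y) = - bracket X Y"
  using bracket_uminus_left[of Y Y X] bracket_anticomm[of X] by simp

lemma bracket_smul_right: "f \<in> funs \<Longrightarrow> X \<in> fields \<Longrightarrow> Y \<in> fields \<Longrightarrow>
    bracket X (f \<cdot>\<^sub>v Y) = f \<cdot>\<^sub>v bracket X Y + X f \<cdot>\<^sub>v Y"
  using bracket_smul_left[of Y Y X f] bracket_anticomm[of X] by simp

lemma bracket_diff_left: "X \<in> fields \<Longrightarrow> Y \<in> fields \<Longrightarrow> Z \<in> fields \<Longrightarrow>
    bracket (X - Y) Z = bracket X Z - bracket Y Z"
  using bracket_add_left[of X "- Y" Z] bracket_uminus_left[of Y Y Z] vf_uminus[of Y] by simp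

lemma bracket_diff_right: "X \<in> fields \<Longrightarrow> Y \<in> fields \<Longrightarrow> Z \<in> fields \<Longrightarrow>
    bracket X (Y - Z) = bracket X Y - bracket X Z"
  using bracket_add_right[of X Y "- Z"] bracket_uminus_right[of X Z] vf_uminus[of Z] by simp

lemmas bracket_simps = bracket_add_left bracket_add_right bracket_diff_left bracket_diff_right
  bracket_uminus_left bracket_uminus_right bracket_smul_left bracket_smul_right

lemma jacobi:
  assumes X: "X \<in> fields" and Y: "Y \<in> fields" and Z: "Z \<in> fields"
  shows "bracket (bracket X Y) Z = bracket X (bracket Y Z) - bracket Y (bracket X Z)"
  by (rule ext)
    (simp add: bracket_def field_rules[OF X] field_rules[OF Y] field_rules[OF Z] algebra_simps)

section \<open>One-forms and bilinear forms\<close>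

lemma form_funs: "\<alpha> \<in> one_forms A \<Longrightarrow> \<alpha> X \<in> funs"
  by (cases "X \<in> fields") (auto simp: one_forms_def funs_0)

lemma form_outside: "\<alpha> \<in> one_forms A \<Longrightarrow> X \<notin> fields \<Longrightarrow> \<alpha> X = 0"
  by (auto simp: one_forms_def)

lemma form_add: "\<alpha> \<in> one_forms A \<Longrightarrow> X \<in> fields \<Longrightarrow> Y \<in> fields \<Longrightarrow> \<alpha> (X + Y) = \<alpha> X + \<alpha> Y"
  by (auto simp: one_forms_def)

lemma form_smul: "\<alpha> \<in> one_forms A \<Longrightarrow> f \<in> funs \<Longrightarrow> X \<in> fields \<Longrightarrow> \<alpha> (f \<cdot>\<^sub>v X) = f * \<alpha> X"
  by (auto simp: one_forms_def)

lemma form_0: "\<alpha> \<in> one_forms A \<Longrightarrow> \<alpha> 0 = 0"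
  using form_add[of \<alpha> 0 0] vf_zero by simp

lemma form_uminus: "\<alpha> \<in> one_forms A \<Longrightarrow> X \<in> fields \<Longrightarrow> \<alpha> (- X) = - \<alpha> X"
  using form_smul[of \<alpha> "- 1" X] funs_uminus[OF funs_1] by simp

lemma form_diff: "\<alpha> \<in> one_forms A \<Longrightarrow> X \<in> fields \<Longrightarrow> Y \<in> fields \<Longrightarrow> \<alpha> (X - Y) = \<alpha> X - \<alpha> Y"
  using form_add[of \<alpha> X "- Y"] by (simp add: form_uminus[of \<alpha>] vf_uminus)

lemma form_sum: "\<alpha> \<in> one_forms A \<Longrightarrow> (\<And>i. i \<in> I \<Longrightarrow> X i \<in> fields) \<Longrightarrow> \<alpha> (sum X I) = (\<Sum>i\<in>I. \<alpha> (X i))"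
  by (induction I rule: infinite_finite_induct) (auto simp: form_0[of \<alpha>] form_add[of \<alpha>] vf_sum)

lemmas form_simps = form_add form_smul form_0 form_uminus form_diff form_sum

lemmas form_rules = form_simps form_funs form_outside

lemma one_formsI:
  assumes "\<And>X. X \<in> fields \<Longrightarrow> \<alpha> X \<in> funs"
    "\<And>X Y. X \<in> fields \<Longrightarrow> Y \<in> fields \<Longrightarrow> \<alpha> (X + Y) = \<alpha> X + \<alpha> Y"
    "\<And>f X. f \<in> funs \<Longrightarrow> X \<in> fields \<Longrightarrow> \<alpha> (f \<cdot>\<^sub>v X) = f * \<alpha> X"
    "\<And>X. X \<notin> fields \<Longrightarrow> \<alpha> X = 0"
  shows "\<alpha> \<in> one_forms A"
  using assms by (auto simp: one_forms_def)

lemma one_forms_add: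
  assumes \<alpha>: "\<alpha> \<in> one_forms A" and \<beta>: "\<beta> \<in> one_forms A"
  shows "\<alpha> + \<beta> \<in> one_forms A"
  by (rule one_formsI) (simp_all add: form_rules[OF \<alpha>] form_rules[OF \<beta>] funs_add algebra_simps)

lemma one_forms_scale:
  assumes f: "f \<in> funs" and \<alpha>: "\<alpha> \<in> one_forms A"
  shows "(\<lambda>X. f * \<alpha> X) \<in> one_forms A"
  by (rule one_formsI) (simp_all add: form_rules[OF \<alpha>] f funs_mult algebra_simps)

lemma one_forms_uminus: "\<alpha> \<in> one_forms A \<Longrightarrow> - \<alpha> \<in> one_forms A"
  using one_forms_scale[OF funs_uminus[OF funs_1]] by (simp add: fun_Compl_def[of \<alpha>])

lemma one_forms_diff: "\<alpha> \<in> one_forms A \<Longrightarrow> \<beta> \<in> one_forms A \<Longrightarrow> \<alpha> - \<beta> \<in> one_forms A"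
  using one_forms_add[of \<alpha> "- \<beta>"] one_forms_uminus[of \<beta>] by simp

lemma one_forms_0: "0 \<in> one_forms A"
  by (rule one_formsI) (simp_all add: funs_0)

lemma bilinear_formsD:
  assumes "\<beta> \<in> bilinear_forms A"
  shows bilinear_right: "\<beta> X \<in> one_forms A" and bilinear_left: "(\<lambda>X. \<beta> X Y) \<in> one_forms A"
  using assms by (auto simp: bilinear_forms_def)

lemma bilinear_left_simps:
  assumes "\<beta> \<in> bilinear_forms A"
  shows "X \<in> fields \<Longrightarrow> Y \<in> fields \<Longrightarrow> \<beta> (X + Y) Z = \<beta> X Z + \<beta> Y Z"
    "X \<in> fields \<Longrightarrow> Y \<in> fields \<Longrightarrow> \<beta> (X - Y) Z = \<beta> X Z - \<beta> Y Z"
    "X \<in> fields \<Longrightarrow> \<beta> (- X) Z = - \<beta> X Z"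
    "f \<in> funs \<Longrightarrow> X \<in> fields \<Longrightarrow> \<beta> (f \<cdot>\<^sub>v X) Z = f * \<beta> X Z"
    "\<beta> 0 Z = 0"
    "(\<And>i. i \<in> I \<Longrightarrow> E i \<in> fields) \<Longrightarrow> \<beta> (sum E I) Z = (\<Sum>i\<in>I. \<beta> (E i) Z)"
  by (simp_all add: form_simps[OF bilinear_left[OF assms, of Z]])

lemmas bilinear_simps = bilinear_left_simps form_simps[OF bilinear_right]

lemma bilinear_funs: "\<beta> \<in> bilinear_forms A \<Longrightarrow> \<beta> X Y \<in> funs"
  by (simp add: bilinear_right form_funs)

text \<open>In the dual basis expansion of \<open>X\<close> the coefficients \<open>X (u i)\<close>
  vanish at \<open>p\<close>. This is how a map defined on global fields acquires values on tangent
  vectors.\<close>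

lemma form_tensorial:
  assumes \<alpha>: "\<alpha> \<in> one_forms A" and X: "X \<in> fields" "\<And>f. X f p = 0"
  shows "\<alpha> X p = 0"
proof -
  obtain I :: "('m \<times> 'e) set" and E u where "finite I" and Eu: "\<And>i. i \<in> I \<Longrightarrow> E i \<in> fields" "\<And>i. i \<in> I \<Longrightarrow> u i \<in> funs"
    "\<And>X. X \<in> fields \<Longrightarrow> X = (\<Sum>i\<in>I. X (u i) \<cdot>\<^sub>v E i)"
    by (rule dual_basis) blast
  have "\<alpha> X = \<alpha> (\<Sum>i\<in>I. X (u i) \<cdot>\<^sub>v E i)" by (subst Eu(3)[OF X(1)]) (rule refl)
  also have "\<dots> = (\<Sum>i\<in>I. X (u i) * \<alpha> (E i))"
    by (simp add: form_sum[OF \<alpha>] form_smul[OF \<alpha>] Eu fields_funs[OF X(1)] vf_smul)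
  finally show ?thesis by (simp add: X)
qed

lemma form_tensorial_eq:
  assumes \<alpha>: "\<alpha> \<in> one_forms A" and X: "X \<in> fields" and Y: "Y \<in> fields" and eq: "\<And>f. X f p = Y f p"
  shows "\<alpha> X p = \<alpha> Y p"
  using form_tensorial[OF \<alpha> vf_diff[OF X Y]] eq by (simp add: form_diff[OF \<alpha> X Y])

section \<open>The musical isomorphism\<close>

text \<open>Gaussian elimination over the ring of smooth functions: positivity makes the pivot
  \<open>H k k\<close> invertible at every point, and the Schur complement \<open>H'\<close> is
  again symmetric and positive definite.\<close>

lemma gram_solvable:
  fixes H :: "'i \<Rightarrow> 'i \<Rightarrow> 'm \<Rightarrow> real"
  assumes "finite I" "\<And>i j. H i j \<in> funs" "\<And>i j. H i j = H j i" "\<And>i. a i \<in> funs"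
    "\<And>c p. (\<exists>i\<in>I. c i \<noteq> 0) \<Longrightarrow> (\<Sum>i\<in>I. \<Sum>j\<in>I. c i * c j * H i j p) > 0"
  shows "\<exists>x. (\<forall>i. x i \<in> funs) \<and> (\<forall>i\<in>I. (\<Sum>j\<in>I. H i j * x j) = a i)"
  using assms
proof (induction I arbitrary: H a rule: finite_induct)
  case empty
  then show ?case using funs_0 by auto
next
  case (insert k I)
  note H = insert.prems(1) and sym = insert.prems(2) and a = insert.prems(3) and pos = insert.prems(4)
  have sym': "H i k p = H k i p" if "i \<in> I" for i p using sym[of i k] by simp
  have expand: "(\<Sum>i\<in>insert k I. \<Sum>j\<in>insert k I. c i * c j * H i j p)
      = (\<Sum>i\<in>I. \<Sum>j\<in>I. c i * c j * H i j p) + 2 * c k * (\<Sum>j\<in>I. H k j p * c j) + c k * c k * H k k p" for c p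
    using insert.hyps
    by (simp add: sym' sum.distrib sum_distrib_left algebra_simps)
  have Hkk: "H k k p > 0" for p
  proof -
    have "(\<Sum>i\<in>insert k I. \<Sum>j\<in>insert k I. (if i = k then 1 else 0) * (if j = k then 1 else 0) * H i j p) > 0"
      by (rule pos) auto
    then show ?thesis unfolding expand using insert.hyps
      by (simp add: if_distrib[of "\<lambda>x. x * _"] if_distrib[of "\<lambda>x. _ * x"] cong: if_cong)
  qed
  define w where "w p = inverse (H k k p)" for p
  have w: "w \<in> funs" unfolding w_def[abs_def] by (rule funs_inverse[OF H]) (use Hkk in \<open>metis less_irrefl\<close>)
  have w_H: "H k k * w = 1" using Hkk by (auto simp: w_def fun_eq_iff less_imp_neq[THEN not_sym])
  have w_Hp: "H k k p * w p = 1" for p using fun_cong[OF w_H, of p] by simp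
  define H' where "H' i j = H i j - H k i * w * H k j" for i j
  define a' where "a' i = a i - H i k * w * a k" for i
  have "\<exists>x. (\<forall>i. x i \<in> funs) \<and> (\<forall>i\<in>I. (\<Sum>j\<in>I. H' i j * x j) = a' i)"
  proof (rule insert.IH)
    show "H' i j \<in> funs" for i j unfolding H'_def by (intro funs_intros H w)
    show "H' i j = H' j i" for i j unfolding H'_def using sym[of i j] by (simp add: mult_ac)
    show "a' i \<in> funs" for i unfolding a'_def by (intro funs_intros H w a)
    fix c :: "'i \<Rightarrow> real" and p assume c: "\<exists>i\<in>I. c i \<noteq> 0"
    define S where "S = (\<Sum>j\<in>I. H k j p * c j)"
    \<comment> \<open>The entry at \<open>k\<close> minimises the quadratic form of \<open>H\<close>
      for the given remaining entries; the minimum is the value of the form of \<open>H'\<close> at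
      \<open>c\<close>.\<close>
    define c' where "c' = c(k := - w p * S)"
    have c': "c' i = c i" if "i \<in> I" for i using that insert.hyps by (auto simp: c'_def)
    have "0 < (\<Sum>i\<in>insert k I. \<Sum>j\<in>insert k I. c' i * c' j * H i j p)"
      using c c' by (intro pos) auto
    also have "\<dots> = (\<Sum>i\<in>I. \<Sum>j\<in>I. c i * c j * H i j p) + 2 * c' k * S + c' k * c' k * H k k p"
      unfolding expand S_def using c' by simp
    also have "c' k * c' k * H k k p = w p * S * S * (H k k p * w p)" by (simp add: c'_def)
    also have "(\<Sum>i\<in>I. \<Sum>j\<in>I. c i * c j * H i j p) + 2 * c' k * S + w p * S * S * (H k k p * w p)
        = (\<Sum>i\<in>I. \<Sum>j\<in>I. c i * c j * H i j p) - w p * (S * S)"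
      unfolding w_Hp by (simp add: c'_def)
    also have "S * S = (\<Sum>i\<in>I. \<Sum>j\<in>I. (H k i p * c i) * (H k j p * c j))"
      unfolding S_def by (rule sum_product)
    also have "(\<Sum>i\<in>I. \<Sum>j\<in>I. c i * c j * H i j p) - w p * (\<Sum>i\<in>I. \<Sum>j\<in>I. (H k i p * c i) * (H k j p * c j))
        = (\<Sum>i\<in>I. \<Sum>j\<in>I. c i * c j * H' i j p)"
      by (simp add: H'_def sum_distrib_left sum_subtractf right_diff_distrib mult_ac)
    finally show "(\<Sum>i\<in>I. \<Sum>j\<in>I. c i * c j * H' i j p) > 0" .
  qed
  then obtain x where x: "\<And>i. x i \<in> funs" "\<And>i. i \<in> I \<Longrightarrow> (\<Sum>j\<in>I. H' i j * x j) = a' i" by blast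
  define T where "T = (\<Sum>j\<in>I. H k j * x j)"
  \<comment> \<open>Back substitution: the entry at \<open>k\<close> is solved from row
    \<open>k\<close>.\<close>
  define x' where "x' = x(k := w * (a k - T))"
  have T: "T \<in> funs" unfolding T_def by (intro funs_intros H x)
  have x': "x' i = x i" if "i \<in> I" for i using that insert.hyps by (auto simp: x'_def)
  have row: "(\<Sum>j\<in>insert k I. H i j * x' j) = H i k * (w * (a k - T)) + (\<Sum>j\<in>I. H i j * x j)" for i
  proof -
    have "(\<Sum>j\<in>I. H i j * x' j) = (\<Sum>j\<in>I. H i j * x j)" using x' by simp
    then show ?thesis using insert.hyps by (simp add: x'_def)
  qed
  have "(\<Sum>j\<in>insert k I. H k j * x' j) = H k k * w * (a k - T) + T"
    unfolding row by (simp add: T_def mult.assoc)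
  then have "(\<Sum>j\<in>insert k I. H k j * x' j) = a k" by (simp add: w_H)
  moreover have "(\<Sum>j\<in>insert k I. H i j * x' j) = a i" if "i \<in> I" for i
  proof -
    have "a' i = (\<Sum>j\<in>I. H i j * x j) - H k i * w * T"
      unfolding x(2)[OF that, symmetric] H'_def T_def
      by (simp add: sum_distrib_left right_diff_distrib sum_subtractf mult_ac)
    then show ?thesis unfolding row a'_def using sym[of i k] by (simp add: algebra_simps)
  qed
  moreover have "x' i \<in> funs" for i unfolding x'_def using x w a T by (simp add: funs_mult funs_diff)
  ultimately show ?case by blast
qed

lemma riemannianD:
  assumes "riemannian_metric A g"
  shows riemannian_bilinear: "g \<in> bilinear_forms A" and riemannian_sym: "g X Y = g Y X"
    and riemannian_pos: "X \<in> fields \<Longrightarrow> nonzero_at X p \<Longrightarrow> g X X p > 0"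
  using assms by (auto simp: riemannian_metric_def)

lemma riemannian_nonneg: "riemannian_metric A g \<Longrightarrow> X \<in> fields \<Longrightarrow> g X X p \<ge> 0"
  using riemannian_pos[of g X p] form_tensorial[OF bilinear_right[OF riemannian_bilinear], of g X p X]
  by (cases "nonzero_at X p") (auto simp: nonzero_at_def less_imp_le)

lemma riemannian_eqI:
  assumes g: "riemannian_metric A g" and "X \<in> fields" "Y \<in> fields" "\<And>Z. Z \<in> fields \<Longrightarrow> g X Z = g Y Z"
  shows "X = Y"
proof -
  have "g (X - Y) (X - Y) = 0"
    using assms(4)[of "X - Y"] assms(2,3) by (simp add: bilinear_left_simps[OF riemannian_bilinear[OF g]] vf_diff)
  then have "\<not> nonzero_at (X - Y) p" for p
    using riemannian_pos[OF g vf_diff[OF assms(2,3)], of p] by auto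
  then show ?thesis by (auto simp: nonzero_at_def fun_eq_iff)
qed

text \<open>The generators \<open>E i\<close> are in general dependent, so their Gram matrix is only
  semidefinite. Adding the squares of a matrix \<open>Q\<close> that detects whether a tuple is the
  coefficient tuple of a field makes it definite; on actual coefficient tuples the added term
  vanishes, so the solution still represents \<alpha>.\<close>

lemma sharp_exists:
  assumes g: "riemannian_metric A g" and \<alpha>: "\<alpha> \<in> one_forms A"
  shows "\<exists>U\<in>fields. \<forall>X\<in>fields. g U X = \<alpha> X"
proof -
  note gb = riemannian_bilinear[OF g]
  obtain I :: "('m \<times> 'e) set" and E' u' where I: "finite I" and Eu': "\<And>i. i \<in> I \<Longrightarrow> E' i \<in> fields"
    "\<And>i. i \<in> I \<Longrightarrow> u' i \<in> funs" "\<And>X. X \<in> fields \<Longrightarrow> X = (\<Sum>i\<in>I. X (u' i) \<cdot>\<^sub>v E' i)"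
    by (rule dual_basis) blast
  \<comment> \<open>Extension by zero, because \<open>gram_solvable\<close> has conditions on all
    indices and not only on those in \<open>I\<close>.\<close>
  define E where "E i = (if i \<in> I then E' i else 0)" for i
  define u where "u i = (if i \<in> I then u' i else 0)" for i
  have E: "E i \<in> fields" and u: "u i \<in> funs" for i using Eu' by (auto simp: E_def u_def vf_zero funs_0)
  have rep: "X = (\<Sum>i\<in>I. X (u i) \<cdot>\<^sub>v E i)" if "X \<in> fields" for X
    using Eu'(3)[OF that] by (simp add: E_def u_def)
  \<comment> \<open>The matrix with entries \<open>E i (u l)\<close> sends a tuple to the dual basis
    coefficients of the field it generates and is idempotent; \<open>Q\<close> is the complementary
    projection.\<close>
  define Q where "Q i l = (if i = l then 1 else 0) - E i (u l)" for i l
  have Q: "Q i l \<in> funs" for i l unfolding Q_def using fields_funs[OF E, of i] by (simp add: funs_intros)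
  have Q_sum: "(\<Sum>i\<in>I. c i * Q i l) = c l - (\<Sum>i\<in>I. c i \<cdot>\<^sub>v E i) (u l)" if "l \<in> I" for c l
    using that I by (simp add: Q_def right_diff_distrib sum_subtractf smul_def
        if_distrib[of "\<lambda>x. _ * x"] cong: if_cong)
  define H where "H i j = g (E i) (E j) + (\<Sum>l\<in>I. Q i l * Q j l)" for i j
  have "\<exists>x. (\<forall>i. x i \<in> funs) \<and> (\<forall>i\<in>I. (\<Sum>j\<in>I. H i j * x j) = \<alpha> (E i))"
  proof (rule gram_solvable[OF I])
    show "H i j \<in> funs" for i j unfolding H_def by (intro funs_add funs_sum funs_mult Q bilinear_funs[OF gb])
    show "H i j = H j i" for i j unfolding H_def by (simp add: riemannian_sym[OF g, of "E i" "E j"] mult.commute)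
    show "\<alpha> (E i) \<in> funs" for i by (rule form_funs[OF \<alpha>])
    fix c :: "'m \<times> 'e \<Rightarrow> real" and p assume c: "\<exists>i\<in>I. c i \<noteq> 0"
    define X where "X = (\<Sum>i\<in>I. (\<lambda>_. c i) \<cdot>\<^sub>v E i)"
    have X: "X \<in> fields" unfolding X_def by (intro vf_sum vf_smul funs_const E)
    have "g X X p = (\<Sum>i\<in>I. \<Sum>j\<in>I. c i * c j * g (E i) (E j) p)"
      by (simp add: X_def bilinear_simps[OF gb] vf_smul vf_sum funs_const E sum_distrib_left mult_ac
          riemannian_sym[OF g])
    moreover have "(\<Sum>l\<in>I. (c l - X (u l) p)\<^sup>2) = (\<Sum>i\<in>I. \<Sum>j\<in>I. c i * c j * (\<Sum>l\<in>I. Q i l p * Q j l p))"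
    proof -
      have "c l - X (u l) p = (\<Sum>i\<in>I. c i * Q i l p)" if "l \<in> I" for l
        using fun_cong[OF Q_sum[OF that, of "\<lambda>i _. c i"], of p] by (simp add: X_def)
      then have "(\<Sum>l\<in>I. (c l - X (u l) p)\<^sup>2) = (\<Sum>l\<in>I. \<Sum>i\<in>I. \<Sum>j\<in>I. c i * c j * (Q i l p * Q j l p))"
        by (simp add: power2_eq_square sum_product mult_ac)
      also have "\<dots> = (\<Sum>i\<in>I. \<Sum>l\<in>I. \<Sum>j\<in>I. c i * c j * (Q i l p * Q j l p))" by (rule sum.swap)
      also have "\<dots> = (\<Sum>i\<in>I. \<Sum>j\<in>I. \<Sum>l\<in>I. c i * c j * (Q i l p * Q j l p))"
        by (intro sum.cong refl sum.swap)
      finally show ?thesis by (simp add: sum_distrib_left)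
    qed
    ultimately have eq: "(\<Sum>i\<in>I. \<Sum>j\<in>I. c i * c j * H i j p) = g X X p + (\<Sum>l\<in>I. (c l - X (u l) p)\<^sup>2)"
      by (simp add: H_def distrib_left sum.distrib)
    show "(\<Sum>i\<in>I. \<Sum>j\<in>I. c i * c j * H i j p) > 0"
    proof (cases "nonzero_at X p")
      case True
      then show ?thesis unfolding eq
        using riemannian_pos[OF g X] by (intro add_pos_nonneg sum_nonneg) auto
    next
      case False
      then have "c l - X (u l) p = c l" for l by (simp add: nonzero_at_def)
      then have "(\<Sum>l\<in>I. (c l - X (u l) p)\<^sup>2) > 0" using c I by (auto intro!: sum_pos2)
      then show ?thesis unfolding eq using riemannian_nonneg[OF g X] by (intro add_nonneg_pos)
    qed
  qed
  then obtain x where x: "\<And>i. x i \<in> funs" and Hx: "\<And>i. i \<in> I \<Longrightarrow> (\<Sum>j\<in>I. H i j * x j) = \<alpha> (E i)"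
    by blast
  define X where "X = (\<Sum>i\<in>I. x i \<cdot>\<^sub>v E i)"
  have X: "X \<in> fields" unfolding X_def by (intro vf_sum vf_smul x E)
  have "g X Y = \<alpha> Y" if Y: "Y \<in> fields" for Y
  proof -
    define y where "y j = Y (u j)" for j
    have y: "y j \<in> funs" for j unfolding y_def by (rule fields_funs[OF Y])
    have Y_eq: "Y = (\<Sum>j\<in>I. y j \<cdot>\<^sub>v E j)" unfolding y_def by (rule rep[OF Y])
    \<comment> \<open>The coefficients \<open>y\<close> of a field are annihilated by
      \<open>Q\<close>.\<close>
    have yQ: "(\<Sum>j\<in>I. y j * Q j l) = 0" if "l \<in> I" for l
      unfolding Q_sum[OF that] Y_eq[symmetric] by (simp add: y_def)
    have "(\<Sum>j\<in>I. \<Sum>i\<in>I. \<Sum>l\<in>I. y j * x i * (Q j l * Q i l)) = (\<Sum>l\<in>I. (\<Sum>j\<in>I. y j * Q j l) * (\<Sum>i\<in>I. x i * Q i l))"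
    proof -
      have "(\<Sum>j\<in>I. \<Sum>i\<in>I. \<Sum>l\<in>I. y j * x i * (Q j l * Q i l)) = (\<Sum>j\<in>I. \<Sum>l\<in>I. \<Sum>i\<in>I. y j * x i * (Q j l * Q i l))"
        by (intro sum.cong refl sum.swap)
      also have "\<dots> = (\<Sum>l\<in>I. \<Sum>j\<in>I. \<Sum>i\<in>I. y j * x i * (Q j l * Q i l))" by (rule sum.swap)
      also have "\<dots> = (\<Sum>l\<in>I. \<Sum>j\<in>I. \<Sum>i\<in>I. (y j * Q j l) * (x i * Q i l))" by (simp add: mult_ac)
      finally show ?thesis by (simp only: sum_product)
    qed
    then have Q0: "(\<Sum>j\<in>I. \<Sum>i\<in>I. \<Sum>l\<in>I. y j * x i * (Q j l * Q i l)) = 0" by (simp add: yQ)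
    have "\<alpha> Y = (\<Sum>j\<in>I. y j * \<alpha> (E j))"
      by (subst Y_eq) (simp add: form_simps[OF \<alpha>] vf_smul E y)
    also have "\<dots> = (\<Sum>j\<in>I. \<Sum>i\<in>I. y j * x i * H j i)"
      by (simp add: Hx[symmetric] sum_distrib_left mult_ac)
    also have "\<dots> = (\<Sum>j\<in>I. \<Sum>i\<in>I. y j * x i * g (E j) (E i))"
      using Q0 by (simp add: H_def distrib_left sum.distrib sum_distrib_left)
    also have "\<dots> = (\<Sum>j\<in>I. y j * g (E j) X)"
      by (simp add: X_def bilinear_simps[OF gb] vf_smul E x sum_distrib_left mult_ac del: times_fun_apply)
    also have "\<dots> = g (\<Sum>j\<in>I. y j \<cdot>\<^sub>v E j) X"
      by (simp add: bilinear_left_simps[OF gb] vf_smul E y)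
    finally have "\<alpha> Y = g Y X" by (simp only: Y_eq[symmetric])
    then show ?thesis by (simp only: riemannian_sym[OF g, of X])
  qed
  then show ?thesis using X by blast
qed

lemma sharp_eqI:
  assumes "riemannian_metric A g" "U \<in> fields" "\<And>X. X \<in> fields \<Longrightarrow> g U X = \<alpha> X"
  shows "sharp A g \<alpha> = U"
  unfolding sharp_def
proof (rule the_equality)
  fix W assume "W \<in> fields \<and> (\<forall>X\<in>fields. g W X = \<alpha> X)"
  then show "W = U" using assms by (intro riemannian_eqI[OF assms(1)]) auto
qed (use assms in auto)

lemma sharp:
  assumes "riemannian_metric A g" "\<alpha> \<in> one_forms A"
  shows sharp_field: "sharp A g \<alpha> \<in> fields" and sharp_eq: "X \<in> fields \<Longrightarrow> g (sharp A g \<alpha>) X = \<alpha> X"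
proof -
  obtain U where U: "U \<in> fields" "\<And>X. X \<in> fields \<Longrightarrow> g U X = \<alpha> X" using sharp_exists[OF assms] by blast
  then have "sharp A g \<alpha> = U" by (rule sharp_eqI[OF assms(1)])
  then show "sharp A g \<alpha> \<in> fields" "X \<in> fields \<Longrightarrow> g (sharp A g \<alpha>) X = \<alpha> X" using U by auto
qed

section \<open>The Levi-Civita connection\<close>

text \<open>\<open>K\<close> is the right-hand side of the Koszul formula, that is, twice the
  product of D_X Y with \<open>Z\<close>. For fixed \<open>X\<close> and \<open>Y\<close> it is
  linear over the smooth functions in \<open>Z\<close>, so the musical isomorphism yields a field;
  each axiom is then checked after pairing with an arbitrary field.\<close>

lemma levi_civita_exists:
  assumes g: "riemannian_metric A g"
  shows "\<exists>D. levi_civita A g D"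
proof -
  note gb = riemannian_bilinear[OF g]
  note g_funs = bilinear_funs[OF gb]
  note sym = riemannian_sym[OF g]
  define h :: "'m \<Rightarrow> real" where "h = (\<lambda>_. 1 / 2)"
  have h: "h \<in> funs" unfolding h_def by (rule funs_const)
  have hh: "h * a + h * a = a" for a by (simp add: h_def fun_eq_iff)
  define K where "K X Y Z = X (g Y Z) + Y (g X Z) - Z (g X Y)
     + g (bracket X Y) Z - g (bracket X Z) Y - g (bracket Y Z) X" for X Y Z
  \<comment> \<open>One-forms must be 0 at arguments that are not fields, which \<open>K\<close>
    alone does not guarantee.\<close>
  define k where "k X Y Z = (if Z \<in> fields then h * K X Y Z else 0)" for X Y Z
  note simps = bilinear_simps[OF gb] form_simps[OF bilinear_right[OF gb]] bracket_simps vf_bracket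
    g_funs funs_intros smul_apply
  have k: "k X Y \<in> one_forms A" if "X \<in> fields" "Y \<in> fields" for X Y
  proof (rule one_formsI)
    note rules = field_rules[OF that(1)] field_rules[OF that(2)]
    show "k X Y Z \<in> funs" if "Z \<in> fields" for Z
      unfolding k_def K_def using that \<open>X \<in> fields\<close> \<open>Y \<in> fields\<close>
      by (auto intro!: funs_intros h g_funs simp: rules field_rules[OF that])
    show "k X Y (Z + W) = k X Y Z + k X Y W" if "Z \<in> fields" "W \<in> fields" for Z W
      using that \<open>X \<in> fields\<close> \<open>Y \<in> fields\<close>
      by (simp add: k_def K_def vf_add simps rules field_rules[OF that(1)] field_rules[OF that(2)] algebra_simps)
    show "k X Y (f \<cdot>\<^sub>v Z) = f * k X Y Z" if "f \<in> funs" "Z \<in> fields" for f Z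
      using that \<open>X \<in> fields\<close> \<open>Y \<in> fields\<close> sym[of X Y] sym[of Z X] sym[of Z Y]
      by (simp add: k_def K_def vf_smul simps rules field_rules[OF that(2)] algebra_simps)
  qed (simp add: k_def)
  define D where "D X Y = sharp A g (k X Y)" for X Y
  have D: "D X Y \<in> fields" if "X \<in> fields" "Y \<in> fields" for X Y
    unfolding D_def by (rule sharp_field[OF g k[OF that]])
  have gD: "g (D X Y) Z = h * K X Y Z" if "X \<in> fields" "Y \<in> fields" "Z \<in> fields" for X Y Z
    using sharp_eq[OF g k[OF that(1,2)] that(3)] that(3) by (simp add: D_def k_def)
  have "affine_connection A D"
    unfolding affine_connection_def
  proof (intro conjI ballI)
    fix X Y Z assume XYZ: "X \<in> fields" "Y \<in> fields" "Z \<in> fields"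
    note rules = field_rules[OF XYZ(1)] field_rules[OF XYZ(2)] field_rules[OF XYZ(3)]
    show "D (X + Y) Z = D X Z + D Y Z"
    proof (rule riemannian_eqI[OF g])
      fix W assume W: "W \<in> fields"
      show "g (D (X + Y) Z) W = g (D X Z + D Y Z) W"
        using XYZ W by (simp add: vf_add D gD K_def simps rules field_rules[OF W] algebra_simps)
    qed (use XYZ in \<open>simp_all add: vf_add D\<close>)
    show "D X (Y + Z) = D X Y + D X Z"
    proof (rule riemannian_eqI[OF g])
      fix W assume W: "W \<in> fields"
      show "g (D X (Y + Z)) W = g (D X Y + D X Z) W"
        using XYZ W by (simp add: vf_add D gD K_def simps rules field_rules[OF W] algebra_simps)
    qed (use XYZ in \<open>simp_all add: vf_add D\<close>)
  next
    fix f X Y assume fXY: "f \<in> funs" "X \<in> fields" "Y \<in> fields"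
    note rules = field_rules[OF fXY(2)] field_rules[OF fXY(3)]
    show "D (f \<cdot>\<^sub>v X) Y = f \<cdot>\<^sub>v D X Y"
    proof (rule riemannian_eqI[OF g])
      fix Z assume Z: "Z \<in> fields"
      have "K (f \<cdot>\<^sub>v X) Y Z = f * K X Y Z"
        using fXY Z sym[of Z X] sym[of Z Y] sym[of X Y]
        by (simp add: K_def vf_smul simps rules field_rules[OF Z] algebra_simps)
      then show "g (D (f \<cdot>\<^sub>v X) Y) Z = g (f \<cdot>\<^sub>v D X Y) Z"
        using fXY Z by (simp add: vf_smul D gD simps mult_ac)
    qed (use fXY in \<open>simp_all add: vf_smul D\<close>)
    show "D X (f \<cdot>\<^sub>v Y) = X f \<cdot>\<^sub>v Y + f \<cdot>\<^sub>v D X Y"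
    proof (rule riemannian_eqI[OF g])
      fix Z assume Z: "Z \<in> fields"
      have "K X (f \<cdot>\<^sub>v Y) Z = f * K X Y Z + (X f * g Y Z + X f * g Y Z)"
        using fXY Z sym[of Z X] sym[of Z Y] sym[of X Y]
        by (simp add: K_def vf_smul simps rules field_rules[OF Z] algebra_simps)
      then have "h * K X (f \<cdot>\<^sub>v Y) Z = f * (h * K X Y Z) + X f * g Y Z"
        using hh[of "X f * g Y Z"] by (simp add: distrib_left mult_ac)
      then show "g (D X (f \<cdot>\<^sub>v Y)) Z = g (X f \<cdot>\<^sub>v Y + f \<cdot>\<^sub>v D X Y) Z"
        using fXY Z by (simp add: vf_smul vf_add D gD simps rules)
    qed (use fXY in \<open>simp_all add: vf_smul vf_add rules D\<close>)
  qed (rule D)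
  moreover have "D X Y - D Y X = bracket X Y" if "X \<in> fields" "Y \<in> fields" for X Y
  proof (rule riemannian_eqI[OF g])
    fix Z assume Z: "Z \<in> fields"
    have "K X Y Z - K Y X Z = g (bracket X Y) Z + g (bracket X Y) Z"
      using that Z bracket_anticomm[of Y X] by (simp add: K_def sym[of Y X] simps)
    then have "h * K X Y Z - h * K Y X Z = g (bracket X Y) Z"
      using hh[of "g (bracket X Y) Z"] by (simp only: right_diff_distrib[symmetric] distrib_left[symmetric])
    then show "g (D X Y - D Y X) Z = g (bracket X Y) Z"
      using that Z by (simp add: D gD simps)
  qed (use that in \<open>simp_all add: D vf_intros\<close>)
  moreover have "X (g Y Z) = g (D X Y) Z + g Y (D X Z)" if "X \<in> fields" "Y \<in> fields" "Z \<in> fields" for X Y Z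
  proof -
    have "K X Y Z + K X Z Y = X (g Y Z) + X (g Y Z)"
      using that bracket_anticomm[of Y Z] by (simp add: K_def sym[of Z Y] simps)
    then have "h * K X Y Z + h * K X Z Y = X (g Y Z)"
      using hh[of "X (g Y Z)"] by (simp only: distrib_left[symmetric])
    then show ?thesis using that by (simp add: gD sym[of Y "D X Z"])
  qed
  ultimately show ?thesis unfolding levi_civita_def by blast
qed

end

subsection \<open>Exterior derivative\<close>

context closed_manifold
begin

lemma d1_eq:
  "X \<in> fields \<Longrightarrow> Y \<in> fields \<Longrightarrow> d1 A \<alpha> X Y = X (\<alpha> Y) - Y (\<alpha> X) - \<alpha> (bracket X Y)"
  by (simp add: d1_def)

lemma d1_outside: "X \<notin> fields \<or> Y \<notin> fields \<Longrightarrow> d1 A \<alpha> X Y = 0"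
  by (auto simp: d1_def)

lemma d1_skew:
  assumes \<alpha>: "\<alpha> \<in> one_forms A"
  shows "d1 A \<alpha> Y X = - d1 A \<alpha> X Y"
  using bracket_anticomm[of Y X] by (simp add: d1_def form_uminus[OF \<alpha>] vf_bracket)

lemma d1_form:
  assumes \<alpha>: "\<alpha> \<in> one_forms A"
  shows "d1 A \<alpha> X \<in> one_forms A"
proof (cases "X \<in> fields")
  case X: True
  note rules = form_rules[OF \<alpha>] field_rules[OF X] vf_bracket bracket_simps X
  show ?thesis
  proof (rule one_formsI)
    fix Y assume Y: "Y \<in> fields"
    note rules = rules field_rules[OF Y] Y
    show "d1 A \<alpha> X Y \<in> funs" by (simp add: d1_eq rules funs_diff)
    show "d1 A \<alpha> X (f \<cdot>\<^sub>v Y) = f * d1 A \<alpha> X Y" if "f \<in> funs" for f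
      using that by (simp add: d1_eq rules vf_intros smul_apply algebra_simps)
    show "d1 A \<alpha> X (Y + Z) = d1 A \<alpha> X Y + d1 A \<alpha> X Z" if "Z \<in> fields" for Z
      using that by (simp add: d1_eq rules field_rules[OF that] vf_intros algebra_simps)
  qed (simp add: d1_def)
next
  case False
  then have "d1 A \<alpha> X = 0" by (simp add: d1_def fun_eq_iff)
  then show ?thesis by (simp add: one_forms_0)
qed

lemma two_formsI:
  assumes right: "\<And>X. \<beta> X \<in> one_forms A" and skew: "\<And>X Y. \<beta> Y X = - \<beta> X Y"
  shows "\<beta> \<in> two_forms A"
proof -
  have "(\<lambda>X. \<beta> X Y) = - \<beta> Y" for Y
  proof
    show "\<beta> X Y = (- \<beta> Y) X" for X using skew[of X Y] by simp
  qed
  then have "(\<lambda>X. \<beta> X Y) \<in> one_forms A" for Y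
    using one_forms_uminus[OF right, of Y] by metis
  then show ?thesis
    using right skew unfolding two_forms_def bilinear_forms_def by blast
qed

lemma two_formsD:
  assumes "\<beta> \<in> two_forms A"
  shows two_form_bilinear: "\<beta> \<in> bilinear_forms A" and two_form_skew: "\<beta> Y X = - \<beta> X Y"
  using assms unfolding two_forms_def by blast+

lemma d1_two_forms: "\<alpha> \<in> one_forms A \<Longrightarrow> d1 A \<alpha> \<in> two_forms A"
  by (rule two_formsI[OF d1_form d1_skew])

lemma two_forms_uminus:
  assumes "\<beta> \<in> two_forms A"
  shows "- \<beta> \<in> two_forms A"
proof (rule two_formsI)
  show "(- \<beta>) X \<in> one_forms A" for X
    using one_forms_uminus[OF bilinear_right[OF two_form_bilinear[OF assms]], of X] by simp
  show "(- \<beta>) Y X = - (- \<beta>) X Y" for X Y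
    using two_form_skew[OF assms, of Y X] by simp
qed

text \<open>This is d(d\<alpha>) = 0: second derivatives cancel by the definition of the bracket,
  double brackets by the Jacobi identity. Later it shows that d\<alpha> is invariant along every
  field that it annihilates.\<close>

lemma d2_d1:
  assumes \<alpha>: "\<alpha> \<in> one_forms A" and X: "X \<in> fields" and Y: "Y \<in> fields" and Z: "Z \<in> fields"
  shows "X (d1 A \<alpha> Y Z) - Y (d1 A \<alpha> X Z) + Z (d1 A \<alpha> X Y)
    - d1 A \<alpha> (bracket X Y) Z + d1 A \<alpha> (bracket X Z) Y - d1 A \<alpha> (bracket Y Z) X = 0"
proof -
  have cyc: "\<alpha> (bracket (bracket X Y) Z) = \<alpha> (bracket X (bracket Y Z)) - \<alpha> (bracket Y (bracket X Z))"
    "\<alpha> (bracket (bracket X Z) Y) = - \<alpha> (bracket Y (bracket X Z))"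
    "\<alpha> (bracket (bracket Y Z) X) = - \<alpha> (bracket X (bracket Y Z))"
    using bracket_anticomm[of "bracket X Z" Y] bracket_anticomm[of "bracket Y Z" X]
    by (simp_all add: jacobi[OF X Y Z] form_diff[OF \<alpha>] form_uminus[OF \<alpha>] vf_bracket X Y Z)
  have br: "bracket P Q f = P (Q f) - Q (P f)" for P Q :: "'m vf" and f by (simp add: bracket_def)
  show ?thesis
    by (simp add: d1_eq X Y Z vf_bracket cyc br field_rules[OF X] field_rules[OF Y] field_rules[OF Z]
        form_funs[OF \<alpha>] funs_diff)
qed

lemma d1_add:
  assumes \<alpha>: "\<alpha> \<in> one_forms A" and \<beta>: "\<beta> \<in> one_forms A"
  shows "d1 A (\<alpha> + \<beta>) = d1 A \<alpha> + d1 A \<beta>"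
proof (intro ext)
  fix X Y p
  show "d1 A (\<alpha> + \<beta>) X Y p = (d1 A \<alpha> + d1 A \<beta>) X Y p"
  proof (cases "X \<in> fields \<and> Y \<in> fields")
    case True
    then show ?thesis
      using fields_add[of X "\<alpha> Y" "\<beta> Y"] fields_add[of Y "\<alpha> X" "\<beta> X"]
      by (simp add: d1_eq form_funs[OF \<alpha>] form_funs[OF \<beta>])
  qed (auto simp: d1_def)
qed

section \<open>Endomorphism fields\<close>

lemma endosD:
  assumes "J \<in> endos A"
  shows endo_field: "X \<in> fields \<Longrightarrow> J X \<in> fields"
    and endo_add: "X \<in> fields \<Longrightarrow> Y \<in> fields \<Longrightarrow> J (X + Y) = J X + J Y"
    and endo_smul: "f \<in> funs \<Longrightarrow> X \<in> fields \<Longrightarrow> J (f \<cdot>\<^sub>v X) = f \<cdot>\<^sub>v J X"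
    and endo_outside: "X \<notin> fields \<Longrightarrow> J X = 0"
  using assms by (auto simp: endos_def)

lemma endo_more:
  assumes J: "J \<in> endos A"
  shows endo_0: "J 0 = 0" and endo_total: "J X \<in> fields"
    and endo_uminus: "X \<in> fields \<Longrightarrow> J (- X) = - J X"
    and endo_diff: "X \<in> fields \<Longrightarrow> Y \<in> fields \<Longrightarrow> J (X - Y) = J X - J Y"
proof -
  show 0: "J 0 = 0" using endo_add[OF J, of 0 0] vf_zero by simp
  show "J X \<in> fields" for X
    using endo_field[OF J] endo_outside[OF J] vf_zero by (cases "X \<in> fields") auto
  show um: "J (- X) = - J X" if "X \<in> fields" for X
    using endo_add[OF J that vf_uminus[OF that]] 0 by (simp add: eq_neg_iff_add_eq_0 add.commute)
  show "J (X - Y) = J X - J Y" if "X \<in> fields" "Y \<in> fields"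
    using endo_add[OF J that(1) vf_uminus[OF that(2)]] um[OF that(2)] by simp
qed

lemmas endo_rules = endo_add endo_smul endo_outside endo_0 endo_total endo_uminus endo_diff

lemma one_forms_comp:
  assumes \<alpha>: "\<alpha> \<in> one_forms A" and J: "J \<in> endos A"
  shows "(\<lambda>X. \<alpha> (J X)) \<in> one_forms A"
  by (rule one_formsI) (simp_all add: form_rules[OF \<alpha>] endo_rules[OF J])

end

subsection \<open>Vaisman structures\<close>

locale vaisman = closed_manifold A
  for A :: "('m::{t2_space, second_countable_topology}, 'e::euclidean_space) chart set" +
  fixes J :: "'m endo" and g :: "'m form2" and \<theta> :: "'m form1"
  assumes vaisman: "vaisman_structure A J g \<theta>"
begin

abbreviation "U \<equiv> field_U A g \<theta>"
abbreviation "V \<equiv> field_V A J g \<theta>"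
abbreviation "\<theta>c \<equiv> theta_c J \<theta>"
abbreviation "\<omega>\<^sub>0 \<equiv> omega0 A J \<theta>"

section \<open>The Lee form, the anti-Lee form and their dual fields\<close>

lemma endo: "J \<in> endos A"
  and J_J: "X \<in> fields \<Longrightarrow> J (J X) = - X"
  and nijenhuis: "X \<in> fields \<Longrightarrow> Y \<in> fields \<Longrightarrow>
    bracket (J X) (J Y) - J (bracket (J X) Y) - J (bracket X (J Y)) - bracket X Y = 0"
  and metric: "riemannian_metric A g"
  and hermitian: "X \<in> fields \<Longrightarrow> Y \<in> fields \<Longrightarrow> g (J X) (J Y) = g X Y"
  and lee: "\<theta> \<in> one_forms A"
  and lee_closed: "d1 A \<theta> = 0"
  and lck: "d2 A (fundamental_form J g) = wedge12 \<theta> (fundamental_form J g)"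
  and lee_not_exact: "\<not> (\<exists>f\<in>funs. \<theta> = d0 A f)"
  and lee_unit: "form_norm A g \<theta> p = 1"
  and complex_dim: "DIM('e) div 2 \<ge> 2"
  using vaisman unfolding vaisman_structure_def lck_structure_def hermitian_structure_def
    complex_structure_def by auto

lemmas J_rules = endo_rules[OF endo]
lemmas g_rules = bilinear_simps[OF riemannian_bilinear[OF metric]]
lemmas g_sym = riemannian_sym[OF metric]
lemmas lee_rules = form_rules[OF lee]

lemma U_field: "U \<in> fields"
  unfolding field_U_def by (rule sharp_field[OF metric lee])

lemma V_eq: "V = J U"
  by (simp add: field_V_def)

lemma V_field: "V \<in> fields"
  by (simp add: V_eq J_rules)

lemma J_V: "J V = - U"
  by (simp add: V_eq J_J U_field)

lemma g_U: "X \<in> fields \<Longrightarrow> g U X = \<theta> X"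
  unfolding field_U_def by (rule sharp_eq[OF metric lee])

lemma g_J_left: "X \<in> fields \<Longrightarrow> Y \<in> fields \<Longrightarrow> g (J X) Y = - g X (J Y)"
  using hermitian[of X "J Y"] by (simp add: J_J J_rules g_rules minus_equation_iff[of "g (J X) Y"])

lemma fundamental_skew: "X \<in> fields \<Longrightarrow> Y \<in> fields \<Longrightarrow> g (J Y) X = - g (J X) Y"
  using g_J_left[of X Y] g_sym[of X "J Y"] by simp

lemma lee_U: "\<theta> U = 1"
proof
  fix p
  have "g U U p = 1" using lee_unit[of p] by (simp add: form_norm_def field_U_def)
  then show "\<theta> U p = 1 p" using g_U[OF U_field] by simp
qed

lemma theta_c_form: "\<theta>c \<in> one_forms A"
proof -
  have "\<theta>c = - (\<lambda>X. \<theta> (J X))" by (simp add: theta_c_def fun_eq_iff)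
  then show ?thesis using one_forms_uminus[OF one_forms_comp[OF lee endo]] by simp
qed

lemmas theta_c_rules = form_rules[OF theta_c_form]

lemma lee_J: "\<theta> (J X) = - \<theta>c X"
  by (simp add: theta_c_def)

lemma theta_c_J: "X \<in> fields \<Longrightarrow> \<theta>c (J X) = \<theta> X"
  by (simp add: theta_c_def J_J lee_rules)

lemma theta_c_U: "\<theta>c U = 0"
proof -
  have "g (J U) U = - g (J U) U" using fundamental_skew[OF U_field U_field] .
  then have "g (J U) U = 0" by (simp add: fun_eq_iff)
  then have "g U (J U) = 0" using g_sym[of U "J U"] by simp
  then show ?thesis using g_U[of "J U"] by (simp add: theta_c_def J_rules)
qed

lemma lee_V: "\<theta> V = 0"
  using theta_c_U lee_J[of U] by (simp add: V_eq)

lemma theta_c_V: "\<theta>c V = 1"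
  using theta_c_J[OF U_field] lee_U by (simp add: V_eq)

lemma g_V: "X \<in> fields \<Longrightarrow> g V X = \<theta>c X"
  using g_J_left[OF U_field, of X] g_U[of "J X"] by (simp add: V_eq theta_c_def J_rules)

lemma lee_bracket: "X \<in> fields \<Longrightarrow> Y \<in> fields \<Longrightarrow> \<theta> (bracket X Y) = X (\<theta> Y) - Y (\<theta> X)"
  using fun_cong[OF fun_cong[OF lee_closed], of X Y] by (simp add: d1_eq)

section \<open>Holomorphy of U and V, and the derivative of the anti-Lee form\<close>

text \<open>A parallel Lee form has a parallel dual field, so torsion-freeness turns D_U into the
  bracket with \<open>U\<close>, and metric compatibility becomes the Killing equation.\<close>

lemma killing_U:
  assumes X: "X \<in> fields" and Y: "Y \<in> fields"
  shows "U (g X Y) = g (bracket U X) Y + g X (bracket U Y)"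
proof -
  obtain D where D: "levi_civita A g D" "parallel_form A D \<theta>"
    using vaisman unfolding vaisman_structure_def by blast
  have D_field: "D X Y \<in> fields" if "X \<in> fields" "Y \<in> fields" for X Y
    using D(1) that unfolding levi_civita_def affine_connection_def by blast
  have compat: "X (g Y Z) = g (D X Y) Z + g Y (D X Z)" if "X \<in> fields" "Y \<in> fields" "Z \<in> fields" for X Y Z
    using D(1) that unfolding levi_civita_def by blast
  have torsion: "D X Y - D Y X = bracket X Y" if "X \<in> fields" "Y \<in> fields" for X Y
    using D(1) that unfolding levi_civita_def by blast
  have D_U: "D X U = 0" if X: "X \<in> fields" for X
  proof (rule riemannian_eqI[OF metric D_field[OF X U_field] vf_zero])
    fix Y assume Y: "Y \<in> fields"
    have "X (g U Y) = g (D X U) Y + g U (D X Y)" by (rule compat[OF X U_field Y])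
    moreover have "X (\<theta> Y) - \<theta> (D X Y) = 0" using D(2) X Y unfolding parallel_form_def by blast
    ultimately show "g (D X U) Y = g 0 Y"
      by (simp add: g_U D_field X Y g_rules)
  qed
  have "D U X = bracket U X" if "X \<in> fields" for X
    using torsion[OF U_field that] D_U[OF that] by simp
  then show ?thesis using compat[OF U_field X Y] X Y by simp
qed

lemma lck_eq:
  assumes "X \<in> fields" "Y \<in> fields" "Z \<in> fields"
  shows "X (g (J Y) Z) - Y (g (J X) Z) + Z (g (J X) Y)
      - g (J (bracket X Y)) Z + g (J (bracket X Z)) Y - g (J (bracket Y Z)) X
    = \<theta> X * g (J Y) Z - \<theta> Y * g (J X) Z + \<theta> Z * g (J X) Y"
  using fun_cong[OF fun_cong[OF fun_cong[OF lck]], of X Y Z] assms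
  by (simp add: d2_def wedge12_def fundamental_form_def)

text \<open>
  The tensor \<open>B(X, Y) = g((L\<^sub>U J)X, Y)\<close> is skew, being the Lie derivative of the fundamental form
  along the Killing field \<open>U\<close>; it is also symmetric, because the fundamental form is preserved by
  \<open>V\<close> and the Nijenhuis tensor vanishes, so that \<open>B = L\<^sub>V g\<close>. Hence \<open>L\<^sub>U J = 0\<close>.
\<close>

lemma bracket_U_J: "X \<in> fields \<Longrightarrow> bracket U (J X) = J (bracket U X)"
  and d1_theta_c: "X \<in> fields \<Longrightarrow> Y \<in> fields \<Longrightarrow>
    d1 A \<theta>c X Y = \<theta> X * \<theta>c Y - \<theta> Y * \<theta>c X - g (J X) Y"
proof -
  define B where "B X Y = g (bracket U (J X)) Y - g (J (bracket U X)) Y" for X Y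
  have lie_fund: "U (g (J X) Y) - g (J (bracket U X)) Y - g (J X) (bracket U Y) = B X Y"
    if "X \<in> fields" "Y \<in> fields" for X Y
    using killing_U[of "J X" Y] that by (simp add: B_def J_rules)
  have skew: "B Y X = - B X Y" if X: "X \<in> fields" and Y: "Y \<in> fields" for X Y
    using fundamental_skew[OF X Y] fundamental_skew[of "bracket U X" Y] fundamental_skew[of X "bracket U Y"]
      g_sym[of "J (bracket U Y)" X] X Y
    by (simp add: lie_fund[OF X Y, symmetric] lie_fund[OF Y X, symmetric] field_rules[OF U_field] bilinear_funs[OF riemannian_bilinear[OF metric]] vf_bracket U_field)
  have sym: "B Y X = B X Y" if X: "X \<in> fields" and Y: "Y \<in> fields" for X Y
  proof -
    \<comment> \<open>Cartan's formula for \<open>V\<close>: contracting the fundamental form with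
      \<open>V\<close> gives -\<theta>, which is closed, and in the contraction of \<theta> \<and>
      \<omega> one term contains \<open>\<theta> V = 0\<close> and the other becomes \<theta> \<and>
      \<theta>.\<close>
    have lie_V: "V (g (J X) Y) = g (J (bracket V X)) Y + g (J X) (bracket V Y)"
      if X: "X \<in> fields" and Y: "Y \<in> fields" for X Y
    proof -
      have "g (J V) Z = - \<theta> Z" if "Z \<in> fields" for Z
        using that by (simp add: J_V g_rules U_field g_U)
      moreover have "g (J (bracket X Y)) V = X (\<theta> Y) - Y (\<theta> X)"
        using fundamental_skew[of V "bracket X Y"] X Y
        by (simp add: lee_bracket[OF X Y, symmetric] J_V g_rules U_field g_U vf_bracket V_field)
      moreover have "g (J (bracket V Y)) X = - g (J X) (bracket V Y)"
        using fundamental_skew[of X "bracket V Y"] X Y by (simp add: vf_bracket V_field)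
      ultimately show ?thesis
        using lck_eq[OF V_field X Y] X Y
        by (simp add: lee_V field_rules[OF X] field_rules[OF Y] lee_rules, simp add: algebra_simps)
    qed
    have "B X Y = V (g X Y) - g (bracket V X) Y - g X (bracket V Y)"
      if X: "X \<in> fields" and Y: "Y \<in> fields" for X Y
    proof -
      \<comment> \<open>The Nijenhuis tensor at \<open>U\<close> and \<open>X\<close> expresses the
        derivative of \<open>J\<close> along \<open>V\<close> by that along \<open>U\<close>;
        combined with the invariance of the fundamental form this leaves the Lie derivative of the
        metric.\<close>
      have "bracket V (J X) = J (bracket V X) + J (bracket U (J X)) + bracket U X"
        using nijenhuis[OF U_field X] by (simp add: V_eq algebra_simps)
      then have "J (bracket V (J X)) = - bracket V X - bracket U (J X) + J (bracket U X)"
        using X by (simp add: J_rules vf_intros U_field V_field J_J)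
      then have "g (J (bracket V (J X))) Y = - g (bracket V X) Y - g (bracket U (J X)) Y + g (J (bracket U X)) Y"
        using X by (simp add: g_rules J_rules vf_intros U_field V_field)
      moreover have "- V (g X Y) = g (J (bracket V (J X))) Y - g X (bracket V Y)"
        using lie_V[of "J X" Y] X Y
        by (simp add: J_J J_rules g_rules field_rules[OF V_field] bilinear_funs[OF riemannian_bilinear[OF metric]])
      ultimately show ?thesis
        unfolding B_def by (simp add: algebra_simps)
    qed
    from this[OF X Y] this[OF Y X] show ?thesis
      using g_sym[of Y X] g_sym[of "bracket V X" Y] g_sym[of "bracket V Y" X] by simp
  qed
  have B0: "B X Y = 0" if "X \<in> fields" "Y \<in> fields" for X Y
    using skew[OF that] sym[OF that] by (simp add: fun_eq_iff)
  show "bracket U (J X) = J (bracket U X)" if X: "X \<in> fields"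
  proof (rule riemannian_eqI[OF metric])
    show "g (bracket U (J X)) Y = g (J (bracket U X)) Y" if "Y \<in> fields" for Y
      using B0[OF X that] by (simp add: B_def)
  qed (simp_all add: J_rules vf_bracket U_field X)
  assume X: "X \<in> fields" and Y: "Y \<in> fields"
  \<comment> \<open>Contracting the fundamental form with \<open>U\<close> gives
    \<open>\<theta>c\<close>. As that form is now invariant along \<open>U\<close>, Cartan's formula
    makes the derivative of \<open>\<theta>c\<close> minus the contraction of \<theta> \<and>
    \<omega> with \<open>U\<close>.\<close>
  have "g (J (bracket X Y)) U = - \<theta>c (bracket X Y)"
    using fundamental_skew[of U "bracket X Y"] X Y g_V by (simp add: V_eq U_field vf_bracket)
  moreover have "g (J (bracket U Y)) X = - g (J X) (bracket U Y)"
    using fundamental_skew[of X "bracket U Y"] X Y by (simp add: vf_bracket U_field)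
  ultimately show "d1 A \<theta>c X Y = \<theta> X * \<theta>c Y - \<theta> Y * \<theta>c X - g (J X) Y"
    using lck_eq[OF U_field X Y] lie_fund[OF X Y] B0[OF X Y] g_V X Y
    by (simp add: d1_eq lee_U V_eq algebra_simps)
qed

text \<open>By the vanishing of the Nijenhuis tensor L_V J = J L_U J, so holomorphy passes from
  \<open>U\<close> to \<open>V\<close>.\<close>

lemma bracket_V_J: "X \<in> fields \<Longrightarrow> bracket V (J X) = J (bracket V X)"
  using nijenhuis[OF U_field, of X] bracket_U_J[of X]
  by (simp add: V_eq J_J J_rules vf_bracket U_field)

lemma bracket_U_V: "bracket U V = 0"
  using bracket_U_J[OF U_field] by (simp add: V_eq J_rules)

lemma omega0_eq:
  "X \<in> fields \<Longrightarrow> Y \<in> fields \<Longrightarrow> \<omega>\<^sub>0 X Y = g (J X) Y - \<theta> X * \<theta>c Y + \<theta> Y * \<theta>c X"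
  using d1_theta_c[of X Y] by (simp add: omega0_def)

lemma omega0_U: "Y \<in> fields \<Longrightarrow> \<omega>\<^sub>0 U Y = 0"
  using g_V[of Y] by (simp add: omega0_eq U_field lee_U theta_c_U flip: V_eq)

lemma omega0_V: "Y \<in> fields \<Longrightarrow> \<omega>\<^sub>0 V Y = 0"
  by (simp add: omega0_eq V_field J_V g_rules U_field g_U lee_V theta_c_V)

lemma omega0_J: "X \<in> fields \<Longrightarrow> Y \<in> fields \<Longrightarrow> \<omega>\<^sub>0 (J X) (J Y) = \<omega>\<^sub>0 X Y"
  by (simp add: omega0_eq J_rules hermitian lee_J theta_c_J algebra_simps)

section \<open>Tangent fields and basic forms of the characteristic foliation\<close>

text \<open>The coefficients in the definition of \<open>sigma_fields\<close> are chosen point by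
  point, without smoothness. Evaluating \<theta> and \<open>\<theta>c\<close> identifies them with
  values of smooth functions.\<close>

lemma sigma_fields_decomp:
  assumes "X \<in> sigma_fields A J g \<theta>"
  shows "X = \<theta> X \<cdot>\<^sub>v U + \<theta>c X \<cdot>\<^sub>v V"
proof (intro ext)
  fix f p
  have X: "X \<in> fields" using assms by (simp add: sigma_fields_def)
  obtain a b where ab: "\<And>f. X f p = a * U f p + b * V f p"
    using assms unfolding sigma_fields_def by blast
  \<comment> \<open>Freezing the coefficients found at \<open>p\<close> gives a global field with
    the same value there, so tensoriality applies.\<close>
  define Y where "Y = (\<lambda>_. a) \<cdot>\<^sub>v U + (\<lambda>_. b) \<cdot>\<^sub>v V"
  have Y: "Y \<in> fields" unfolding Y_def by (intro vf_add vf_smul funs_const U_field V_field)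
  have XY: "X f p = Y f p" for f using ab by (simp add: Y_def smul_apply)
  have "\<theta> X p = \<theta> Y p" "\<theta>c X p = \<theta>c Y p"
    using form_tensorial_eq[OF lee X Y XY] form_tensorial_eq[OF theta_c_form X Y XY] by auto
  moreover have "\<theta> Y = (\<lambda>_. a)" "\<theta>c Y = (\<lambda>_. b)"
    by (simp_all add: Y_def lee_rules theta_c_rules vf_smul funs_const U_field V_field
        lee_U lee_V theta_c_U theta_c_V)
  ultimately show "X f p = (\<theta> X \<cdot>\<^sub>v U + \<theta>c X \<cdot>\<^sub>v V) f p"
    using ab by (simp add: smul_apply)
qed

lemma sigma_fieldsI:
  assumes "f \<in> funs" "h \<in> funs"
  shows "f \<cdot>\<^sub>v U + h \<cdot>\<^sub>v V \<in> sigma_fields A J g \<theta>"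
  unfolding sigma_fields_def
proof (intro CollectI conjI allI)
  show "f \<cdot>\<^sub>v U + h \<cdot>\<^sub>v V \<in> fields" by (intro vf_add vf_smul assms U_field V_field)
  show "\<exists>a b. \<forall>k. (f \<cdot>\<^sub>v U + h \<cdot>\<^sub>v V) k p = a * U k p + b * V k p" for p
    by (intro exI[of _ "f p"] exI[of _ "h p"]) (simp add: smul_apply)
qed

lemma sigma_fields_field: "X \<in> sigma_fields A J g \<theta> \<Longrightarrow> X \<in> fields"
  by (simp add: sigma_fields_def)

lemma U_sigma: "U \<in> sigma_fields A J g \<theta>" and V_sigma: "V \<in> sigma_fields A J g \<theta>"
  using sigma_fieldsI[of 1 0] sigma_fieldsI[of 0 1] funs_0 funs_1 by simp_all

lemma form_sigma:
  assumes \<alpha>: "\<alpha> \<in> one_forms A" and "\<alpha> U = 0" "\<alpha> V = 0" and X: "X \<in> sigma_fields A J g \<theta>"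
  shows "\<alpha> X = 0"
proof -
  have "\<alpha> X = \<alpha> (\<theta> X \<cdot>\<^sub>v U + \<theta>c X \<cdot>\<^sub>v V)" by (subst sigma_fields_decomp[OF X]) (rule refl)
  then show ?thesis
    using assms by (simp add: form_rules[OF \<alpha>] vf_smul lee_rules theta_c_rules U_field V_field)
qed

lemma basic_one_formsD:
  assumes "\<zeta> \<in> basic_one_forms A J g \<theta>"
  shows basic_form: "\<zeta> \<in> one_forms A" and basic_U: "\<zeta> U = 0" and basic_V: "\<zeta> V = 0"
    and basic_lie_U: "Y \<in> fields \<Longrightarrow> \<zeta> (bracket U Y) = U (\<zeta> Y)"
    and basic_lie_V: "Y \<in> fields \<Longrightarrow> \<zeta> (bracket V Y) = V (\<zeta> Y)"
  using assms U_sigma V_sigma by (auto simp: basic_one_forms_def lie1_def)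

text \<open>For a form vanishing on \<open>X\<close>, Cartan's formula reduces the Lie derivative
  along \<open>X\<close> to the contraction of the exterior derivative. That is tensorial in
  \<open>X\<close>, so testing on \<open>U\<close> and \<open>V\<close> is enough.\<close>

lemma basic_one_formsI:
  assumes \<zeta>: "\<zeta> \<in> one_forms A" and U: "\<zeta> U = 0" "\<And>Y. Y \<in> fields \<Longrightarrow> d1 A \<zeta> U Y = 0"
    and V: "\<zeta> V = 0" "\<And>Y. Y \<in> fields \<Longrightarrow> d1 A \<zeta> V Y = 0"
  shows "\<zeta> \<in> basic_one_forms A J g \<theta>"
proof -
  have "lie1 X \<zeta> Y = 0" if X: "X \<in> sigma_fields A J g \<theta>" and Y: "Y \<in> fields" for X Y
  proof -
    have "d1 A \<zeta> X Y = 0"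
      by (rule form_sigma[OF bilinear_left[OF two_form_bilinear[OF d1_two_forms[OF \<zeta>]]] _ _ X])
        (use U V Y in auto)
    then show ?thesis
      using form_sigma[OF \<zeta> U(1) V(1) X] sigma_fields_field[OF X] Y
      by (simp add: d1_eq lie1_def field_rules[OF Y])
  qed
  then show ?thesis using form_sigma[OF \<zeta> U(1) V(1)] \<zeta> by (simp add: basic_one_forms_def)
qed

text \<open>Since d\<alpha> is closed, its Lie derivative along \<open>X\<close> is the derivative
  of its contraction with \<open>X\<close>, which is zero. The sign is that of the transverse form
  of a deformation.\<close>

lemma exact_basic_two_forms:
  assumes \<alpha>: "\<alpha> \<in> one_forms A"
    and "\<And>Y. Y \<in> fields \<Longrightarrow> d1 A \<alpha> U Y = 0" "\<And>Y. Y \<in> fields \<Longrightarrow> d1 A \<alpha> V Y = 0"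
  shows "- d1 A \<alpha> \<in> basic_two_forms A J g \<theta>"
proof -
  note two = d1_two_forms[OF \<alpha>]
  have vanish: "d1 A \<alpha> X Y = 0" if X: "X \<in> sigma_fields A J g \<theta>" for X Y
  proof (cases "Y \<in> fields")
    case True
    show ?thesis
      by (rule form_sigma[OF bilinear_left[OF two_form_bilinear[OF two]] _ _ X]) (use assms True in auto)
  qed (simp add: d1_def)
  have "lie2 X (- d1 A \<alpha>) Y Z = 0" if X: "X \<in> sigma_fields A J g \<theta>" and Y: "Y \<in> fields" and Z: "Z \<in> fields"
    for X Y Z
  proof -
    note XF = sigma_fields_field[OF X]
    have "X (d1 A \<alpha> Y Z) - d1 A \<alpha> (bracket X Y) Z + d1 A \<alpha> (bracket X Z) Y = 0"
      using d2_d1[OF \<alpha> XF Y Z] two_form_skew[OF two, of X "bracket Y Z"] vanish[OF X]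
      by (simp add: field_rules[OF Y] field_rules[OF Z])
    then show ?thesis
      using two_form_skew[OF two, of "bracket X Z" Y]
      by (simp add: lie2_def field_rules[OF XF] form_funs[OF d1_form[OF \<alpha>]])
        (simp add: algebra_simps eq_neg_iff_add_eq_0)
  qed
  then show ?thesis
    using vanish two_forms_uminus[OF two] unfolding basic_two_forms_def by (simp add: fun_eq_iff)
qed

end

subsection \<open>Deformations\<close>

context closed_manifold
begin

section \<open>A criterion for Vaisman structures\<close>

text \<open>The data are \<open>J\<close>, \<theta> and \<open>U\<close>; the metric is built from
  them. Invariance of d\<alpha> under \<open>J\<close> makes \<open>g\<close> symmetric,
  \<open>J\<close> exchanging \<theta> and \<alpha> up to sign makes it Hermitian, and
  \<open>U\<close> in the kernel of d\<alpha> makes \<open>U\<close> dual to \<theta>.\<close>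

lemma vaisman_structureI:
  fixes J :: "'m endo" and \<theta> :: "'m form1"
  defines "\<alpha> \<equiv> theta_c J \<theta>"
  defines "g \<equiv> \<lambda>X Y. \<theta> X * \<theta> Y + \<alpha> X * \<alpha> Y - d1 A \<alpha> X (J Y)"
  assumes dim: "DIM('e) div 2 \<ge> 2" and J: "complex_structure A J"
    and \<theta>: "\<theta> \<in> one_forms A" "d1 A \<theta> = 0" "\<not> (\<exists>f\<in>funs. \<theta> = d0 A f)"
    and U: "U \<in> fields" "\<theta> U = 1" "\<theta> (J U) = 0"
    and lie_J: "\<And>Y. Y \<in> fields \<Longrightarrow> bracket U (J Y) = J (bracket U Y)"
    and d\<alpha>_U: "\<And>Y. Y \<in> fields \<Longrightarrow> d1 A \<alpha> U Y = 0"
    and d\<alpha>_J: "\<And>X Y. X \<in> fields \<Longrightarrow> Y \<in> fields \<Longrightarrow> d1 A \<alpha> (J X) (J Y) = d1 A \<alpha> X Y"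
    and pos: "\<And>X p. X \<in> fields \<Longrightarrow> nonzero_at X p \<Longrightarrow> g X X p > 0"
  shows "vaisman_structure A J g \<theta>" and "field_U A g \<theta> = U"
proof -
  have endo: "J \<in> endos A" and JJ: "\<And>X. X \<in> fields \<Longrightarrow> J (J X) = - X"
    using J unfolding complex_structure_def by auto
  note J_rules = endo_rules[OF endo]
  note \<theta>_rules = form_rules[OF \<theta>(1)]
  have \<alpha>: "\<alpha> \<in> one_forms A"
  proof -
    have "\<alpha> = - (\<lambda>X. \<theta> (J X))" by (simp add: \<alpha>_def theta_c_def fun_eq_iff)
    then show ?thesis using one_forms_uminus[OF one_forms_comp[OF \<theta>(1) endo]] by simp
  qed
  note \<alpha>_rules = form_rules[OF \<alpha>]
  have \<theta>_J: "\<theta> (J X) = - \<alpha> X" for X by (simp add: \<alpha>_def theta_c_def)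
  have \<alpha>_J: "\<alpha> (J X) = \<theta> X" if "X \<in> fields" for X
    using that by (simp add: \<alpha>_def theta_c_def JJ \<theta>_rules)
  have \<alpha>_U: "\<alpha> U = 0" using U(3) \<theta>_J[of U] by simp
  note two = d1_two_forms[OF \<alpha>]
  note d\<alpha>_bil = two_form_bilinear[OF two]
  note d\<alpha>_rules = bilinear_simps[OF d\<alpha>_bil]
  have d\<alpha>_J_swap: "d1 A \<alpha> Y (J X) = d1 A \<alpha> X (J Y)" if X: "X \<in> fields" and Y: "Y \<in> fields" for X Y
    using d\<alpha>_J[of X "J Y"] two_form_skew[OF two, of "J X" Y] X Y
    by (simp add: J_rules JJ d\<alpha>_rules del: uminus_apply)
  have \<theta>_bracket: "\<theta> (bracket X Y) = X (\<theta> Y) - Y (\<theta> X)" if "X \<in> fields" "Y \<in> fields" for X Y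
    using fun_cong[OF fun_cong[OF \<theta>(2)], of X Y] that by (simp add: d1_eq)
  have \<alpha>_bracket: "\<alpha> (bracket X Y) = X (\<alpha> Y) - Y (\<alpha> X) - d1 A \<alpha> X Y"
    if "X \<in> fields" "Y \<in> fields" for X Y
    using that by (simp add: d1_eq)
  have g_sym: "g X Y = g Y X" for X Y
  proof (cases "X \<in> fields \<and> Y \<in> fields")
    case True
    then show ?thesis using d\<alpha>_J_swap by (simp add: g_def mult.commute)
  next
    case False
    then show ?thesis
      by (auto simp: g_def \<theta>_rules \<alpha>_rules J_rules d1_outside form_0[OF d1_form[OF \<alpha>]])
  qed
  have g_form: "g X \<in> one_forms A" for X
  proof -
    have "g X = (\<lambda>Y. \<theta> X * \<theta> Y) + (\<lambda>Y. \<alpha> X * \<alpha> Y) - (\<lambda>Y. d1 A \<alpha> X (J Y))"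
      by (simp add: g_def fun_eq_iff)
    then show ?thesis
      by (simp only: one_forms_diff one_forms_add one_forms_scale one_forms_comp endo \<theta>(1) \<alpha>
          \<theta>_rules \<alpha>_rules d1_form[OF \<alpha>])
  qed
  have g_bil: "g \<in> bilinear_forms A"
  proof -
    have "(\<lambda>X. g X Y) = g Y" for Y using g_sym by (rule ext)
    then show ?thesis using g_form by (simp add: bilinear_forms_def)
  qed
  have metric: "riemannian_metric A g"
    unfolding riemannian_metric_def using g_bil g_sym pos by blast
  have g_U: "g U X = \<theta> X" if "X \<in> fields" for X
    using that by (simp add: g_def U \<alpha>_U d\<alpha>_U J_rules)
  have sharp_U: "sharp A g \<theta> = U"
    by (rule sharp_eqI[of g U \<theta>, OF metric U(1) g_U])
  then show "field_U A g \<theta> = U" by (simp add: field_U_def)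
  have hermitian: "g (J X) (J Y) = g X Y" if "X \<in> fields" "Y \<in> fields" for X Y
    using that d\<alpha>_J[of X "J Y"] by (simp add: g_def J_rules \<theta>_J \<alpha>_J)
  define \<omega> where "\<omega> = fundamental_form J g"
  have \<omega>: "\<omega> X Y = \<theta> X * \<alpha> Y - \<alpha> X * \<theta> Y - d1 A \<alpha> X Y" if "X \<in> fields" "Y \<in> fields" for X Y
    using that by (simp add: \<omega>_def fundamental_form_def g_def J_rules \<theta>_J \<alpha>_J d\<alpha>_J fun_eq_iff)
  \<comment> \<open>With \<omega> = \<theta> \<and> \<alpha> - d\<alpha> and \<theta> closed, both
    sides equal -\<theta> \<and> d\<alpha>.\<close>
  have lck: "d2 A \<omega> = wedge12 \<theta> \<omega>"
  proof (intro ext)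
    fix X Y Z p
    show "d2 A \<omega> X Y Z p = wedge12 \<theta> \<omega> X Y Z p"
    proof (cases "X \<in> fields \<and> Y \<in> fields \<and> Z \<in> fields")
      case True
      then have X: "X \<in> fields" and Y: "Y \<in> fields" and Z: "Z \<in> fields" by auto
      note rules = field_rules[OF X] field_rules[OF Y] field_rules[OF Z] \<theta>_rules \<alpha>_rules
        form_funs[OF d1_form[OF \<alpha>]] funs_mult funs_diff vf_bracket X Y Z
      have "d2 A \<omega> X Y Z = wedge12 \<theta> \<omega> X Y Z"
        using d2_d1[OF \<alpha> X Y Z]
        by (simp add: d2_def wedge12_def \<omega> rules, simp add: \<theta>_bracket \<alpha>_bracket rules algebra_simps)
      then show ?thesis by simp
    next
      case False
      have "\<omega> P Q = 0" if "P \<notin> fields \<or> Q \<notin> fields" for P Q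
        using that by (auto simp: \<omega>_def fundamental_form_def J_rules g_sym[of 0 Q] form_0[OF g_form]
            form_outside[OF g_form])
      then show ?thesis using False by (auto simp: d2_def wedge12_def \<theta>_rules)
    qed
  qed
  \<comment> \<open>Every ingredient of \<open>g\<close>, namely \<theta>, \<alpha>, d\<alpha> and
    \<open>J\<close>, is invariant along \<open>U\<close>.\<close>
  have killing: "U (g X Y) = g (bracket U X) Y + g X (bracket U Y)" if X: "X \<in> fields" and Y: "Y \<in> fields" for X Y
  proof -
    have lie_d\<alpha>: "U (d1 A \<alpha> X W) = d1 A \<alpha> (bracket U X) W + d1 A \<alpha> X (bracket U W)" if W: "W \<in> fields" for W
      using d2_d1[OF \<alpha> U(1) X W] two_form_skew[OF two, of X "bracket U W"]
        two_form_skew[OF two, of U "bracket X W"] X W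
      by (simp add: d\<alpha>_U vf_bracket field_rules[OF X] field_rules[OF W] algebra_simps)
    have "\<theta> (bracket U W) = U (\<theta> W)" "\<alpha> (bracket U W) = U (\<alpha> W)" if "W \<in> fields" for W
      using that by (simp_all add: \<theta>_bracket \<alpha>_bracket U \<alpha>_U d\<alpha>_U field_rules[OF that])
    then show ?thesis
      using X Y lie_d\<alpha>[of "J Y"]
      by (simp add: g_def J_rules lie_J[symmetric] field_rules[OF U(1)] \<theta>_rules \<alpha>_rules
          form_funs[OF d1_form[OF \<alpha>]] funs_mult funs_add algebra_simps)
  qed
  obtain D where D: "levi_civita A g D" using levi_civita_exists[OF metric] by blast
  have D_field: "D X Y \<in> fields" if "X \<in> fields" "Y \<in> fields" for X Y
    using D that unfolding levi_civita_def affine_connection_def by blast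
  have compat: "X (g Y Z) = g (D X Y) Z + g Y (D X Z)" if "X \<in> fields" "Y \<in> fields" "Z \<in> fields" for X Y Z
    using D that unfolding levi_civita_def by blast
  have torsion: "D X Y = bracket X Y + D Y X" if "X \<in> fields" "Y \<in> fields" for X Y
  proof -
    have "D X Y - D Y X = bracket X Y" using D that unfolding levi_civita_def by blast
    then show ?thesis by (simp add: algebra_simps)
  qed
  note g_rules = bilinear_simps[OF g_bil]
  have "parallel_form A D \<theta>"
    unfolding parallel_form_def
  proof (intro ballI)
    have cov: "X (\<theta> Y) = g (D X U) Y + \<theta> (D X Y)" if "X \<in> fields" "Y \<in> fields" for X Y
      using compat[OF that(1) U(1) that(2)] that by (simp add: g_U D_field)
    fix X Y assume X: "X \<in> fields" and Y: "Y \<in> fields"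
    have "\<theta> (D X Y) = \<theta> (bracket X Y) + \<theta> (D Y X)"
      unfolding torsion[OF X Y] using X Y by (simp add: \<theta>_rules vf_bracket D_field)
    \<comment> \<open>Closedness of \<theta> makes g(D_X U, Y) symmetric in \<open>X\<close> and
      \<open>Y\<close>; the Killing equation makes it skew, so it vanishes.\<close>
    then have sym: "g (D X U) Y = g (D Y U) X"
      using cov[OF X Y] cov[OF Y X] by (simp add: \<theta>_bracket[OF X Y] algebra_simps)
    have "U (g X Y) = g (bracket U X + D X U) Y + g X (bracket U Y + D Y U)"
      using compat[OF U(1) X Y] torsion[OF U(1) X] torsion[OF U(1) Y] by simp
    then have "g (D X U) Y + g (D Y U) X = 0"
      using killing[OF X Y] g_sym[of X "D Y U"] X Y U(1) by (simp add: g_rules vf_bracket D_field)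
    then have "g (D X U) Y = 0" using sym by (simp add: fun_eq_iff)
    then show "X (\<theta> Y) - \<theta> (D X Y) = 0" using cov[OF X Y] by simp
  qed
  moreover have "form_norm A g \<theta> p = 1" for p
    by (simp add: form_norm_def sharp_U g_U U)
  ultimately show "vaisman_structure A J g \<theta>"
    unfolding vaisman_structure_def lck_structure_def hermitian_structure_def
    using dim J metric hermitian \<theta> lck D unfolding \<omega>_def by blast
qed

end

context vaisman
begin

section \<open>From basic forms to deformations\<close>

definition twist_J :: "'m form1 \<Rightarrow> 'm endo" where
  "twist_J \<zeta> = (\<lambda>X. J X - (\<zeta> X \<cdot>\<^sub>v U + \<zeta> (J X) \<cdot>\<^sub>v V))"

definition twist_g :: "'m form1 \<Rightarrow> 'm form2" where
  "twist_g \<zeta> = (\<lambda>X Y. \<theta> X * \<theta> Y + (\<theta>c + \<zeta>) X * (\<theta>c + \<zeta>) Y - d1 A (\<theta>c + \<zeta>) X (twist_J \<zeta> Y))"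

lemma twist_J_endo:
  assumes \<zeta>: "\<zeta> \<in> one_forms A"
  shows "twist_J \<zeta> \<in> endos A"
  unfolding endos_def
proof (intro CollectI conjI ballI allI impI)
  note rules = form_rules[OF \<zeta>] J_rules
  fix X assume X: "X \<in> fields"
  show "twist_J \<zeta> X \<in> fields" unfolding twist_J_def
    by (intro vf_diff vf_add vf_smul U_field V_field) (simp_all add: rules)
  show "twist_J \<zeta> (X + Y) = twist_J \<zeta> X + twist_J \<zeta> Y" if "Y \<in> fields" for Y
    using X that by (simp add: twist_J_def rules smul.scale_left_distrib)
  show "twist_J \<zeta> (f \<cdot>\<^sub>v X) = f \<cdot>\<^sub>v twist_J \<zeta> X" if "f \<in> funs" for f
    using X that by (simp add: twist_J_def rules smul.scale_right_diff_distrib smul.scale_right_distrib)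
next
  fix X assume "X \<notin> fields"
  then show "twist_J \<zeta> X = 0" by (simp add: twist_J_def form_rules[OF \<zeta>] J_rules)
qed

lemma twist_theta_c:
  assumes \<zeta>: "\<zeta> \<in> one_forms A"
  shows "theta_c (twist_J \<zeta>) \<theta> = \<theta>c + \<zeta>"
proof
  fix X
  show "theta_c (twist_J \<zeta>) \<theta> X = (\<theta>c + \<zeta>) X"
    by (simp add: theta_c_def twist_J_def lee_rules vf_smul vf_add form_rules[OF \<zeta>] J_rules U_field V_field
        lee_U lee_V)
qed

lemma twist_J_U: "\<zeta> U = 0 \<Longrightarrow> \<zeta> V = 0 \<Longrightarrow> twist_J \<zeta> U = V"
  by (simp add: twist_J_def flip: V_eq)

text \<open>As \<open>U\<close> and \<open>V\<close> are commuting symmetries of \<open>J\<close>,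
  twisting changes the Nijenhuis tensor only along \<open>U\<close> and \<open>V\<close>. Up to sign
  the coefficients are d\<zeta>(JX, Y) + d\<zeta>(X, JY) and d\<zeta>(JX, JY) - d\<zeta>(X, Y), and
  both vanish for d\<zeta> of type (1,1).\<close>

lemma twist_J_complex:
  assumes basic: "\<zeta> \<in> basic_one_forms A J g \<theta>"
    and inv: "\<And>X Y. X \<in> fields \<Longrightarrow> Y \<in> fields \<Longrightarrow> d1 A \<zeta> (J X) (J Y) = d1 A \<zeta> X Y"
  shows "complex_structure A (twist_J \<zeta>)"
  unfolding complex_structure_def
proof (intro conjI ballI)
  note \<zeta> = basic_form[OF basic]
  note \<zeta>_rules = form_rules[OF \<zeta>]
  note \<zeta>_UV = basic_U[OF basic] basic_V[OF basic]
  show endo': "twist_J \<zeta> \<in> endos A" by (rule twist_J_endo[OF \<zeta>])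
  show "twist_J \<zeta> (twist_J \<zeta> X) = - X" if X: "X \<in> fields" for X
  proof -
    have "J (twist_J \<zeta> X) = - X - \<zeta> X \<cdot>\<^sub>v V + \<zeta> (J X) \<cdot>\<^sub>v U"
      using X by (simp add: twist_J_def J_rules vf_smul vf_add \<zeta>_rules U_field V_field J_J J_V
          smul.scale_right_diff_distrib smul.scale_minus_right algebra_simps flip: V_eq)
    moreover have "\<zeta> (twist_J \<zeta> X) = \<zeta> (J X)"
      using X by (simp add: twist_J_def J_rules vf_smul vf_add \<zeta>_rules U_field V_field \<zeta>_UV)
    moreover have "\<zeta> (J (twist_J \<zeta> X)) = - \<zeta> X"
      using X by (simp add: calculation(1) vf_intros \<zeta>_rules U_field V_field \<zeta>_UV)
    ultimately show ?thesis
      by (simp add: twist_J_def[of \<zeta>, THEN fun_cong, of "twist_J \<zeta> X"] smul.scale_minus_left)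
  qed
  fix X Y assume X: "X \<in> fields" and Y: "Y \<in> fields"
  note UV = U_field V_field
  define a b c e where abce: "a = \<zeta> X" "b = \<zeta> (J X)" "c = \<zeta> Y" "e = \<zeta> (J Y)"
  have funs: "a \<in> funs" "b \<in> funs" "c \<in> funs" "e \<in> funs" by (simp_all add: abce \<zeta>_rules)
  have JXY: "J X \<in> fields" "J Y \<in> fields" by (simp_all add: J_rules)
  define TX where "TX = a \<cdot>\<^sub>v U + b \<cdot>\<^sub>v V"
  define TY where "TY = c \<cdot>\<^sub>v U + e \<cdot>\<^sub>v V"
  have T: "TX \<in> fields" "TY \<in> fields" by (simp_all add: TX_def TY_def vf_add vf_smul funs UV)
  have twist: "twist_J \<zeta> X = J X - TX" "twist_J \<zeta> Y = J Y - TY"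
    by (simp_all add: twist_J_def TX_def TY_def abce)
  have T_bracket: "bracket (k \<cdot>\<^sub>v U + l \<cdot>\<^sub>v V) Z = k \<cdot>\<^sub>v bracket U Z + l \<cdot>\<^sub>v bracket V Z - (Z k \<cdot>\<^sub>v U + Z l \<cdot>\<^sub>v V)"
    if "k \<in> funs" "l \<in> funs" "Z \<in> fields" for k l Z
    using that by (simp add: bracket_simps vf_smul UV algebra_simps)
  \<comment> \<open>\<zeta> and its composition with \<open>J\<close> are both invariant along
    \<open>U\<close> and \<open>V\<close>; this makes the terms quadratic in \<zeta> cancel in the
    end.\<close>
  have lie: "\<zeta> (bracket U Z) = U (\<zeta> Z)" "\<zeta> (bracket V Z) = V (\<zeta> Z)"
    "\<zeta> (J (bracket U Z)) = U (\<zeta> (J Z))" "\<zeta> (J (bracket V Z)) = V (\<zeta> (J Z))" if "Z \<in> fields" for Z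
    using that basic_lie_U[OF basic, of "J Z"] basic_lie_V[OF basic, of "J Z"]
    by (simp_all add: basic_lie_U[OF basic] basic_lie_V[OF basic] bracket_U_J bracket_V_J J_rules)
  have U_T: "bracket U TY = U c \<cdot>\<^sub>v U + U e \<cdot>\<^sub>v V" "bracket V TY = V c \<cdot>\<^sub>v U + V e \<cdot>\<^sub>v V"
    using bracket_U_V bracket_anticomm[of V U]
    by (simp_all add: TY_def bracket_simps vf_smul funs UV)
  have TT: "bracket TX TY = a \<cdot>\<^sub>v bracket U TY + b \<cdot>\<^sub>v bracket V TY - (TY a \<cdot>\<^sub>v U + TY b \<cdot>\<^sub>v V)"
    unfolding TX_def by (rule T_bracket[OF funs(1,2) T(2)])
  have TY_app: "TY k = c * U k + e * V k" for k by (simp add: TY_def smul_apply)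
  have XT: "bracket Z TY = (Z c \<cdot>\<^sub>v U + Z e \<cdot>\<^sub>v V) - (c \<cdot>\<^sub>v bracket U Z + e \<cdot>\<^sub>v bracket V Z)" if "Z \<in> fields" for Z
    using T_bracket[OF funs(3,4) that] bracket_anticomm[of Z TY] by (simp add: TY_def)
  have TX: "bracket TX Z = a \<cdot>\<^sub>v bracket U Z + b \<cdot>\<^sub>v bracket V Z - (Z a \<cdot>\<^sub>v U + Z b \<cdot>\<^sub>v V)" if "Z \<in> fields" for Z
    unfolding TX_def by (rule T_bracket[OF funs(1,2) that])
  define W1 where "W1 = bracket (twist_J \<zeta> X) Y"
  define W2 where "W2 = bracket X (twist_J \<zeta> Y)"
  have W1: "W1 = bracket (J X) Y - (a \<cdot>\<^sub>v bracket U Y + b \<cdot>\<^sub>v bracket V Y - (Y a \<cdot>\<^sub>v U + Y b \<cdot>\<^sub>v V))"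
    by (simp add: W1_def twist bracket_diff_left JXY T Y TX)
  have W2: "W2 = bracket X (J Y) - ((X c \<cdot>\<^sub>v U + X e \<cdot>\<^sub>v V) - (c \<cdot>\<^sub>v bracket U X + e \<cdot>\<^sub>v bracket V X))"
    by (simp add: W2_def twist bracket_diff_right JXY T X XT)
  note membership = vf_smul vf_add vf_diff vf_bracket UV X Y JXY funs field_rules[OF X] field_rules[OF Y]
  have JW1: "J W1 = J (bracket (J X) Y) - (a \<cdot>\<^sub>v J (bracket U Y) + b \<cdot>\<^sub>v J (bracket V Y) - (Y a \<cdot>\<^sub>v V - Y b \<cdot>\<^sub>v U))"
    by (simp add: W1 membership endo_add[OF endo] endo_diff[OF endo] endo_smul[OF endo] J_V flip: V_eq)
  have JW2: "J W2 = J (bracket X (J Y)) - ((X c \<cdot>\<^sub>v V - X e \<cdot>\<^sub>v U) - (c \<cdot>\<^sub>v J (bracket U X) + e \<cdot>\<^sub>v J (bracket V X)))"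
    by (simp add: W2 membership endo_add[OF endo] endo_diff[OF endo] endo_smul[OF endo] J_V flip: V_eq)
  have \<zeta>W1: "\<zeta> W1 = \<zeta> (bracket (J X) Y) - (a * U c + b * V c)"
    "\<zeta> (J W1) = \<zeta> (J (bracket (J X) Y)) - (a * U e + b * V e)"
    by (simp add: W1 membership \<zeta>_rules \<zeta>_UV lie abce)
      (simp add: JW1 membership J_rules \<zeta>_rules \<zeta>_UV lie abce)
  have \<zeta>W2: "\<zeta> W2 = \<zeta> (bracket X (J Y)) + (c * U a + e * V a)"
    "\<zeta> (J W2) = \<zeta> (J (bracket X (J Y))) + (c * U b + e * V b)"
    by (simp add: W2 membership \<zeta>_rules \<zeta>_UV lie abce)
      (simp add: JW2 membership J_rules \<zeta>_rules \<zeta>_UV lie abce)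
  have B: "bracket (twist_J \<zeta> X) (twist_J \<zeta> Y) = bracket (J X) (J Y)
      - (a \<cdot>\<^sub>v J (bracket U Y) + b \<cdot>\<^sub>v J (bracket V Y) - (J Y a \<cdot>\<^sub>v U + J Y b \<cdot>\<^sub>v V))
      - ((J X c \<cdot>\<^sub>v U + J X e \<cdot>\<^sub>v V) - (c \<cdot>\<^sub>v J (bracket U X) + e \<cdot>\<^sub>v J (bracket V X)))
      + bracket TX TY"
    by (simp add: twist bracket_diff_left bracket_diff_right vf_diff JXY T TX[OF JXY(2)] XT[OF JXY(1)]
        bracket_U_J bracket_V_J X Y algebra_simps)
  have nij: "bracket (J X) (J Y) = J (bracket (J X) Y) + J (bracket X (J Y)) + bracket X Y"
    using nijenhuis[OF X Y] by (simp add: algebra_simps)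
  have \<zeta>_nij: "\<zeta> (bracket (J X) (J Y)) = \<zeta> (J (bracket (J X) Y)) + \<zeta> (J (bracket X (J Y))) + \<zeta> (bracket X Y)"
    unfolding nij by (simp add: \<zeta>_rules vf_add vf_bracket J_rules X Y)
  have "d1 A \<zeta> X (J Y) = - d1 A \<zeta> (J X) Y"
    using inv[OF X JXY(2)] X Y
    by (simp add: J_J bilinear_simps[OF two_form_bilinear[OF d1_two_forms[OF \<zeta>]]])
  then have dU: "d1 A \<zeta> (J X) Y + d1 A \<zeta> X (J Y) = 0" by (simp del: uminus_apply)
  have PU: "J X c - Y b - \<zeta> (bracket (J X) Y) + (X e - J Y a - \<zeta> (bracket X (J Y))) = 0"
    using dU by (simp add: d1_eq X Y JXY abce)
  have PV: "J X e - J Y b - \<zeta> (bracket (J X) (J Y)) = X c - Y a - \<zeta> (bracket X Y)"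
    using inv[OF X Y] by (simp add: d1_eq X Y JXY abce)
  show "bracket (twist_J \<zeta> X) (twist_J \<zeta> Y) - twist_J \<zeta> (bracket (twist_J \<zeta> X) Y)
      - twist_J \<zeta> (bracket X (twist_J \<zeta> Y)) - bracket X Y = 0"
    (is "?N = 0")
  proof (intro ext)
    fix f p
    have "?N f p = - (J X c - Y b - \<zeta> (bracket (J X) Y) + (X e - J Y a - \<zeta> (bracket X (J Y)))) p * U f p
       - (J X e - J Y b - (\<zeta> (J (bracket (J X) Y)) + \<zeta> (J (bracket X (J Y)))) - (X c - Y a)) p * V f p"
      unfolding W1_def[symmetric] W2_def[symmetric] B twist_J_def[of \<zeta>, THEN fun_cong, of W1]
        twist_J_def[of \<zeta>, THEN fun_cong, of W2] \<zeta>W1 \<zeta>W2 TT U_T TY_app nij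
      unfolding JW1 JW2 by (simp add: smul_apply algebra_simps)
    moreover have "(J X e - J Y b - (\<zeta> (J (bracket (J X) Y)) + \<zeta> (J (bracket X (J Y)))) - (X c - Y a)) = 0"
      using PV unfolding \<zeta>_nij by (simp add: algebra_simps)
    ultimately show "?N f p = 0 f p" unfolding PU by simp
  qed
qed

lemma twist_vaisman:
  assumes "\<zeta> \<in> deformation_forms A J g \<theta>"
  shows "vaisman_structure A (twist_J \<zeta>) (twist_g \<zeta>) \<theta>" and "field_U A (twist_g \<zeta>) \<theta> = U"
proof -
  define \<alpha> where "\<alpha> = \<theta>c + \<zeta>"
  have basic: "\<zeta> \<in> basic_one_forms A J g \<theta>"
    and positive: "positive_wrt A J g \<theta> (\<omega>\<^sub>0 - d1 A \<zeta>)"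
    using assms by (auto simp: deformation_forms_def)
  note \<zeta> = basic_form[OF basic]
  note \<zeta>_rules = form_rules[OF \<zeta>]
  note \<zeta>_UV = basic_U[OF basic] basic_V[OF basic]
  have \<alpha>: "\<alpha> \<in> one_forms A" unfolding \<alpha>_def by (rule one_forms_add[OF theta_c_form \<zeta>])
  have d\<alpha>_eq: "\<omega>\<^sub>0 - d1 A \<zeta> = - d1 A \<alpha>"
    unfolding \<alpha>_def d1_add[OF theta_c_form \<zeta>] by (simp add: omega0_def)
  note two = d1_two_forms[OF \<alpha>]
  note d\<alpha>_rules = bilinear_simps[OF two_form_bilinear[OF two]]
  have d\<alpha>_J: "d1 A \<alpha> (J X) (J Y) = d1 A \<alpha> X Y" if "X \<in> fields" "Y \<in> fields" for X Y
    using positive that unfolding positive_wrt_def basic_11_forms_def d\<alpha>_eq by simp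
  have "- d1 A \<alpha> \<in> basic_two_forms A J g \<theta>"
    using positive unfolding positive_wrt_def basic_11_forms_def d\<alpha>_eq by simp
  then have "(- d1 A \<alpha>) X = 0" if "X \<in> sigma_fields A J g \<theta>" for X
    using that unfolding basic_two_forms_def by blast
  then have d\<alpha>_sigma: "d1 A \<alpha> X Y = 0" if "X \<in> sigma_fields A J g \<theta>" for X Y
    using that by (simp add: fun_eq_iff)
  have d\<alpha>_U: "d1 A \<alpha> U Y = 0" "d1 A \<alpha> V Y = 0" "d1 A \<alpha> Y U = 0" "d1 A \<alpha> Y V = 0" for Y
    using d\<alpha>_sigma[OF U_sigma] d\<alpha>_sigma[OF V_sigma] two_form_skew[OF two, of U Y] two_form_skew[OF two, of V Y]
    by simp_all
  \<comment> \<open>Positivity includes the type (1,1) of the whole transverse form; subtracting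
    that of the given structure leaves d\<zeta>.\<close>
  have d\<zeta>_J: "d1 A \<zeta> (J X) (J Y) = d1 A \<zeta> X Y" if "X \<in> fields" "Y \<in> fields" for X Y
  proof -
    have "d1 A \<zeta> = d1 A \<alpha> + \<omega>\<^sub>0" using d\<alpha>_eq by (simp add: algebra_simps)
    then show ?thesis using d\<alpha>_J[OF that] omega0_J[OF that] by simp
  qed
  have theta_c: "theta_c (twist_J \<zeta>) \<theta> = \<alpha>" by (simp add: \<alpha>_def twist_theta_c[OF \<zeta>])
  \<comment> \<open>The twist is tangent to the foliation, hence invisible to d\<alpha>.\<close>
  have d\<alpha>_twist: "d1 A \<alpha> Y (twist_J \<zeta> X) = d1 A \<alpha> Y (J X)" "d1 A \<alpha> (twist_J \<zeta> X) Y = d1 A \<alpha> (J X) Y"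
    if "X \<in> fields" for X Y
    using that by (simp_all add: twist_J_def d\<alpha>_rules J_rules vf_add vf_smul \<zeta>_rules U_field V_field d\<alpha>_U fun_eq_iff)
  have d\<alpha>_J': "d1 A \<alpha> (twist_J \<zeta> X) (twist_J \<zeta> Y) = d1 A \<alpha> X Y" if "X \<in> fields" "Y \<in> fields" for X Y
    using that by (simp add: d\<alpha>_twist d\<alpha>_J)
  have lie: "bracket U (twist_J \<zeta> Y) = twist_J \<zeta> (bracket U Y)" if Y: "Y \<in> fields" for Y
    using Y basic_lie_U[OF basic, of Y] basic_lie_U[OF basic, of "J Y"]
    by (simp add: twist_J_def bracket_simps vf_add vf_smul U_field V_field \<zeta>_rules J_rules bracket_U_V bracket_U_J)
  have g_eq: "twist_g \<zeta> = (\<lambda>X Y. \<theta> X * \<theta> Y + \<alpha> X * \<alpha> Y - d1 A \<alpha> X (twist_J \<zeta> Y))"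
    by (simp add: twist_g_def \<alpha>_def)
  have pos: "\<theta> X p * \<theta> X p + \<alpha> X p * \<alpha> X p - d1 A \<alpha> X (twist_J \<zeta> X) p > 0"
    if X: "X \<in> fields" and nz: "nonzero_at X p" for X p
  proof -
    \<comment> \<open>The transverse term of the metric depends only on the normal part
      \<open>N\<close> of \<open>X\<close>, where positivity of the deformed form applies. If
      \<open>N\<close> vanishes at \<open>p\<close>, so does \<open>\<zeta> X\<close>; then \<alpha>
      agrees there with \<open>\<theta>c\<close>, and the two squares cannot both be 0.\<close>
    define N where "N = X - (\<theta> X \<cdot>\<^sub>v U + \<theta>c X \<cdot>\<^sub>v V)"
    have N: "N \<in> fields" unfolding N_def
      by (intro vf_diff vf_add vf_smul X U_field V_field) (simp_all add: lee_rules theta_c_rules)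
    have X_eq: "X = N + (\<theta> X \<cdot>\<^sub>v U + \<theta>c X \<cdot>\<^sub>v V)" by (simp add: N_def)
    note mem = vf_diff vf_add vf_smul X N U_field V_field lee_rules theta_c_rules J_rules
    have "\<theta> N = 0" "\<theta>c N = 0"
      by (simp_all add: N_def mem lee_U lee_V theta_c_U theta_c_V)
    then have normal: "normal_at A J g \<theta> N p"
      using g_U[OF N] g_V[OF N] g_sym[of N U] g_sym[of N V] by (simp add: normal_at_def)
    have JN: "J N = J X - (\<theta> X \<cdot>\<^sub>v V - \<theta>c X \<cdot>\<^sub>v U)"
      by (simp add: N_def mem J_V flip: V_eq)
    have "d1 A \<alpha> N (J N) = d1 A \<alpha> N (J X)"
      unfolding JN by (simp add: d\<alpha>_rules mem d\<alpha>_U fun_eq_iff)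
    also have "\<dots> = d1 A \<alpha> X (J X)"
      by (simp add: N_def d\<alpha>_rules mem d\<alpha>_U fun_eq_iff)
    finally have dN: "d1 A \<alpha> X (twist_J \<zeta> X) = d1 A \<alpha> N (J N)" using d\<alpha>_twist(1)[OF X] by simp
    show ?thesis
    proof (cases "nonzero_at N p")
      case True
      then have "(- d1 A \<alpha>) N (J N) p > 0"
        using positive N normal unfolding positive_wrt_def d\<alpha>_eq by blast
      then have "d1 A \<alpha> N (J N) p < 0" by simp
      also have "0 \<le> \<theta> X p * \<theta> X p + \<alpha> X p * \<alpha> X p" by simp
      finally show ?thesis unfolding dN by simp
    next
      case False
      then have N0: "N f p = 0" for f by (simp add: nonzero_at_def)
      have "d1 A \<alpha> N (J N) p = 0"
        by (rule form_tensorial[OF bilinear_left[OF two_form_bilinear[OF two]] N N0])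
      moreover have "\<zeta> X p = 0"
      proof -
        have "\<zeta> N = \<zeta> X" by (simp add: N_def \<zeta>_rules mem \<zeta>_UV)
        then show ?thesis using form_tensorial[OF \<zeta> N N0] by simp
      qed
      moreover have "\<theta> X p \<noteq> 0 \<or> \<theta>c X p \<noteq> 0"
      proof (rule ccontr)
        assume "\<not> (\<theta> X p \<noteq> 0 \<or> \<theta>c X p \<noteq> 0)"
        then have "X f p = 0" for f
          using fun_cong[OF fun_cong[OF X_eq, of f], of p] N0 by (simp add: smul_apply)
        then show False using nz by (simp add: nonzero_at_def)
      qed
      ultimately show ?thesis unfolding dN
        by (auto simp: \<alpha>_def sum_squares_gt_zero_iff)
    qed
  qed
  note twisted = vaisman_structureI[of "twist_J \<zeta>" \<theta> U, unfolded theta_c, folded g_eq,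
      OF complex_dim twist_J_complex[OF basic d\<zeta>_J] lee lee_closed lee_not_exact U_field lee_U]
  show "vaisman_structure A (twist_J \<zeta>) (twist_g \<zeta>) \<theta>" and "field_U A (twist_g \<zeta>) \<theta> = U"
    by (rule twisted;
        simp add: twist_J_U \<zeta>_UV lee_V lie d\<alpha>_U d\<alpha>_J' pos[simplified] g_eq)+
qed

lemma twist_deformation:
  assumes "\<zeta> \<in> deformation_forms A J g \<theta>"
  shows "(twist_J \<zeta>, twist_g \<zeta>, \<theta>) \<in> vaisman_deformations A J g \<theta>"
proof -
  have basic: "\<zeta> \<in> basic_one_forms A J g \<theta>" using assms by (simp add: deformation_forms_def)
  note \<zeta>_rules = form_rules[OF basic_form[OF basic]]
  have "field_V A (twist_J \<zeta>) (twist_g \<zeta>) \<theta> = V"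
    by (simp add: field_V_def[of A "twist_J \<zeta>"] twist_vaisman[OF assms] twist_J_U basic_U[OF basic] basic_V[OF basic])
  moreover have "twist_J \<zeta> X - J X \<in> sigma_fields A J g \<theta>" for X
  proof -
    have "twist_J \<zeta> X - J X = (- \<zeta> X) \<cdot>\<^sub>v U + (- \<zeta> (J X)) \<cdot>\<^sub>v V"
      by (simp add: twist_J_def smul.scale_minus_left)
    then show ?thesis by (simp only: sigma_fieldsI funs_uminus \<zeta>_rules)
  qed
  ultimately show ?thesis
    using twist_vaisman[OF assms] by (simp add: vaisman_deformations_def)
qed

section \<open>Recovering the basic form from a deformation\<close>

text \<open>The anti-Lee form of the twisted structure is \<open>\<theta>c + \<zeta>\<close>, so the
  complex structure alone remembers \<zeta>.\<close>

lemma twist_J_inj: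
  assumes "\<zeta> \<in> one_forms A" "\<eta> \<in> one_forms A" "twist_J \<zeta> = twist_J \<eta>"
  shows "\<zeta> = \<eta>"
proof -
  have "\<theta>c + \<zeta> = \<theta>c + \<eta>"
    using twist_theta_c[OF assms(1)] twist_theta_c[OF assms(2)] unfolding assms(3) by (rule trans[OF sym])
  then show ?thesis by (rule add_left_imp_eq)
qed

text \<open>\<zeta> is the difference of the two anti-Lee forms. The facts on Vaisman structures
  apply to the given and to the deformed one with the same \<open>U\<close> and \<open>V\<close>, so
  both transverse forms annihilate these fields and \<zeta> is basic.\<close>

lemma deformation_is_twist:
  assumes "(J', g', \<theta>') \<in> vaisman_deformations A J g \<theta>"
  shows "\<exists>\<zeta>\<in>deformation_forms A J g \<theta>. (J', g', \<theta>') = (twist_J \<zeta>, twist_g \<zeta>, \<theta>)"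
proof -
  have def: "vaisman_structure A J' g' \<theta>" "\<theta>' = \<theta>" "field_U A g' \<theta> = U" "field_V A J' g' \<theta> = V"
    and J'_sigma: "\<And>X. X \<in> fields \<Longrightarrow> J' X - J X \<in> sigma_fields A J g \<theta>"
    using assms by (auto simp: vaisman_deformations_def)
  interpret D: vaisman A J' g' \<theta> by unfold_locales (rule def(1))
  note D_UV = def(3,4)
  define \<alpha> where "\<alpha> = theta_c J' \<theta>"
  define \<zeta> where "\<zeta> = \<alpha> - \<theta>c"
  have \<alpha>: "\<alpha> \<in> one_forms A" unfolding \<alpha>_def by (rule D.theta_c_form)
  have \<zeta>: "\<zeta> \<in> one_forms A" unfolding \<zeta>_def by (rule one_forms_diff[OF \<alpha> theta_c_form])
  note \<zeta>_rules = form_rules[OF \<zeta>]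
  have \<alpha>_eq: "\<theta>c + \<zeta> = \<alpha>" by (simp add: \<zeta>_def)
  have \<alpha>_UV: "\<alpha> U = 0" "\<alpha> V = 1"
    using D.theta_c_U D.theta_c_V by (simp_all add: \<alpha>_def D_UV)
  have \<zeta>_UV: "\<zeta> U = 0" "\<zeta> V = 0"
    by (simp_all add: \<zeta>_def \<alpha>_UV theta_c_U theta_c_V)
  have d\<alpha>_eq: "\<omega>\<^sub>0 - d1 A \<zeta> = - d1 A \<alpha>"
    unfolding \<alpha>_eq[symmetric] d1_add[OF theta_c_form \<zeta>] by (simp add: omega0_def)
  have D_omega0: "omega0 A J' \<theta> X Y = - d1 A \<alpha> X Y" for X Y
    by (simp add: omega0_def \<alpha>_def)
  note two = d1_two_forms[OF \<alpha>]
  note d\<alpha>_rules = bilinear_simps[OF two_form_bilinear[OF two]]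
  have d\<alpha>_U: "d1 A \<alpha> U Y = 0" "d1 A \<alpha> V Y = 0" if "Y \<in> fields" for Y
    using D.omega0_U[OF that] D.omega0_V[OF that] by (simp_all add: D_UV D_omega0)
  have d\<zeta>_U: "d1 A \<zeta> U Y = 0" "d1 A \<zeta> V Y = 0" if "Y \<in> fields" for Y
  proof -
    have "d1 A \<zeta> = \<omega>\<^sub>0 + d1 A \<alpha>" using d\<alpha>_eq by (simp add: algebra_simps)
    then show "d1 A \<zeta> U Y = 0" "d1 A \<zeta> V Y = 0"
      using that by (simp_all add: d\<alpha>_U omega0_U omega0_V)
  qed
  have basic: "\<zeta> \<in> basic_one_forms A J g \<theta>"
    by (rule basic_one_formsI[OF \<zeta> \<zeta>_UV(1) d\<zeta>_U(1) \<zeta>_UV(2) d\<zeta>_U(2)])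
  have J'_eq: "J' = twist_J \<zeta>"
  proof
    fix X
    show "J' X = twist_J \<zeta> X"
    proof (cases "X \<in> fields")
      case X: True
      note mem = J_rules D.J_rules X
      \<comment> \<open>A field tangent to the foliation is determined by its values under \<theta>
        and \<open>\<theta>c\<close>.\<close>
      have "\<theta> (J' X - J X) = - \<zeta> X"
        using D.lee_J[of X] lee_J[of X] by (simp add: lee_rules mem \<zeta>_def \<alpha>_def)
      moreover have "\<theta>c (J' X - J X) = - \<zeta> (J X)"
      proof -
        have "\<zeta> (J' X - J X) = 0" by (rule form_sigma[OF \<zeta> \<zeta>_UV J'_sigma[OF X]])
        then have "\<zeta> (J' X) = \<zeta> (J X)" by (simp add: \<zeta>_rules mem)
        moreover have "\<theta>c (J' X) = \<theta> X - \<zeta> (J' X)"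
          using D.theta_c_J[OF X] by (simp add: \<zeta>_def \<alpha>_def)
        ultimately show ?thesis using theta_c_J[OF X] by (simp add: theta_c_rules mem)
      qed
      ultimately have "J' X - J X = (- \<zeta> X) \<cdot>\<^sub>v U + (- \<zeta> (J X)) \<cdot>\<^sub>v V"
        using sigma_fields_decomp[OF J'_sigma[OF X]] by simp
      then show ?thesis by (simp add: twist_J_def smul.scale_minus_left algebra_simps)
    next
      case False
      then show ?thesis using endo_outside[OF twist_J_endo[OF \<zeta>]] by (simp add: D.J_rules)
    qed
  qed
  have g'_eq: "g' = twist_g \<zeta>"
  proof (intro ext)
    fix X Y p
    have "g' X Y = twist_g \<zeta> X Y"
    proof (cases "X \<in> fields \<and> Y \<in> fields")
      case True
      then have X: "X \<in> fields" and Y: "Y \<in> fields" by auto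
      \<comment> \<open>The formula for the transverse form, with \<open>J' Y\<close> in the second
        slot, is solved for the metric.\<close>
      have "- d1 A \<alpha> X (J' Y) = g' X Y - \<theta> X * \<theta> Y - \<alpha> Y * \<alpha> X"
        using D.omega0_eq[OF X, of "J' Y"] X Y
        by (simp add: D_omega0 D.J_rules D.hermitian D.theta_c_J D.lee_J \<alpha>_def)
      then show ?thesis
        unfolding twist_g_def \<alpha>_eq J'_eq[symmetric] by (simp add: algebra_simps)
    next
      case False
      then have "g' X Y = 0"
        using form_outside[OF bilinear_left[OF riemannian_bilinear[OF D.metric]], of X Y]
          form_outside[OF bilinear_right[OF riemannian_bilinear[OF D.metric]], of Y X] by auto
      moreover have "twist_g \<zeta> X Y = 0"
        using False unfolding twist_g_def \<alpha>_eq J'_eq[symmetric]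
        by (auto simp: lee_rules form_rules[OF \<alpha>] D.J_rules d1_outside form_0[OF d1_form[OF \<alpha>]])
      ultimately show ?thesis by simp
    qed
    then show "g' X Y p = twist_g \<zeta> X Y p" by simp
  qed
  have d\<alpha>_sigma: "d1 A \<alpha> X Y = 0" if "X \<in> sigma_fields A J g \<theta>" "Y \<in> fields" for X Y
    by (rule form_sigma[OF bilinear_left[OF two_form_bilinear[OF two]] _ _ that(1)])
      (use d\<alpha>_U that in auto)
  have d\<alpha>_J': "d1 A \<alpha> Y (J' X) = d1 A \<alpha> Y (J X)" "d1 A \<alpha> (J' X) Y = d1 A \<alpha> (J X) Y"
    if X: "X \<in> fields" and Y: "Y \<in> fields" for X Y
  proof -
    have "d1 A \<alpha> (J' X - J X) Y = 0" by (rule d\<alpha>_sigma[OF J'_sigma[OF X] Y])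
    then show "d1 A \<alpha> (J' X) Y = d1 A \<alpha> (J X) Y" by (simp add: d\<alpha>_rules J_rules D.J_rules)
    then show "d1 A \<alpha> Y (J' X) = d1 A \<alpha> Y (J X)"
      using two_form_skew[OF two, of Y "J' X"] two_form_skew[OF two, of Y "J X"] by simp
  qed
  have "positive_wrt A J g \<theta> (- d1 A \<alpha>)"
    unfolding positive_wrt_def basic_11_forms_def
  proof (intro conjI CollectI ballI allI impI)
    show "- d1 A \<alpha> \<in> basic_two_forms A J g \<theta>"
      by (rule exact_basic_two_forms[OF \<alpha> d\<alpha>_U])
    show "(- d1 A \<alpha>) (J X) (J Y) = (- d1 A \<alpha>) X Y" if "X \<in> fields" "Y \<in> fields" for X Y
      using D.omega0_J[OF that] d\<alpha>_J'[of X "J' Y"] d\<alpha>_J'[of Y "J X"] that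
      by (simp add: D_omega0 J_rules D.J_rules)
    fix X p assume X: "X \<in> fields" and "normal_at A J g \<theta> X p \<and> nonzero_at X p"
    then have normal: "\<theta> X p = 0" "\<theta>c X p = 0" and nz: "nonzero_at X p"
      using g_U[OF X] g_V[OF X] g_sym[of X U] g_sym[of X V] by (simp_all add: normal_at_def)
    \<comment> \<open>\<open>X\<close> is normal for \<open>g\<close> but perhaps not for
      \<open>g'\<close>. Removing its components along \<open>U\<close> and \<open>V\<close> as
      measured by \<open>g'\<close> makes \<open>\<theta> Y\<close> and \<open>\<alpha> Y\<close>
      vanish identically, so that positivity of \<open>g'\<close> becomes positivity of
      -d\<alpha>.\<close>
    define Y where "Y = X - (\<theta> X \<cdot>\<^sub>v U + \<alpha> X \<cdot>\<^sub>v V)"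
    note mem = vf_diff vf_add vf_smul X U_field V_field lee_rules form_rules[OF \<alpha>] D.J_rules
    have Y: "Y \<in> fields" by (simp add: Y_def mem)
    have Y_UV: "\<theta> Y = 0" "\<alpha> Y = 0"
      by (simp_all add: Y_def mem lee_U lee_V \<alpha>_UV)
    have "nonzero_at Y p"
    \<comment> \<open>If \<open>Y\<close> vanished at \<open>p\<close>, then \<open>X\<close> would
      be a multiple of \<open>V\<close> there, and \<open>\<theta>c X p = 0\<close> would make
      \<open>X\<close> vanish too.\<close>
    proof (rule ccontr)
      assume "\<not> nonzero_at Y p"
      then have "Y f p = 0" for f by (simp add: nonzero_at_def)
      then have X_eq: "X f p = ((\<lambda>_. \<alpha> X p) \<cdot>\<^sub>v V) f p" for f
        using normal by (simp add: Y_def smul_apply)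
      have "\<theta>c X p = \<theta>c ((\<lambda>_. \<alpha> X p) \<cdot>\<^sub>v V) p"
        by (rule form_tensorial_eq[where \<alpha> = \<theta>c, OF theta_c_form X vf_smul[OF funs_const V_field] X_eq])
      then have "\<alpha> X p = 0"
        using normal by (simp add: theta_c_rules funs_const V_field theta_c_V)
      then show False using nz X_eq by (simp add: nonzero_at_def smul_apply)
    qed
    then have "g' Y Y p > 0" by (rule riemannian_pos[OF D.metric Y])
    moreover have "g' Y Y = - d1 A \<alpha> Y (J' Y)"
      unfolding g'_eq twist_g_def \<alpha>_eq J'_eq[symmetric] by (simp add: Y_UV)
    moreover have "d1 A \<alpha> Y (J' Y) = d1 A \<alpha> X (J' X)"
    proof -
      have d\<alpha>_UV: "d1 A \<alpha> Z U = 0" "d1 A \<alpha> Z V = 0" if "Z \<in> fields" for Z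
        using d\<alpha>_U[OF that] two_form_skew[OF two, of U Z] two_form_skew[OF two, of V Z] by simp_all
      have J'Y: "J' Y = J' X - (\<theta> X \<cdot>\<^sub>v V - \<alpha> X \<cdot>\<^sub>v U)"
        using D.J_V D.V_eq by (simp add: Y_def mem D_UV)
      have "d1 A \<alpha> Y (J' Y) = d1 A \<alpha> Y (J' X)"
        unfolding J'Y using Y by (simp add: d\<alpha>_rules mem d\<alpha>_UV fun_eq_iff)
      also have "\<dots> = d1 A \<alpha> X (J' X)"
        by (simp add: Y_def d\<alpha>_rules mem d\<alpha>_U fun_eq_iff)
      finally show ?thesis .
    qed
    moreover have "d1 A \<alpha> X (J' X) = d1 A \<alpha> X (J X)" by (rule d\<alpha>_J'(1)[OF X X])
    ultimately show "(- d1 A \<alpha>) X (J X) p > 0" by simp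
  qed
  then have "\<zeta> \<in> deformation_forms A J g \<theta>"
    using basic by (simp add: deformation_forms_def d\<alpha>_eq)
  then show ?thesis using J'_eq g'_eq def(2) by blast
qed

lemma deformations_bij_betw:
  "bij_betw (\<lambda>\<zeta>. (twist_J \<zeta>, twist_g \<zeta>, \<theta>)) (deformation_forms A J g \<theta>) (vaisman_deformations A J g \<theta>)"
  unfolding bij_betw_def
proof
  show "inj_on (\<lambda>\<zeta>. (twist_J \<zeta>, twist_g \<zeta>, \<theta>)) (deformation_forms A J g \<theta>)"
  proof (rule inj_onI)
    fix \<zeta> \<eta> assume "\<zeta> \<in> deformation_forms A J g \<theta>" "\<eta> \<in> deformation_forms A J g \<theta>"
      "(twist_J \<zeta>, twist_g \<zeta>, \<theta>) = (twist_J \<eta>, twist_g \<eta>, \<theta>)"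
    then show "\<zeta> = \<eta>"
      by (intro twist_J_inj basic_form) (auto simp: deformation_forms_def)
  qed
  show "(\<lambda>\<zeta>. (twist_J \<zeta>, twist_g \<zeta>, \<theta>)) ` deformation_forms A J g \<theta> = vaisman_deformations A J g \<theta>"
    using twist_deformation deformation_is_twist by fast
qed

end

theorem proposition4p2:
  fixes A :: "('m::{t2_space, second_countable_topology}, 'e::euclidean_space) chart set"
    and J :: "'m endo" and g :: "'m form2" and \<theta> :: "'m form1"
  assumes "smooth_atlas A"
    and "compact (UNIV :: 'm set)"
    and "connected (UNIV :: 'm set)"
    and "vaisman_structure A J g \<theta>"
  shows "\<exists>F. bij_betw F (deformation_forms A J g \<theta>) (vaisman_deformations A J g \<theta>)"
proof -
  interpret vaisman A J g \<theta> by unfold_locales (rule assms)+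
  show ?thesis using deformations_bij_betw by blast
qed

end
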